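(* Let $\omega$ be a weight function with constants $K,b$, let $\tau\in(0,1)$, let $E\subset\mathbb{R}^{2N}$ be a Lebesgue measurable set, $\varepsilon\in(0,1)$, $1\le p\le\infty$, and suppose that one of the following conditions holds. (a) There exist $f,g\in\mathcal{S}_\omega(\mathbb{R}^N)$, $f,g\ne0$, and $\lambda\ge0$ such that $$\int_Ee^{\lambda\omega(x,\xi)}|Sp_gf(x,\xi)|\,dx\,d\xi\ge(1-\varepsilon)D_\lambda^{(5)}\,\|e^{K\lambda\omega}\mathrm{Wig}_\tau(f)\|_p,$$ where $D_\lambda^{(5)}=e^{K\lambda}\|e^{K\lambda\omega}\mathrm{Wig}_{1-\tau}(\tilde g)\|_{p'}$ and $\tilde g(t):=g(-t)$. (b) There exist $f,g\in\mathcal{S}_\omega(\mathbb{R}^N)$, $f,g\ne0$, $\lambda\ge0$ and $\mu>\frac{2N}{b}\left(K^2+\frac2{(2p)'}\right)$ such that $$\int_Ee^{\lambda\omega(x,\xi)}|\mathrm{Wig}_\tau(f)(x,\xi)|\,dx\,d\xi\ge(1-\varepsilon)D_{\lambda,\mu}^{(6)}\,\|e^{(8K^4\lambda+\mu)\omega}Sp_gf\|_p,$$ where $$D^{(6)}_{\lambda,\mu}=\frac{e^{\frac K2(1+2K)\lambda}}{(2\pi)^{\frac52N}(\tau-\tau^2)^{\frac N2}\|g\|_2^4}\;\inf\Big[e^{K(1+2K)(4K^2\lambda+\mu')}\|e^{K^2(4K^2\lambda+\mu')\omega}g\|_\infty\,\|e^{K^2(4K^2\lambda+\mu')\omega}\hat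 g\|_\infty\,\|e^{-\mu'\omega}\|_{L^2(\mathbb{R}^{2N})}\,\|e^{-\mu''\omega}\|^2_{L^{(2p)'}(\mathbb{R}^{2N})}\Big],$$ the infimum being taken over all $\mu',\mu''$ with $2(K^2\mu'+\mu'')=\mu$, $\mu'>\frac Nb$ and $\mu''>\frac{2N}{b(2p)'}$. Then $m(E)\ge1-\varepsilon$, where $m(E)$ is the Lebesgue measure of $E$.
   Context: A weight function is a continuous increasing (i.e. nondecreasing) function $\omega:[0,\infty)\to[0,\infty)$ such that: ($\alpha$) there is $K\ge1$ with $\omega(2t)\le K(1+\omega(t))$ for all $t\ge0$; ($\beta$) $\omega(t)=o(t)$ as $t\to\infty$; ($\gamma$) there are $a\in\mathbb{R}$, $b>0$ with $\omega(t)\ge a+b\log(1+t)$ for all $t\ge0$; ($\delta$) $t\mapsto\omega(e^t)$ is convex. $K$ and $b$ always denote the constants in ($\alpha$) and ($\gamma$). One extends $\omega$ to $\mathbb{R}^M$ by $\omega(z)=\omega(|z|)$; in particular $\omega(x,\xi)=\omega(|(x,\xi)|)$ on $\mathbb{R}^{2N}$. Fourier transform: $\hat f(\xi)=\int_{\mathbb{R}^N}e^{-ix\xi}f(x)\,dx$. $\mathcal{S}_\omega(\mathbb{R}^N)$ is the set of all $f\in L^1(\mathbb{R}^N)$ with $f,\hat f\in C^\infty(\mathbb{R}^N)$ and $\|e^{\lambda\omega}\partial^\alpha f\|_\infty<\infty$, $\|e^{\lambda\omega}\partial^\alpha\hat f\|_\infty<\infty$ for all $\lambda>0$, $\alpha\in\mathbb{N}_0^N$.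 Short-time Fourier transform: $V_gf(x,\xi)=\int_{\mathbb{R}^N}f(y)\overline{g(y-x)}e^{-iy\xi}\,dy$. Spectrogram: $Sp_gf(x,\xi)=|V_gf(x,\xi)|^2$. $\tau$-Wigner transform, $\tau\in[0,1]$: $\mathrm{Wig}_\tau(f)(x,\xi)=\int_{\mathbb{R}^N}e^{-it\xi}f(x+\tau t)\overline{f(x-(1-\tau)t)}\,dt$. $p'$ is the conjugate exponent of $p\in[1,\infty]$; $(2p)'$ is defined by $\frac1{2p}+\frac1{(2p)'}=1$, with $(2p)'=1$ for $p=\infty$. Norms of functions on $\mathbb{R}^N$ are in $L^q(\mathbb{R}^N)$, norms of functions on $\mathbb{R}^{2N}$ are in $L^q(\mathbb{R}^{2N})$. *)

theory Defs
  imports "HOL-Analysis.Analysis" "HOL-Probability.Essential_Supremum" "HOL-Library.Landau_Symbols"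
begin

text \<open>
  \<open>\<real>\<^sup>N\<close> is \<open>real ^ 'n\<close> with \<open>N = CARD('n)\<close>, and \<open>\<real>\<^sup>2\<^sup>N\<close> is \<open>(real ^ 'n) \<times> (real ^ 'n)\<close>, whose
  product norm is the Euclidean one. Norms and integrals that may be infinite take values in
  \<^typ>\<open>ennreal\<close>, so none of the inequalities depends on a default value of the Bochner integral.
\<close>

section \<open>Weight functions\<close>

text \<open>Only the values of \<open>\<omega>\<close> on \<open>[0,\<infinity>)\<close> matter. \<open>K\<close> and \<open>b\<close> are arbitrary admissible constants in
  conditions \<open>(\<alpha>)\<close> and \<open>(\<gamma>)\<close>.\<close>

definition weight_function :: "(real \<Rightarrow> real) \<Rightarrow> real \<Rightarrow> real \<Rightarrow> bool" where
  "weight_function \<omega> K b \<longleftrightarrow>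
     continuous_on {0..} \<omega> \<and> mono_on {0..} \<omega> \<and> (\<forall>t\<ge>0. \<omega> t \<ge> 0) \<and>
     K \<ge> 1 \<and> (\<forall>t\<ge>0. \<omega> (2 * t) \<le> K * (1 + \<omega> t)) \<and>
     \<omega> \<in> o[at_top](\<lambda>t. t) \<and>
     b > 0 \<and> (\<exists>a. \<forall>t\<ge>0. \<omega> t \<ge> a + b * ln (1 + t)) \<and>
     convex_on UNIV (\<lambda>t. \<omega> (exp t))"

text \<open>The function \<open>z \<mapsto> e\<^bsup>lam \<omega>(z)\<^esup> F(z)\<close>, with \<open>\<omega>(z) = \<omega>(|z|)\<close>.\<close>

definition weighted :: "(real \<Rightarrow> real) \<Rightarrow> real \<Rightarrow>
    ('a::real_normed_vector \<Rightarrow> 'b::real_normed_vector) \<Rightarrow> 'a \<Rightarrow> 'b" where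
  "weighted \<omega> lam F = (\<lambda>z. exp (lam * \<omega> (norm z)) *\<^sub>R F z)"

section \<open>Lebesgue norms and conjugate exponents\<close>

definition Lp_norm :: "ennreal \<Rightarrow> ('a::euclidean_space \<Rightarrow> 'b::real_normed_vector) \<Rightarrow> ennreal" where
  "Lp_norm p F =
     (if p = \<infinity> then esssup lebesgue (\<lambda>z. ennreal (norm (F z)))
      else let I = (\<integral>\<^sup>+z. ennreal (norm (F z) powr enn2real p) \<partial>lebesgue)
           in if I = \<infinity> then \<infinity> else ennreal (enn2real I powr (1 / enn2real p)))"

text \<open>In \<^typ>\<open>ennreal\<close> one has \<open>1 / \<infinity> = 0\<close> and \<open>2 * \<infinity> = \<infinity>\<close>, so the endpoints \<open>p = 1\<close>, \<open>p = \<infinity>\<close> and the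
  exponent \<open>(2p)'\<close> for \<open>p = \<infinity>\<close> need no special treatment.\<close>

definition conj_exponent :: "ennreal \<Rightarrow> ennreal" where
  "conj_exponent p = (THE q. inverse p + inverse q = 1)"

lemma conj_exponent_eq:
  assumes "1 \<le> p"
  shows "conj_exponent p = inverse (1 - inverse p)"
proof -
  have inv: "inverse (inverse x) = x" for x :: ennreal
    by (cases x; cases "x = 0") (auto simp: inverse_ennreal less_le)
  have le: "inverse p \<le> (1::ennreal)"
    using assms by (cases p) (auto simp: inverse_ennreal ennreal_le_1 field_simps simp flip: ennreal_1)
  then have fin: "inverse p \<noteq> \<infinity>"
    using order_le_less_trans[of "inverse p" 1 \<infinity>] by auto
  show ?thesis
    unfolding conj_exponent_def
  proof (rule the_equality)
    show "inverse p + inverse (inverse (1 - inverse p)) = 1"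
      using le by (simp add: inv diff_add_cancel_ennreal add.commute)
  next
    fix q assume "inverse p + inverse q = 1"
    then have "inverse q = 1 - inverse p"
      using fin by (metis ennreal_add_diff_cancel_left infinity_ennreal_def)
    then show "q = inverse (1 - inverse p)"
      by (metis inv)
  qed
qed

section \<open>Partial derivatives and the space \<open>\<S>\<^sub>\<omega>\<close>\<close>

definition partial_deriv :: "'n \<Rightarrow> (real ^ 'n \<Rightarrow> complex) \<Rightarrow> real ^ 'n \<Rightarrow> complex" where
  "partial_deriv i f x = vector_derivative (\<lambda>t. f (x + t *\<^sub>R axis i 1)) (at 0)"

text \<open>A list \<open>[i\<^sub>1, \<dots>, i\<^sub>k]\<close> of coordinates stands for \<open>\<partial>\<^bsub>i\<^sub>1\<^esub> \<dots> \<partial>\<^bsub>i\<^sub>k\<^esub>\<close>, i.e. for \<open>\<partial>\<^sup>\<alpha>\<close> with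
  \<open>\<alpha>\<^sub>j = count_list [i\<^sub>1, \<dots>, i\<^sub>k] j\<close>. Every multi-index arises in this way, and for smooth functions the
  order of the entries is irrelevant.\<close>

definition iter_partial :: "'n list \<Rightarrow> (real ^ 'n \<Rightarrow> complex) \<Rightarrow> real ^ 'n \<Rightarrow> complex" where
  "iter_partial \<alpha> f = foldr partial_deriv \<alpha> f"

definition smooth_fun :: "(real ^ 'n \<Rightarrow> complex) \<Rightarrow> bool" where
  "smooth_fun f \<longleftrightarrow>
     (\<forall>\<alpha>. continuous_on UNIV (iter_partial \<alpha> f) \<and>
          (\<forall>i x. (\<lambda>t::real. iter_partial \<alpha> f (x + t *\<^sub>R axis i 1)) differentiable (at 0)))"

definition fourier :: "(real ^ 'n \<Rightarrow> complex) \<Rightarrow> real ^ 'n \<Rightarrow> complex" where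
  "fourier f \<xi> = (LINT x|lebesgue. exp (- (\<i> * of_real (x \<bullet> \<xi>))) * f x)"

definition S_space :: "(real \<Rightarrow> real) \<Rightarrow> (real ^ 'n \<Rightarrow> complex) set" where
  "S_space \<omega> = {f. integrable lebesgue f \<and> smooth_fun f \<and> smooth_fun (fourier f) \<and>
     (\<forall>lam>0. \<forall>\<alpha>. Lp_norm \<infinity> (weighted \<omega> lam (iter_partial \<alpha> f)) < \<infinity> \<and>
                Lp_norm \<infinity> (weighted \<omega> lam (iter_partial \<alpha> (fourier f))) < \<infinity>)}"

section \<open>Time-frequency representations\<close>

definition STFT :: "(real ^ 'n \<Rightarrow> complex) \<Rightarrow> (real ^ 'n \<Rightarrow> complex) \<Rightarrow>
    (real ^ 'n) \<times> (real ^ 'n) \<Rightarrow> complex" where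
  "STFT g f = (\<lambda>(x, \<xi>). LINT y|lebesgue. f y * cnj (g (y - x)) * exp (- (\<i> * of_real (y \<bullet> \<xi>))))"

definition spectrogram :: "(real ^ 'n \<Rightarrow> complex) \<Rightarrow> (real ^ 'n \<Rightarrow> complex) \<Rightarrow>
    (real ^ 'n) \<times> (real ^ 'n) \<Rightarrow> real" where
  "spectrogram g f z = (cmod (STFT g f z))\<^sup>2"

definition Wig :: "real \<Rightarrow> (real ^ 'n \<Rightarrow> complex) \<Rightarrow> (real ^ 'n) \<times> (real ^ 'n) \<Rightarrow> complex" where
  "Wig \<tau> f = (\<lambda>(x, \<xi>). LINT t|lebesgue. exp (- (\<i> * of_real (t \<bullet> \<xi>))) *
                 f (x + \<tau> *\<^sub>R t) * cnj (f (x - (1 - \<tau>) *\<^sub>R t)))"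

section \<open>The constants\<close>

definition D5 :: "(real \<Rightarrow> real) \<Rightarrow> real \<Rightarrow> real \<Rightarrow> ennreal \<Rightarrow> real \<Rightarrow> (real ^ 'n \<Rightarrow> complex) \<Rightarrow> ennreal" where
  "D5 \<omega> K \<tau> p lam g =
     ennreal (exp (K * lam)) *
     Lp_norm (conj_exponent p) (weighted \<omega> (K * lam) (Wig (1 - \<tau>) (\<lambda>t. g (- t))))"

definition D6 :: "(real \<Rightarrow> real) \<Rightarrow> real \<Rightarrow> real \<Rightarrow> real \<Rightarrow> ennreal \<Rightarrow> real \<Rightarrow> real \<Rightarrow>
    (real ^ 'n \<Rightarrow> complex) \<Rightarrow> ennreal" where
  "D6 \<omega> K b \<tau> p lam \<mu> g =
     (let N = real CARD('n); r = conj_exponent (2 * p) in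
      ennreal (exp (K / 2 * (1 + 2 * K) * lam)) /
        (ennreal ((2 * pi) powr (5 / 2 * N) * (\<tau> - \<tau>\<^sup>2) powr (N / 2)) * Lp_norm 2 g ^ 4) *
      (INF (\<mu>', \<mu>'') \<in> {(\<mu>', \<mu>''). 2 * (K\<^sup>2 * \<mu>' + \<mu>'') = \<mu> \<and> \<mu>' > N / b \<and>
                                   \<mu>'' > 2 * N / (b * enn2real r)}.
         ennreal (exp (K * (1 + 2 * K) * (4 * K\<^sup>2 * lam + \<mu>'))) *
         Lp_norm \<infinity> (weighted \<omega> (K\<^sup>2 * (4 * K\<^sup>2 * lam + \<mu>')) g) *
         Lp_norm \<infinity> (weighted \<omega> (K\<^sup>2 * (4 * K\<^sup>2 * lam + \<mu>')) (fourier g)) *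
         Lp_norm 2 (\<lambda>z :: (real ^ 'n) \<times> (real ^ 'n). exp (- \<mu>' * \<omega> (norm z))) *
         (Lp_norm r (\<lambda>z :: (real ^ 'n) \<times> (real ^ 'n). exp (- \<mu>'' * \<omega> (norm z))))\<^sup>2))"

end

theory Submission
  imports Defs "HOL-Probability.Characteristic_Functions" "HOL-Probability.Sinc_Integral"
begin

text \<open>
  Let \<open>X\<close> be the nonnegative function integrated over \<open>E\<close> and \<open>R\<close> the constant on the right-hand side
  without the factor \<open>1 - \<epsilon>\<close>. If \<open>X \<le> R\<close> pointwise and \<open>0 < sup X < \<infinity>\<close>, then
  \<open>(1 - \<epsilon>) sup X \<le> (1 - \<epsilon>) R \<le> \<integral>\<^sub>E X \<le> m(E) sup X\<close>, and \<open>sup X\<close> cancels.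

  The bound in (a) comes from \<open>Sp\<^sub>g f = (2\<pi>)\<^sup>-\<^sup>N Wig\<^sub>\<tau> f * Wig\<^sub>1\<^sub>-\<^sub>\<tau> g~\<close>, the quasi-subadditivity
  \<open>\<omega>(z) \<le> K(1 + \<omega>(w) + \<omega>(z - w))\<close> and Hoelder's inequality. For (b), the STFT inversion formula for
  \<open>f\<close> is inserted in both slots of \<open>Wig\<^sub>\<tau> f\<close>; the Wigner transform of two time-frequency shifts of \<open>g\<close>
  is a translate of \<open>Wig\<^sub>\<tau> g\<close> up to a phase. The weighted supremum of \<open>Wig\<^sub>\<tau> g\<close> is the geometric mean
  of a bound in \<open>x\<close> through \<open>g\<close> and a bound in \<open>\<xi>\<close> through the Fourier transform of \<open>g\<close>, both given by
  the Cauchy--Schwarz inequality. Finiteness and \<open>sup X > 0\<close> rest on Fourier inversion.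
\<close>

section \<open>Integrals over Euclidean space\<close>

text \<open>The central tool is \<open>fourier_mult\<close>. A Wigner transform is the Fourier
  transform of a product, and turning it into a convolution needs Fourier inversion for one of the
  two factors only. This yields the frequency decay of \<open>Wig\<close> as well as the convolution
  form of the spectrogram. The decay of \<open>STFT\<close> is then read off from the bound for (a)
  with \<tau> = 1/2 and p = 1, which in turn makes the STFT inversion formula available for (b).
  Origin of the constants in \<open>D6\<close>: the power 5N/2 of 2 pi is 2N from two uses of STFT
  inversion plus N/2 from the bound on the Wigner transform of g, and the fourth power of the L2
  norm of g also comes from the two inversions. The exponent 8 K^4 lam + \<mu> is 2 (s + \<mu>''),
  where s is the weight that falls on each of the two copies of \<open>STFT\<close> and \<mu>'' is
  what Hoelder's inequality consumes. The exponentials of \<open>D6\<close> leave room over what the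
  estimates produce. Only moduli are tracked after each integral identity, so unimodular phases drop
  out and upper bounds can be taken in \<open>ennreal\<close>.\<close>

lemma nn_integral_lborel_affine:
  fixes F :: "'a::euclidean_space \<Rightarrow> ennreal"
  assumes [measurable]: "F \<in> borel_measurable borel" and "c \<noteq> 0"
  shows "(\<integral>\<^sup>+x. F (t + c *\<^sub>R x) \<partial>lborel) = ennreal (1 / \<bar>c\<bar> ^ DIM('a)) * (\<integral>\<^sup>+x. F x \<partial>lborel)"
proof -
  have "(\<integral>\<^sup>+x. F x \<partial>lborel) = ennreal (\<bar>c\<bar> ^ DIM('a)) * (\<integral>\<^sup>+x. F (t + c *\<^sub>R x) \<partial>lborel)"
    by (subst lborel_affine[OF \<open>c \<noteq> 0\<close>, of t])
      (simp add: nn_integral_density nn_integral_distr nn_integral_cmult)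
  then show ?thesis
    using \<open>c \<noteq> 0\<close>
    by (simp flip: mult.assoc ennreal_mult'')
qed

lemma integral_lborel_affine:
  fixes F :: "'a::euclidean_space \<Rightarrow> 'b::{banach, second_countable_topology}"
  assumes [measurable]: "F \<in> borel_measurable borel" and "c \<noteq> 0"
  shows "(\<integral>x. F (t + c *\<^sub>R x) \<partial>lborel) = (1 / \<bar>c\<bar> ^ DIM('a)) *\<^sub>R (\<integral>x. F x \<partial>lborel)"
proof -
  have "(\<integral>x. F x \<partial>lborel) = (\<bar>c\<bar> ^ DIM('a)) *\<^sub>R (\<integral>x. F (t + c *\<^sub>R x) \<partial>lborel)"
    by (subst lborel_affine[OF \<open>c \<noteq> 0\<close>, of t])
      (simp add: integral_density integral_distr)
  then show ?thesis
    using \<open>c \<noteq> 0\<close> by simp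
qed

lemma integrable_lborel_affine:
  fixes F :: "'a::euclidean_space \<Rightarrow> 'b::{banach, second_countable_topology}"
  assumes F: "integrable lborel F" and "c \<noteq> 0"
  shows "integrable lborel (\<lambda>x. F (t + c *\<^sub>R x))"
proof -
  have [measurable]: "F \<in> borel_measurable borel"
    using F by (auto dest: borel_measurable_integrable)
  show ?thesis
  proof (rule integrableI_bounded)
    have "(\<integral>\<^sup>+x. norm (F (t + c *\<^sub>R x)) \<partial>lborel) = ennreal (1 / \<bar>c\<bar> ^ DIM('a)) * (\<integral>\<^sup>+x. norm (F x) \<partial>lborel)"
      by (rule nn_integral_lborel_affine) (use \<open>c \<noteq> 0\<close> in auto)
    also have "\<dots> < \<infinity>"
      using F by (auto simp: integrable_iff_bounded ennreal_mult_less_top)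
    finally show "(\<integral>\<^sup>+x. norm (F (t + c *\<^sub>R x)) \<partial>lborel) < \<infinity>" .
  qed auto
qed

section \<open>Product integrals and the Fourier transform of the Gaussian\<close>

text \<open>\<open>lborel_eq\<close> presents Lebesgue measure as the image of the product of
  one-dimensional Lebesgue measures over \<open>Basis\<close>, so the product rule for finite
  families of sigma-finite measures applies.\<close>

lemma
  fixes f :: "'a::euclidean_space \<Rightarrow> real \<Rightarrow> complex"
  assumes f: "\<And>b. b \<in> Basis \<Longrightarrow> integrable lborel (f b)"
  shows integrable_lborel_prod: "integrable lborel (\<lambda>x::'a. \<Prod>b\<in>Basis. f b (x \<bullet> b))"
    and integral_lborel_prod:
      "(\<integral>x. (\<Prod>b\<in>Basis. f b (x \<bullet> b)) \<partial>(lborel :: 'a measure)) = (\<Prod>b\<in>Basis. (\<integral>t. f b t \<partial>lborel))"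
proof -
  interpret P: product_sigma_finite "\<lambda>_::'a. lborel :: real measure" ..
  have [measurable]: "f b \<in> borel_measurable borel" if "b \<in> Basis" for b
    using f[OF that] by (auto dest: borel_measurable_integrable)
  have eq: "(\<Prod>b\<in>Basis. f b ((\<Sum>d\<in>Basis. y d *\<^sub>R d) \<bullet> b)) = (\<Prod>b\<in>Basis. f b (y b))" for y :: "'a \<Rightarrow> real"
    by simp
  have [measurable]: "(\<lambda>x::'a. \<Prod>b\<in>Basis. f b (x \<bullet> b)) \<in> borel_measurable borel"
    by measurable
  show "integrable lborel (\<lambda>x::'a. \<Prod>b\<in>Basis. f b (x \<bullet> b))"
    unfolding lborel_eq[where 'a='a] by (subst integrable_distr_eq) (auto simp: eq intro!: P.product_integrable_prod f)
  show "(\<integral>x. (\<Prod>b\<in>Basis. f b (x \<bullet> b)) \<partial>(lborel :: 'a measure)) = (\<Prod>b\<in>Basis. (\<integral>t. f b t \<partial>lborel))"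
    unfolding lborel_eq[where 'a='a]
    by (subst integral_distr) (auto simp: eq intro!: P.product_integral_prod f)
qed

text \<open>This is the characteristic function of the standard normal distribution at -a, with the
  normalising factor sqrt (2 pi) moved to the other side.\<close>

lemma
  shows integrable_gaussian_real: "integrable lborel (\<lambda>t. exp (- (\<i> * of_real (t * a))) * of_real (exp (- t\<^sup>2 / 2)))"
    and integral_gaussian_real:
      "(\<integral>t. exp (- (\<i> * of_real (t * a))) * of_real (exp (- t\<^sup>2 / 2)) \<partial>lborel) = of_real (sqrt (2 * pi) * exp (- a\<^sup>2 / 2))"
proof -
  have eq: "exp (- (\<i> * of_real (t * a))) * of_real (exp (- t\<^sup>2 / 2))
      = of_real (sqrt (2 * pi)) * (std_normal_density t *\<^sub>R iexp (- a * t))" for t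
    by (simp add: std_normal_density_def scaleR_conv_of_real mult_ac)
  have "integrable lborel (\<lambda>t. std_normal_density t *\<^sub>R iexp (- a * t))"
  proof (rule Bochner_Integration.integrable_bound)
    show "integrable lborel std_normal_density" by simp
  qed (auto simp: normal_density_nonneg)
  then show "integrable lborel (\<lambda>t. exp (- (\<i> * of_real (t * a))) * of_real (exp (- t\<^sup>2 / 2)))"
    unfolding eq by (rule integrable_mult_right)
  have "char std_normal_distribution (- a) = complex_of_real (exp (- a\<^sup>2 / 2))"
    using fun_cong[OF char_std_normal_distribution, of "- a"] by simp
  moreover have "char std_normal_distribution (- a) = (\<integral>t. std_normal_density t *\<^sub>R iexp (- a * t) \<partial>lborel)"
    unfolding char_def by (subst integral_density) (auto simp: normal_density_nonneg)
  ultimately show "(\<integral>t. exp (- (\<i> * of_real (t * a))) * of_real (exp (- t\<^sup>2 / 2)) \<partial>lborel) = of_real (sqrt (2 * pi) * exp (- a\<^sup>2 / 2))"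
    unfolding eq by (subst integral_mult_right_zero) simp
qed

lemma
  fixes a :: "'a::euclidean_space"
  shows integrable_gaussian: "integrable lborel (\<lambda>x::'a. exp (- (\<i> * of_real (x \<bullet> a))) * of_real (exp (- (norm x)\<^sup>2 / 2)))"
    and integral_gaussian:
      "(\<integral>x. exp (- (\<i> * of_real (x \<bullet> a))) * of_real (exp (- (norm x)\<^sup>2 / 2)) \<partial>(lborel :: 'a measure))
        = of_real (sqrt (2 * pi) ^ DIM('a) * exp (- (norm a)\<^sup>2 / 2))"
proof -
  have nrm: "(norm x)\<^sup>2 = (\<Sum>b\<in>Basis. (x \<bullet> b)\<^sup>2)" for x :: 'a
    by (metis (no_types, lifting) euclidean_inner power2_eq_square power2_norm_eq_inner sum.cong)
  have e1: "(\<Prod>b\<in>Basis. exp (- (\<i> * of_real ((x \<bullet> b) * (a \<bullet> b))))) = exp (- (\<i> * of_real (x \<bullet> a)))" for x :: 'a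
  proof -
    have "(\<Prod>b\<in>Basis. exp (- (\<i> * of_real ((x \<bullet> b) * (a \<bullet> b))))) = exp (\<Sum>b\<in>Basis. - (\<i> * of_real ((x \<bullet> b) * (a \<bullet> b))))"
      by (simp add: exp_sum)
    also have "(\<Sum>b\<in>Basis. - (\<i> * of_real ((x \<bullet> b) * (a \<bullet> b)))) = - (\<i> * of_real (\<Sum>b\<in>Basis. (x \<bullet> b) * (a \<bullet> b)))"
      by (simp only: sum_negf sum_distrib_left of_real_sum)
    finally show ?thesis
      by (simp only: euclidean_inner[of x a])
  qed
  have e2: "(\<Prod>b\<in>Basis. of_real (c * exp (- (x \<bullet> b)\<^sup>2 / 2))) = (of_real (c ^ DIM('a) * exp (- (norm x)\<^sup>2 / 2)) :: complex)" for x :: 'a and c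
  proof -
    have "(\<Prod>b\<in>Basis. exp (- (x \<bullet> b)\<^sup>2 / 2)) = exp (\<Sum>b\<in>Basis. - (x \<bullet> b)\<^sup>2 / 2)"
      by (simp add: exp_sum)
    also have "(\<Sum>b\<in>Basis. - (x \<bullet> b)\<^sup>2 / 2) = - (norm x)\<^sup>2 / 2"
      by (simp add: nrm sum_negf sum_divide_distrib)
    finally show ?thesis
      by (simp only: of_real_prod[symmetric] prod.distrib prod_constant)
  qed
  have eq: "exp (- (\<i> * of_real (x \<bullet> a))) * of_real (exp (- (norm x)\<^sup>2 / 2))
     = (\<Prod>b\<in>Basis. exp (- (\<i> * of_real ((x \<bullet> b) * (a \<bullet> b)))) * of_real (exp (- (x \<bullet> b)\<^sup>2 / 2)))" for x :: 'a
    using e1[of x] e2[of 1 x] by (simp only: prod.distrib mult_1 power_one)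
  show "integrable lborel (\<lambda>x::'a. exp (- (\<i> * of_real (x \<bullet> a))) * of_real (exp (- (norm x)\<^sup>2 / 2)))"
    unfolding eq by (rule integrable_lborel_prod) (rule integrable_gaussian_real)
  have "(\<integral>x. exp (- (\<i> * of_real (x \<bullet> a))) * of_real (exp (- (norm x)\<^sup>2 / 2)) \<partial>(lborel :: 'a measure))
      = (\<Prod>b\<in>Basis. (\<integral>t. exp (- (\<i> * of_real (t * (a \<bullet> b)))) * of_real (exp (- t\<^sup>2 / 2)) \<partial>lborel))"
    unfolding eq
    by (subst integral_lborel_prod[where f="\<lambda>b t. exp (- (\<i> * of_real (t * (a \<bullet> b)))) * of_real (exp (- t\<^sup>2 / 2))"])
      (use integrable_gaussian_real in auto)
  also have "\<dots> = of_real (sqrt (2 * pi) ^ DIM('a) * exp (- (norm a)\<^sup>2 / 2))"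
    by (simp only: integral_gaussian_real e2)
  finally show "(\<integral>x. exp (- (\<i> * of_real (x \<bullet> a))) * of_real (exp (- (norm x)\<^sup>2 / 2)) \<partial>(lborel :: 'a measure))
        = of_real (sqrt (2 * pi) ^ DIM('a) * exp (- (norm a)\<^sup>2 / 2))" .
qed

section \<open>Fourier inversion\<close>

lemma norm_exp_ii [simp]: "norm (exp (\<i> * of_real x)) = 1" "norm (exp (- (\<i> * of_real x))) = 1"
  by (simp_all add: norm_exp_eq_Re)

lemma integrable_pair_mult:
  fixes u :: "'a::euclidean_space \<Rightarrow> complex" and v :: "'b::euclidean_space \<Rightarrow> complex"
  assumes u: "integrable lborel u" and v: "integrable lborel v"
  shows "integrable (lborel \<Otimes>\<^sub>M lborel) (\<lambda>(x, y). u x * v y)"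
proof -
  have [measurable]: "u \<in> borel_measurable borel" "v \<in> borel_measurable borel"
    using u v by (auto dest: borel_measurable_integrable)
  show ?thesis
    by (rule lborel_pair.Fubini_integrable) (use u v in \<open>auto simp: norm_mult\<close>)
qed

text \<open>Passing from \<open>lebesgue\<close> to \<open>lborel\<close> leaves integrals of Borel
  functions unchanged and makes the product measure and Fubini's theorem directly
  applicable.\<close>

lemma fourier_lborel:
  assumes [measurable]: "f \<in> borel_measurable borel"
  shows "fourier f \<xi> = (\<integral>x. exp (- (\<i> * of_real (x \<bullet> \<xi>))) * f x \<partial>lborel)"
  unfolding fourier_def by (rule integral_completion) measurable

lemma borel_measurable_fourier [measurable]:
  assumes [measurable]: "f \<in> borel_measurable borel"
  shows "fourier f \<in> borel_measurable borel"
  unfolding fourier_lborel[OF assms, abs_def] by measurable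

text \<open>The Gaussian factor makes the double integrand in x and \<xi> integrable, which it would
  not be otherwise, so the order of integration may be exchanged. The inner integral is then a
  Gaussian of width e around y; the power of e from rescaling it cancels against the Jacobian of x =
  y + e v.\<close>

lemma fourier_gaussian_regularization:
  fixes h :: "real ^ 'n \<Rightarrow> complex"
  assumes h: "integrable lborel h" and "e > 0"
  shows "(\<integral>\<xi>. exp (\<i> * of_real (y \<bullet> \<xi>)) * fourier h \<xi> * of_real (exp (- (norm (e *\<^sub>R \<xi>))\<^sup>2 / 2)) \<partial>lborel)
    = (\<integral>v. h (y + e *\<^sub>R v) * of_real (sqrt (2 * pi) ^ CARD('n) * exp (- (norm v)\<^sup>2 / 2)) \<partial>lborel)"
proof -
  let ?G = "\<lambda>\<xi>::real^'n. complex_of_real (exp (- (norm \<xi>)\<^sup>2 / 2))"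
  let ?K = "\<lambda>x. \<integral>\<xi>. exp (- (\<i> * of_real (\<xi> \<bullet> (x - y)))) * ?G (e *\<^sub>R \<xi>) \<partial>lborel"
  have [measurable]: "h \<in> borel_measurable borel"
    using h by (auto dest: borel_measurable_integrable)
  have iG: "integrable lborel ?G"
    using integrable_gaussian[of "0 :: real^'n"] by simp
  have iGe: "integrable lborel (\<lambda>\<xi>. ?G (e *\<^sub>R \<xi>))"
    using integrable_lborel_affine[OF iG, of e 0] \<open>e > 0\<close> by simp
  have int: "integrable (lborel \<Otimes>\<^sub>M lborel)
      (\<lambda>(x, \<xi>). exp (- (\<i> * of_real (\<xi> \<bullet> (x - y)))) * ?G (e *\<^sub>R \<xi>) * h x)"
    by (rule Bochner_Integration.integrable_bound[OF integrable_pair_mult[OF h iGe]])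
      (auto simp: norm_mult)
  have "(\<integral>\<xi>. exp (\<i> * of_real (y \<bullet> \<xi>)) * fourier h \<xi> * ?G (e *\<^sub>R \<xi>) \<partial>lborel)
     = (\<integral>\<xi>. (\<integral>x. exp (- (\<i> * of_real (\<xi> \<bullet> (x - y)))) * ?G (e *\<^sub>R \<xi>) * h x \<partial>lborel) \<partial>lborel)"
  proof (rule Bochner_Integration.integral_cong[OF refl])
    fix \<xi> :: "real ^ 'n"
    have "(\<integral>x. exp (- (\<i> * of_real (\<xi> \<bullet> (x - y)))) * ?G (e *\<^sub>R \<xi>) * h x \<partial>lborel)
       = (\<integral>x. (exp (\<i> * of_real (y \<bullet> \<xi>)) * ?G (e *\<^sub>R \<xi>)) * (exp (- (\<i> * of_real (x \<bullet> \<xi>))) * h x) \<partial>lborel)"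
    proof (rule Bochner_Integration.integral_cong[OF refl])
      fix x
      have "exp (- (\<i> * of_real (\<xi> \<bullet> (x - y)))) = exp (\<i> * of_real (y \<bullet> \<xi>)) * exp (- (\<i> * of_real (x \<bullet> \<xi>)))"
        by (simp add: inner_diff_right inner_commute right_diff_distrib flip: exp_add)
      then show "exp (- (\<i> * of_real (\<xi> \<bullet> (x - y)))) * ?G (e *\<^sub>R \<xi>) * h x
        = (exp (\<i> * of_real (y \<bullet> \<xi>)) * ?G (e *\<^sub>R \<xi>)) * (exp (- (\<i> * of_real (x \<bullet> \<xi>))) * h x)"
        by (simp only: mult_ac)
    qed
    then show "exp (\<i> * of_real (y \<bullet> \<xi>)) * fourier h \<xi> * ?G (e *\<^sub>R \<xi>)
      = (\<integral>x. exp (- (\<i> * of_real (\<xi> \<bullet> (x - y)))) * ?G (e *\<^sub>R \<xi>) * h x \<partial>lborel)"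
      by (simp add: fourier_lborel)
  qed
  also have "\<dots> = (\<integral>x. (\<integral>\<xi>. exp (- (\<i> * of_real (\<xi> \<bullet> (x - y)))) * ?G (e *\<^sub>R \<xi>) * h x \<partial>lborel) \<partial>lborel)"
    by (rule lborel_pair.Fubini_integral[OF int])
  also have "\<dots> = (\<integral>x. ?K x * h x \<partial>lborel)"
    by simp
  also have "\<dots> = (e ^ CARD('n)) *\<^sub>R (\<integral>v. ?K (y + e *\<^sub>R v) * h (y + e *\<^sub>R v) \<partial>lborel)"
    using \<open>e > 0\<close> by (subst integral_lborel_affine[where F="\<lambda>x. ?K x * h x"]) auto
  also have "(\<lambda>v. ?K (y + e *\<^sub>R v)) = (\<lambda>v. (1 / e ^ CARD('n)) *\<^sub>R of_real (sqrt (2 * pi) ^ CARD('n) * exp (- (norm v)\<^sup>2 / 2)))"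
  proof
    fix v
    have "?K (y + e *\<^sub>R v) = (\<integral>\<xi>. (\<lambda>\<eta>. exp (- (\<i> * of_real (\<eta> \<bullet> v))) * ?G \<eta>) (0 + e *\<^sub>R \<xi>) \<partial>lborel)"
      by (simp add: inner_commute)
    also have "\<dots> = (1 / e ^ CARD('n)) *\<^sub>R (\<integral>\<eta>. exp (- (\<i> * of_real (\<eta> \<bullet> v))) * ?G \<eta> \<partial>lborel)"
      using \<open>e > 0\<close> by (subst integral_lborel_affine) auto
    finally show "?K (y + e *\<^sub>R v) = (1 / e ^ CARD('n)) *\<^sub>R of_real (sqrt (2 * pi) ^ CARD('n) * exp (- (norm v)\<^sup>2 / 2))"
      unfolding integral_gaussian by simp
  qed
  finally show ?thesis
    using \<open>e > 0\<close> by (simp add: mult.commute)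
qed

text \<open>Let the regularization parameter tend to 0. Dominated convergence applies on both sides:
  the left is dominated by the modulus of \<open>fourier h\<close>, the right by \<open>B\<close>
  times a fixed Gaussian. Continuity of \<open>h\<close> gives the limit at the individual point y,
  and the constant is sqrt (2 pi) to the power N twice, once from the kernel and once from its
  integral.\<close>

theorem fourier_inversion:
  fixes h :: "real ^ 'n \<Rightarrow> complex"
  assumes cont: "continuous_on UNIV h" and bdd: "\<And>x. norm (h x) \<le> B"
    and h: "integrable lborel h" and fh: "integrable lborel (fourier h)"
  shows "(\<integral>\<xi>. exp (\<i> * of_real (y \<bullet> \<xi>)) * fourier h \<xi> \<partial>lborel) = of_real ((2 * pi) ^ CARD('n)) * h y"
proof -
  define e where "e n = inverse (real (Suc n))" for n
  have e: "e n > 0" for n by (simp add: e_def)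
  have elim: "e \<longlonglongrightarrow> 0" unfolding e_def by (rule LIMSEQ_inverse_real_of_nat)
  let ?g = "\<lambda>v::real^'n. complex_of_real (sqrt (2 * pi) ^ CARD('n) * exp (- (norm v)\<^sup>2 / 2))"
  let ?L = "\<lambda>n. \<integral>\<xi>. exp (\<i> * of_real (y \<bullet> \<xi>)) * fourier h \<xi> * of_real (exp (- (norm (e n *\<^sub>R \<xi>))\<^sup>2 / 2)) \<partial>lborel"
  let ?R = "\<lambda>n. \<integral>v. h (y + e n *\<^sub>R v) * ?g v \<partial>lborel"
  have [measurable]: "h \<in> borel_measurable borel"
    using h by (auto dest: borel_measurable_integrable)
  have g: "?g v = of_real (sqrt (2 * pi) ^ CARD('n)) * of_real (exp (- (norm v)\<^sup>2 / 2))" for v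
    by (rule of_real_mult)
  have gauss: "integrable lborel (\<lambda>v::real^'n. complex_of_real (exp (- (norm v)\<^sup>2 / 2)))"
    "(\<integral>v. complex_of_real (exp (- (norm v)\<^sup>2 / 2)) \<partial>(lborel :: (real^'n) measure)) = of_real (sqrt (2 * pi) ^ CARD('n))"
    using integrable_gaussian[of "0 :: real^'n"] integral_gaussian[of "0 :: real^'n"] by simp_all
  have ig: "integrable lborel ?g"
    unfolding g by (rule integrable_mult_right[OF gauss(1)])
  have "(\<integral>v. ?g v \<partial>lborel) = of_real (sqrt (2 * pi) ^ CARD('n)) * of_real (sqrt (2 * pi) ^ CARD('n))"
    unfolding g by (simp only: integral_mult_right_zero gauss(2))
  then have intg: "(\<integral>v. ?g v \<partial>lborel) = of_real ((2 * pi) ^ CARD('n))"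
    by (simp only: of_real_mult[symmetric] power_mult_distrib[symmetric] real_sqrt_mult_self) simp
  have L: "?L \<longlonglongrightarrow> (\<integral>\<xi>. exp (\<i> * of_real (y \<bullet> \<xi>)) * fourier h \<xi> \<partial>lborel)"
  proof (rule integral_dominated_convergence[where w="\<lambda>\<xi>. norm (fourier h \<xi>)"])
    show "AE \<xi> in lborel. (\<lambda>n. exp (\<i> * of_real (y \<bullet> \<xi>)) * fourier h \<xi> * of_real (exp (- (norm (e n *\<^sub>R \<xi>))\<^sup>2 / 2)))
       \<longlonglongrightarrow> exp (\<i> * of_real (y \<bullet> \<xi>)) * fourier h \<xi>"
    proof (rule AE_I2)
      fix \<xi>
      have "(\<lambda>n. exp (\<i> * of_real (y \<bullet> \<xi>)) * fourier h \<xi> * complex_of_real (exp (- (norm (e n *\<^sub>R \<xi>))\<^sup>2 / 2)))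
       \<longlonglongrightarrow> exp (\<i> * of_real (y \<bullet> \<xi>)) * fourier h \<xi> * complex_of_real (exp (- (norm (0 *\<^sub>R \<xi>))\<^sup>2 / 2))"
        by (intro tendsto_intros elim) auto
      then show "(\<lambda>n. exp (\<i> * of_real (y \<bullet> \<xi>)) * fourier h \<xi> * complex_of_real (exp (- (norm (e n *\<^sub>R \<xi>))\<^sup>2 / 2)))
       \<longlonglongrightarrow> exp (\<i> * of_real (y \<bullet> \<xi>)) * fourier h \<xi>" by simp
    qed
  qed (use fh in \<open>auto simp: norm_mult mult_left_le\<close>)
  have R: "?R \<longlonglongrightarrow> (\<integral>v. h y * ?g v \<partial>lborel)"
  proof (rule integral_dominated_convergence[where w="\<lambda>v. B * norm (?g v)"])
    show "AE v in lborel. (\<lambda>n. h (y + e n *\<^sub>R v) * ?g v) \<longlonglongrightarrow> h y * ?g v"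
    proof (rule AE_I2)
      fix v
      have "(\<lambda>n. y + e n *\<^sub>R v) \<longlonglongrightarrow> y + 0 *\<^sub>R v"
        by (intro tendsto_intros elim)
      moreover have "isCont h y"
        using cont by (simp add: continuous_on_eq_continuous_at)
      ultimately have "(\<lambda>n. h (y + e n *\<^sub>R v)) \<longlonglongrightarrow> h y"
        by (auto intro: isCont_tendsto_compose)
      then show "(\<lambda>n. h (y + e n *\<^sub>R v) * ?g v) \<longlonglongrightarrow> h y * ?g v"
        by (intro tendsto_intros)
    qed
    show "integrable lborel (\<lambda>v. B * norm (?g v))"
      by (intro integrable_mult_right integrable_norm ig)
    show "AE v in lborel. norm (h (y + e n *\<^sub>R v) * ?g v) \<le> B * norm (?g v)" for n
      unfolding norm_mult by (intro AE_I2 mult_right_mono bdd) auto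
  qed auto
  have LR: "?L = ?R"
    using fourier_gaussian_regularization[OF h e] by auto
  have "(\<integral>\<xi>. exp (\<i> * of_real (y \<bullet> \<xi>)) * fourier h \<xi> \<partial>lborel) = (\<integral>v. h y * ?g v \<partial>lborel)"
    using L R unfolding LR by (rule LIMSEQ_unique)
  also have "\<dots> = h y * (\<integral>v. ?g v \<partial>lborel)"
    by (rule integral_mult_right_zero)
  also have "\<dots> = of_real ((2 * pi) ^ CARD('n)) * h y"
    unfolding intg by (rule mult.commute)
  finally show ?thesis .
qed

section \<open>Fourier transforms of products, conjugates and affine substitutions\<close>

text \<open>Write out \<open>fourier H\<close> and integrate over \<eta> first: after the reflection
  \<zeta> = \<xi> - \<eta> the inner integral is the inversion formula for \<open>G\<close>. Hence
  the asymmetric hypotheses: \<open>H\<close> is merely integrable, and inversion is asked of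
  \<open>G\<close> alone.\<close>

lemma fourier_mult:
  fixes H G :: "real ^ 'n \<Rightarrow> complex"
  assumes H: "integrable lborel H"
    and G: "continuous_on UNIV G" "\<And>x. norm (G x) \<le> B" "integrable lborel G" "integrable lborel (fourier G)"
  shows "(\<integral>\<eta>. fourier H \<eta> * fourier G (\<xi> - \<eta>) \<partial>lborel) = of_real ((2 * pi) ^ CARD('n)) * fourier (\<lambda>t. H t * G t) \<xi>"
proof -
  have [measurable]: "H \<in> borel_measurable borel" "G \<in> borel_measurable borel"
    using H G by (auto dest: borel_measurable_integrable)
  have iG: "integrable lborel (\<lambda>\<eta>. fourier G (\<xi> - \<eta>))"
    using integrable_lborel_affine[OF G(4), of "-1" \<xi>] by simp
  have int: "integrable (lborel \<Otimes>\<^sub>M lborel) (\<lambda>(t, \<eta>). exp (- (\<i> * of_real (t \<bullet> \<eta>))) * H t * fourier G (\<xi> - \<eta>))"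
    by (rule Bochner_Integration.integrable_bound[OF integrable_pair_mult[OF H iG]])
      (auto simp: norm_mult)
  have "(\<integral>\<eta>. fourier H \<eta> * fourier G (\<xi> - \<eta>) \<partial>lborel)
     = (\<integral>\<eta>. (\<integral>t. exp (- (\<i> * of_real (t \<bullet> \<eta>))) * H t * fourier G (\<xi> - \<eta>) \<partial>lborel) \<partial>lborel)"
    by (simp add: fourier_lborel[of H])
  also have "\<dots> = (\<integral>t. (\<integral>\<eta>. exp (- (\<i> * of_real (t \<bullet> \<eta>))) * H t * fourier G (\<xi> - \<eta>) \<partial>lborel) \<partial>lborel)"
    by (rule lborel_pair.Fubini_integral[OF int])
  also have "\<dots> = (\<integral>t. of_real ((2 * pi) ^ CARD('n)) * (exp (- (\<i> * of_real (t \<bullet> \<xi>))) * (H t * G t)) \<partial>lborel)"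
  proof (rule Bochner_Integration.integral_cong[OF refl])
    fix t
    let ?F = "\<lambda>\<zeta>. exp (- (\<i> * of_real (t \<bullet> \<xi>))) * H t * (exp (\<i> * of_real (t \<bullet> \<zeta>)) * fourier G \<zeta>)"
    have "(\<integral>\<eta>. exp (- (\<i> * of_real (t \<bullet> \<eta>))) * H t * fourier G (\<xi> - \<eta>) \<partial>lborel) = (\<integral>\<eta>. ?F (\<xi> + (-1) *\<^sub>R \<eta>) \<partial>lborel)"
    proof (rule Bochner_Integration.integral_cong[OF refl])
      fix \<eta>
      have "exp (- (\<i> * of_real (t \<bullet> \<eta>))) = exp (- (\<i> * of_real (t \<bullet> \<xi>))) * exp (\<i> * of_real (t \<bullet> (\<xi> + (-1) *\<^sub>R \<eta>)))"
        by (simp add: inner_diff_right right_diff_distrib flip: exp_add)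
      then show "exp (- (\<i> * of_real (t \<bullet> \<eta>))) * H t * fourier G (\<xi> - \<eta>) = ?F (\<xi> + (-1) *\<^sub>R \<eta>)"
        by (simp add: mult_ac)
    qed
    also have "\<dots> = (\<integral>\<zeta>. ?F \<zeta> \<partial>lborel)"
      by (subst integral_lborel_affine) auto
    also have "\<dots> = of_real ((2 * pi) ^ CARD('n)) * (exp (- (\<i> * of_real (t \<bullet> \<xi>))) * (H t * G t))"
      by (simp add: fourier_inversion[OF G])
    finally show "(\<integral>\<eta>. exp (- (\<i> * of_real (t \<bullet> \<eta>))) * H t * fourier G (\<xi> - \<eta>) \<partial>lborel)
       = of_real ((2 * pi) ^ CARD('n)) * (exp (- (\<i> * of_real (t \<bullet> \<xi>))) * (H t * G t))" .
  qed
  also have "\<dots> = of_real ((2 * pi) ^ CARD('n)) * fourier (\<lambda>t. H t * G t) \<xi>"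
    by (simp add: fourier_lborel)
  finally show ?thesis .
qed

lemma fourier_cnj: "fourier (\<lambda>t. cnj (f t)) \<eta> = cnj (fourier f (- \<eta>))"
proof -
  have "fourier (\<lambda>t. cnj (f t)) \<eta> = (\<integral>x. cnj (exp (- (\<i> * of_real (x \<bullet> (- \<eta>)))) * f x) \<partial>lebesgue)"
    unfolding fourier_def by (rule Bochner_Integration.integral_cong[OF refl]) (simp add: exp_cnj)
  then show ?thesis
    unfolding fourier_def by (simp only: Bochner_Integration.integral_cnj)
qed

text \<open>The translation by a contributes only a unimodular factor, so the modulus sees nothing
  but the dilation.\<close>

lemma norm_fourier_affine:
  fixes f :: "real ^ 'n \<Rightarrow> complex"
  assumes [measurable]: "f \<in> borel_measurable borel" and "c \<noteq> 0"
  shows "norm (fourier (\<lambda>t. f (a + c *\<^sub>R t)) \<eta>) = norm (fourier f ((1 / c) *\<^sub>R \<eta>)) / \<bar>c\<bar> ^ CARD('n)"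
proof -
  let ?F = "\<lambda>s. exp (\<i> * of_real (a \<bullet> \<eta> / c)) * (exp (- (\<i> * of_real (s \<bullet> ((1 / c) *\<^sub>R \<eta>)))) * f s)"
  have "fourier (\<lambda>t. f (a + c *\<^sub>R t)) \<eta> = (\<integral>t. exp (- (\<i> * of_real (t \<bullet> \<eta>))) * f (a + c *\<^sub>R t) \<partial>lborel)"
    by (rule fourier_lborel) measurable
  also have "\<dots> = (\<integral>t. ?F (a + c *\<^sub>R t) \<partial>lborel)"
  proof (rule Bochner_Integration.integral_cong[OF refl])
    fix t
    have "exp (- (\<i> * of_real (t \<bullet> \<eta>))) = exp (\<i> * of_real (a \<bullet> \<eta> / c)) * exp (- (\<i> * of_real ((a + c *\<^sub>R t) \<bullet> ((1 / c) *\<^sub>R \<eta>))))"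
      using \<open>c \<noteq> 0\<close> by (simp add: inner_add_left add_divide_distrib distrib_left flip: exp_add)
    then show "exp (- (\<i> * of_real (t \<bullet> \<eta>))) * f (a + c *\<^sub>R t) = ?F (a + c *\<^sub>R t)"
      by (simp only: mult_ac)
  qed
  also have "\<dots> = (1 / \<bar>c\<bar> ^ CARD('n)) *\<^sub>R (\<integral>s. ?F s \<partial>lborel)"
    using \<open>c \<noteq> 0\<close> by (subst integral_lborel_affine) auto
  also have "(\<integral>s. ?F s \<partial>lborel) = exp (\<i> * of_real (a \<bullet> \<eta> / c)) * fourier f ((1 / c) *\<^sub>R \<eta>)"
    by (simp add: fourier_lborel)
  finally show ?thesis
    by (simp only: norm_scaleR norm_mult norm_exp_ii) (simp add: divide_inverse mult.commute)
qed

section \<open>Weights and rapidly decreasing functions\<close>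

lemma nn_integral_inverse_1_plus_square_finite: "(\<integral>\<^sup>+t. ennreal (inverse (1 + t\<^sup>2)) \<partial>lborel) < \<infinity>"
proof -
  have "integrable lborel (\<lambda>t::real. inverse (1 + t\<^sup>2))"
    using integrable_inverse_1_plus_square by (simp add: set_integrable_def)
  then have "(\<integral>\<^sup>+t. norm (inverse (1 + t\<^sup>2)) \<partial>(lborel :: real measure)) < \<infinity>"
    unfolding integrable_iff_bounded by blast
  moreover have "norm (inverse (1 + t\<^sup>2)) = inverse (1 + t\<^sup>2)" for t :: real
    by (simp add: add_nonneg_nonneg)
  ultimately show ?thesis by simp
qed

text \<open>The set where the norm exceeds the essential supremum is null, and for a continuous
  function it is open. A negligible open set is empty, so the almost-everywhere bound holds at every
  point.\<close>

lemma continuous_le_Lp_norm_infinity: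
  fixes F :: "'a::euclidean_space \<Rightarrow> 'b::real_normed_vector"
  assumes "continuous_on UNIV F"
  shows "ennreal (norm (F x)) \<le> Lp_norm \<infinity> F"
proof (cases "Lp_norm \<infinity> F")
  case (real C)
  let ?S = "{x. C < norm (F x)}"
  have "AE z in lebesgue. ennreal (norm (F z)) \<le> Lp_norm \<infinity> F"
    unfolding Lp_norm_def by (simp add: esssup_AE)
  then have ae: "AE z in lebesgue. \<not> C < norm (F z)"
    by (rule AE_mp) (use real in \<open>auto simp: not_less\<close>)
  have op: "open ?S"
    by (intro open_Collect_less continuous_intros assms)
  have "?S \<in> null_sets lebesgue"
    using ae op by (subst AE_iff_null_sets) (simp_all add: lmeasurable_open borel_open)
  then have "negligible ?S"
    by (simp add: negligible_iff_null_sets)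
  then have "?S = {}"
    using open_not_negligible[OF op] by auto
  then have "norm (F x) \<le> C"
    by (auto simp: set_eq_iff not_less)
  then show ?thesis
    using real by (simp add: ennreal_leI)
qed simp

locale weight =
  fixes \<omega> :: "real \<Rightarrow> real" and K b :: real
  assumes weight: "weight_function \<omega> K b"
begin

lemma w_nonneg [simp]: "0 \<le> t \<Longrightarrow> 0 \<le> \<omega> t"
  using weight by (simp add: weight_function_def)

lemma w_mono: "0 \<le> s \<Longrightarrow> s \<le> t \<Longrightarrow> \<omega> s \<le> \<omega> t"
  using weight by (auto simp: weight_function_def mono_on_def)

lemma K_ge_1: "1 \<le> K"
  using weight by (simp add: weight_function_def)

lemma b_pos: "0 < b"
  using weight by (simp add: weight_function_def)

text \<open>No doubling takes place, hence no factor K. This form serves points that are convex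
  combinations of two others, whose norm is at most the larger of the two.\<close>

lemma w_max: "0 \<le> s \<Longrightarrow> 0 \<le> t \<Longrightarrow> 0 \<le> r \<Longrightarrow> r \<le> max s t \<Longrightarrow> \<omega> r \<le> \<omega> s + \<omega> t"
  using w_mono[of r s] w_mono[of r t] w_nonneg[of s] w_nonneg[of t] by linarith

text \<open>Every factor K gained in the estimates comes from here: this is where the doubling
  condition is applied, once per use.\<close>

lemma w_double: "0 \<le> s \<Longrightarrow> 0 \<le> t \<Longrightarrow> 0 \<le> r \<Longrightarrow> r \<le> 2 * max s t \<Longrightarrow> \<omega> r \<le> K * (1 + \<omega> s + \<omega> t)"
proof -
  assume a: "0 \<le> s" "0 \<le> t" "0 \<le> r" "r \<le> 2 * max s t"
  have "\<omega> r \<le> \<omega> (2 * max s t)" using a by (intro w_mono)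
  also have "\<dots> \<le> K * (1 + \<omega> (max s t))"
    using weight a by (simp add: weight_function_def)
  also have "\<dots> \<le> K * (1 + \<omega> s + \<omega> t)"
    using K_ge_1 w_max[of s t "max s t"] a by (intro mult_left_mono) auto
  finally show ?thesis .
qed

lemma w_norm_add: "\<omega> (norm (x + y)) \<le> K * (1 + \<omega> (norm x) + \<omega> (norm y))"
  by (rule w_double) (use norm_triangle_ineq[of x y] in \<open>auto simp: max_def\<close>)

lemma w_norm_Pair: "\<omega> (norm (x, y)) \<le> K * (1 + \<omega> (norm x) + \<omega> (norm y))"
  by (rule w_double) (use norm_Pair_le[of x y] in \<open>auto simp: max_def\<close>)

lemma continuous_on_w_norm [continuous_intros]:
  "continuous_on UNIV (\<lambda>x::'a::real_normed_vector. \<omega> (norm x))"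
proof -
  have "continuous_on {0..} \<omega>"
    using weight by (simp add: weight_function_def)
  then show ?thesis
    by (rule continuous_on_compose2[where f=norm]) (auto intro: continuous_intros)
qed

lemma borel_measurable_w_norm [measurable]:
  "(\<lambda>x::'a::euclidean_space. \<omega> (norm x)) \<in> borel_measurable borel"
  by (rule borel_measurable_continuous_onI[OF continuous_on_w_norm])

text \<open>By the logarithmic lower bound on \<omega>, the condition on m gives decay like (1 +
  |x|) to the power -2 DIM. One factor (1 + |x|)^2 is assigned to each coordinate d and bounded
  below by 1 + (x \<bullet> d)^2, which leaves a product of integrable functions of one
  variable.\<close>

lemma integrable_exp_weight:
  assumes m: "2 * DIM('a) / b \<le> m"
  shows "integrable lborel (\<lambda>x::'a::euclidean_space. exp (- m * \<omega> (norm x)))"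
proof (rule integrableI_bounded)
  let ?D = "DIM('a)"
  obtain a where a: "\<And>t. 0 \<le> t \<Longrightarrow> \<omega> t \<ge> a + b * ln (1 + t)"
    using weight by (auto simp: weight_function_def)
  have mb: "2 * real ?D \<le> m * b" "0 \<le> m"
    using m b_pos by (auto simp: divide_le_eq intro: order_trans[OF _ m])
  have le: "exp (- m * \<omega> (norm x)) \<le> exp (- m * a) * (\<Prod>d\<in>Basis. inverse (1 + (x \<bullet> d)\<^sup>2))" for x :: 'a
  proof -
    have "m * (a + b * ln (1 + norm x)) \<le> m * \<omega> (norm x)"
      using a[of "norm x"] mb by (intro mult_left_mono) auto
    moreover have "2 * ?D * ln (1 + norm x) \<le> m * b * ln (1 + norm x)"
      using mb by (intro mult_right_mono) auto
    ultimately have "- m * \<omega> (norm x) \<le> - m * a + - (2 * ?D * ln (1 + norm x))"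
      by (simp add: algebra_simps)
    then have "exp (- m * \<omega> (norm x)) \<le> exp (- m * a) * exp (- (2 * ?D * ln (1 + norm x)))"
      by (simp flip: exp_add)
    also have "exp (- (2 * ?D * ln (1 + norm x))) = (inverse ((1 + norm x)\<^sup>2)) ^ ?D"
    proof -
      have "0 < 1 + norm x" by (simp add: add_pos_nonneg)
      then have "exp (real (2 * ?D) * ln (1 + norm x)) = (1 + norm x) ^ (2 * ?D)"
        by (simp only: exp_of_nat_mult exp_ln)
      then show ?thesis
        by (simp add: exp_minus power_mult power_inverse)
    qed
    also have "\<dots> = (\<Prod>d\<in>(Basis :: 'a set). inverse ((1 + norm x)\<^sup>2))"
      by simp
    also have "\<dots> \<le> (\<Prod>d\<in>Basis. inverse (1 + (x \<bullet> d)\<^sup>2))"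
    proof (intro prod_mono conjI le_imp_inverse_le)
      fix d :: 'a assume "d \<in> Basis"
      then have "(x \<bullet> d)\<^sup>2 \<le> (norm x)\<^sup>2"
        by (metis Basis_le_norm abs_ge_zero power2_abs power_mono)
      then show "1 + (x \<bullet> d)\<^sup>2 \<le> (1 + norm x)\<^sup>2"
        by (simp add: power2_sum add_increasing2)
    qed (auto simp: add_pos_nonneg)
    finally show ?thesis by simp
  qed
  have "(\<integral>\<^sup>+x. norm (exp (- m * \<omega> (norm (x::'a)))) \<partial>lborel)
      \<le> (\<integral>\<^sup>+x. ennreal (exp (- m * a)) * (\<Prod>d\<in>Basis. ennreal (inverse (1 + (x \<bullet> d)\<^sup>2))) \<partial>(lborel :: 'a measure))"
    by (intro nn_integral_mono) (use le in \<open>simp add: prod_ennreal prod_nonneg add_nonneg_nonneg flip: ennreal_mult\<close>)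
  also have "\<dots> = ennreal (exp (- m * a)) * (\<Prod>d\<in>(Basis :: 'a set). (\<integral>\<^sup>+t. ennreal (inverse (1 + t\<^sup>2)) \<partial>lborel))"
    using nn_integral_lborel_prod[where f="\<lambda>(_ :: 'a) t. ennreal (inverse (1 + t\<^sup>2))"]
    by (simp add: nn_integral_cmult)
  also have "\<dots> < \<infinity>"
    using nn_integral_inverse_1_plus_square_finite
    by (simp add: ennreal_mult_less_top power_less_top_ennreal)
  finally show "(\<integral>\<^sup>+x. norm (exp (- m * \<omega> (norm (x::'a)))) \<partial>lborel) < \<infinity>" .
qed measurable

section \<open>Rapid decay against all powers of the weight\<close>

text \<open>A pointwise bound for every real exponent, so that weights can be shifted freely and m =
  0 gives boundedness; it replaces the essential suprema in \<open>S_space\<close> for the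
  continuous functions considered.\<close>

definition decays :: "('a::euclidean_space \<Rightarrow> 'b::real_normed_vector) \<Rightarrow> bool" where
  "decays F \<longleftrightarrow> (\<forall>m. \<exists>C. \<forall>x. exp (m * \<omega> (norm x)) * norm (F x) \<le> C)"

lemma decaysE:
  assumes "decays F"
  obtains C where "0 \<le> C" "\<And>x. exp (m * \<omega> (norm x)) * norm (F x) \<le> C"
proof -
  obtain C where C: "\<And>x. exp (m * \<omega> (norm x)) * norm (F x) \<le> C"
    using assms by (auto simp: decays_def)
  have "0 \<le> exp (m * \<omega> (norm 0)) * norm (F 0)" by simp
  also note C
  finally show ?thesis using C that by blast
qed

lemma decays_bounded:
  assumes "decays F"
  obtains C where "\<And>x. norm (F x) \<le> C"
  using decaysE[OF assms, of 0] by (metis exp_zero mult_1 mult_zero_left)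

text \<open>An additional exponent k = 2 DIM / b of decay is spent on an integrable
  majorant.\<close>

lemma decays_integrable_weight:
  fixes F :: "'a::euclidean_space \<Rightarrow> 'b::{banach, second_countable_topology}"
  assumes [measurable]: "F \<in> borel_measurable borel" and F: "decays F"
  shows "integrable lborel (\<lambda>x. exp (m * \<omega> (norm x)) * norm (F x))"
proof -
  define k where "k = 2 * DIM('a) / b"
  obtain C where C: "\<And>x. exp ((m + k) * \<omega> (norm x)) * norm (F x) \<le> C"
    using decaysE[OF F] by metis
  have "integrable lborel (\<lambda>x::'a. C * exp (- k * \<omega> (norm x)))"
    by (intro integrable_mult_right integrable_exp_weight) (simp add: k_def)
  then show ?thesis
  proof (rule Bochner_Integration.integrable_bound)
    have "exp (m * \<omega> (norm x)) * norm (F x) \<le> C * exp (- k * \<omega> (norm x))" for x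
    proof -
      have "exp (m * \<omega> (norm x)) * norm (F x) = (exp ((m + k) * \<omega> (norm x)) * norm (F x)) * exp (- k * \<omega> (norm x))"
        by (simp add: distrib_right exp_add exp_minus)
      also have "\<dots> \<le> C * exp (- k * \<omega> (norm x))"
        by (intro mult_right_mono C) simp
      finally show ?thesis .
    qed
    then show "AE x in lborel. norm (exp (m * \<omega> (norm x)) * norm (F x)) \<le> norm (C * exp (- k * \<omega> (norm x)))"
      by (intro AE_I2) (auto simp: norm_mult intro: order_trans[OF _ abs_ge_self])
  qed measurable
qed

lemma decays_integrable:
  fixes F :: "'a::euclidean_space \<Rightarrow> 'b::{banach, second_countable_topology}"
  assumes [measurable]: "F \<in> borel_measurable borel" and F: "decays F"
  shows "integrable lborel F"
  by (rule Bochner_Integration.integrable_bound[OF decays_integrable_weight[OF assms, of 0]]) auto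

lemma continuous_decays:
  fixes F :: "'a::euclidean_space \<Rightarrow> 'b::real_normed_vector"
  assumes F: "continuous_on UNIV F" and fin: "\<And>m. m > 0 \<Longrightarrow> Lp_norm \<infinity> (weighted \<omega> m F) < \<infinity>"
  shows "decays F"
  unfolding decays_def
proof
  fix m :: real
  \<comment> \<open>The norms are known to be finite for positive exponents; any other m is
    dominated by such a one because \<omega> is nonnegative.\<close>
  define k where "k = max m 1"
  have "continuous_on UNIV (weighted \<omega> k F)"
    unfolding weighted_def by (intro continuous_intros F)
  then have le: "ennreal (norm (weighted \<omega> k F x)) \<le> Lp_norm \<infinity> (weighted \<omega> k F)" for x
    by (rule continuous_le_Lp_norm_infinity)
  have "exp (m * \<omega> (norm x)) * norm (F x) \<le> enn2real (Lp_norm \<infinity> (weighted \<omega> k F))" for x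
  proof -
    have "exp (m * \<omega> (norm x)) * norm (F x) \<le> norm (weighted \<omega> k F x)"
      unfolding weighted_def by (simp add: k_def mult_right_mono)
    also have "\<dots> = enn2real (ennreal (norm (weighted \<omega> k F x)))" by simp
    also have "\<dots> \<le> enn2real (Lp_norm \<infinity> (weighted \<omega> k F))"
      using fin[of k] by (intro enn2real_mono le) (simp add: k_def)
    finally show ?thesis .
  qed
  then show "\<exists>C. \<forall>x. exp (m * \<omega> (norm x)) * norm (F x) \<le> C" by blast
qed

lemma S_spaceD:
  assumes "f \<in> S_space \<omega>"
  shows "continuous_on UNIV f" "continuous_on UNIV (fourier f)" "decays f" "decays (fourier f)"
proof -
  have f: "smooth_fun f" "smooth_fun (fourier f)"
    "\<And>m \<alpha>. m > 0 \<Longrightarrow> Lp_norm \<infinity> (weighted \<omega> m (iter_partial \<alpha> f)) < \<infinity>"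
    "\<And>m \<alpha>. m > 0 \<Longrightarrow> Lp_norm \<infinity> (weighted \<omega> m (iter_partial \<alpha> (fourier f))) < \<infinity>"
    using assms by (auto simp: S_space_def)
  have nil: "iter_partial [] g = g" for g :: "real ^ 'n \<Rightarrow> complex"
    by (simp add: iter_partial_def)
  show c: "continuous_on UNIV f" "continuous_on UNIV (fourier f)"
    using f(1,2) nil unfolding smooth_fun_def by metis+
  show "decays f" "decays (fourier f)"
    using f(3,4)[of _ "[]"] by (auto intro!: continuous_decays c simp: nil)
qed

end

section \<open>Hoelder's inequality\<close>

lemma Lp_norm_finite_exponent:
  assumes "1 \<le> r"
  shows "Lp_norm (ennreal r) F =
    (if (\<integral>\<^sup>+z. ennreal (norm (F z) powr r) \<partial>lborel) = \<infinity> then \<infinity>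
     else ennreal (enn2real (\<integral>\<^sup>+z. ennreal (norm (F z) powr r) \<partial>lborel) powr (1 / r)))"
  using assms by (simp add: Lp_norm_def Let_def nn_integral_completion)

lemma Lp_norm_one: "Lp_norm 1 F = (\<integral>\<^sup>+z. ennreal (norm (F z)) \<partial>lborel)"
  using Lp_norm_finite_exponent[of 1 F] by (auto simp: less_top ennreal_enn2real_if)

lemma AE_le_Lp_norm_infinity: "AE z in lborel. ennreal (norm (F z)) \<le> Lp_norm \<infinity> F"
proof -
  have "AE z in lebesgue. ennreal (norm (F z)) \<le> Lp_norm \<infinity> F"
    unfolding Lp_norm_def by (simp add: esssup_AE)
  then show ?thesis by (simp add: AE_completion_iff)
qed

text \<open>Young's inequality, applied to u and v divided by their norms and then
  integrated.\<close>

lemma Holder_nn_integral: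
  fixes u v :: "'a::euclidean_space \<Rightarrow> real"
  assumes [measurable]: "u \<in> borel_measurable borel" "v \<in> borel_measurable borel"
    and nn: "\<And>x. 0 \<le> u x" "\<And>x. 0 \<le> v x"
    and pq: "1 < p" "1 < q" "1 / p + 1 / q = 1"
  shows "(\<integral>\<^sup>+z. ennreal (u z * v z) \<partial>lborel) \<le> Lp_norm (ennreal p) u * Lp_norm (ennreal q) v"
proof -
  let ?A = "\<integral>\<^sup>+z. ennreal (u z powr p) \<partial>lborel" and ?B = "\<integral>\<^sup>+z. ennreal (v z powr q) \<partial>lborel"
  have norm: "Lp_norm (ennreal p) u = (if ?A = \<infinity> then \<infinity> else ennreal (enn2real ?A powr (1 / p)))"
    "Lp_norm (ennreal q) v = (if ?B = \<infinity> then \<infinity> else ennreal (enn2real ?B powr (1 / q)))"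
    using pq nn by (simp_all add: Lp_norm_finite_exponent)
  have zero: "(\<integral>\<^sup>+z. ennreal (u z * v z) \<partial>lborel) = 0" if "?A = 0 \<or> ?B = 0"
  proof -
    have "(AE z in lborel. u z = 0) \<or> (AE z in lborel. v z = 0)"
      using that nn by (auto simp: nn_integral_0_iff_AE)
    then show ?thesis
      by (auto simp: nn_integral_0_iff_AE elim: AE_mp)
  qed
  \<comment> \<open>Since 0 times \<infinity> is 0 in \<open>ennreal\<close>, a vanishing factor is
    treated first: there the integrand is zero almost everywhere. After that an infinite factor
    makes the right-hand side infinite, and both norms can be divided by in the remaining
    case.\<close>
  consider "?A = 0 \<or> ?B = 0" | "?A \<noteq> 0" "?B \<noteq> 0" "?A = \<infinity> \<or> ?B = \<infinity>"
    | "?A \<noteq> 0" "?B \<noteq> 0" "?A \<noteq> \<infinity>" "?B \<noteq> \<infinity>"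
    by blast
  then show ?thesis
  proof cases
    case 1
    then show ?thesis using zero by simp
  next
    case 2
    then have "Lp_norm (ennreal p) u \<noteq> 0" "Lp_norm (ennreal q) v \<noteq> 0"
      unfolding norm by (auto simp: enn2real_eq_0_iff)
    then have "Lp_norm (ennreal p) u * Lp_norm (ennreal q) v = \<infinity>"
      using 2 unfolding norm by (auto simp: ennreal_mult_eq_top_iff)
    then show ?thesis by simp
  next
    case 3
    define A B where "A = enn2real ?A" and "B = enn2real ?B"
    have AB: "?A = ennreal A" "?B = ennreal B" "0 < A" "0 < B"
      using 3 by (auto simp: A_def B_def less_top enn2real_positive_iff zero_less_iff_neq_zero)
    define a c where "a = A powr (1 / p)" and "c = B powr (1 / q)"
    have ac: "0 < a" "0 < c" "a powr p = A" "c powr q = B"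
      using AB pq by (auto simp: a_def c_def powr_powr)
    \<comment> \<open>These absorb the conjugate exponents and the normalisation, so that \<alpha> A
      + \<beta> B = 1/p + 1/q = 1.\<close>
    define \<alpha> \<beta> where "\<alpha> = inverse (p * A)" and "\<beta> = inverse (q * B)"
    have \<alpha>\<beta>: "0 \<le> \<alpha>" "0 \<le> \<beta>"
      using AB pq by (simp_all add: \<alpha>_def \<beta>_def)
    have young: "u z * v z \<le> (a * c) * (\<alpha> * u z powr p + \<beta> * v z powr q)" for z
    proof -
      have "(u z / a) * (v z / c) \<le> (u z / a) powr p / p + (v z / c) powr q / q"
        by (rule Youngs_inequality) (use pq nn ac in auto)
      also have "\<dots> = \<alpha> * u z powr p + \<beta> * v z powr q"
        using ac nn pq by (simp add: powr_divide field_simps \<alpha>_def \<beta>_def)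
      finally have "(a * c) * ((u z / a) * (v z / c)) \<le> (a * c) * (\<alpha> * u z powr p + \<beta> * v z powr q)"
        using ac by (intro mult_left_mono) auto
      then show ?thesis using ac by simp
    qed
    have "(\<integral>\<^sup>+z. ennreal (u z * v z) \<partial>lborel)
        \<le> (\<integral>\<^sup>+z. ennreal (a * c) * (ennreal \<alpha> * ennreal (u z powr p) + ennreal \<beta> * ennreal (v z powr q)) \<partial>lborel)"
    proof (rule nn_integral_mono)
      fix z
      have "ennreal (u z * v z) \<le> ennreal ((a * c) * (\<alpha> * u z powr p + \<beta> * v z powr q))"
        by (rule ennreal_leI) (rule young)
      also have "\<dots> = ennreal (a * c) * (ennreal \<alpha> * ennreal (u z powr p) + ennreal \<beta> * ennreal (v z powr q))"
        using \<alpha>\<beta> ac(1,2) by (simp add: ennreal_mult)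
      finally show "ennreal (u z * v z) \<le> ennreal (a * c) * (ennreal \<alpha> * ennreal (u z powr p) + ennreal \<beta> * ennreal (v z powr q))" .
    qed
    also have "\<dots> = ennreal (a * c) * (ennreal \<alpha> * ?A + ennreal \<beta> * ?B)"
      by (simp add: nn_integral_cmult nn_integral_add)
    also have "\<dots> = ennreal ((a * c) * (\<alpha> * A + \<beta> * B))"
      unfolding AB(1,2) using \<alpha>\<beta> AB(3,4) ac(1,2) by (simp add: ennreal_mult)
    also have "\<alpha> * A + \<beta> * B = 1"
      using AB pq by (simp add: field_simps \<alpha>_def \<beta>_def)
    finally show ?thesis
      using 3 ac(1,2) unfolding norm a_def c_def A_def B_def by (simp flip: ennreal_mult)
  qed
qed

lemma Lp_norm_norm: "Lp_norm p (\<lambda>z. norm (F z)) = Lp_norm p F"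
  by (simp add: Lp_norm_def)

lemma Lp_norm_Holder_infinity:
  assumes [measurable]: "u \<in> borel_measurable borel" "v \<in> borel_measurable borel"
  shows "(\<integral>\<^sup>+z. ennreal (norm (u z)) * ennreal (norm (v z)) \<partial>lborel) \<le> Lp_norm \<infinity> u * Lp_norm 1 v"
proof -
  have "(\<integral>\<^sup>+z. ennreal (norm (u z)) * ennreal (norm (v z)) \<partial>lborel) \<le> (\<integral>\<^sup>+z. Lp_norm \<infinity> u * ennreal (norm (v z)) \<partial>lborel)"
  proof (rule nn_integral_mono_AE)
    show "AE z in lborel. ennreal (norm (u z)) * ennreal (norm (v z)) \<le> Lp_norm \<infinity> u * ennreal (norm (v z))"
      using AE_le_Lp_norm_infinity[of u] by eventually_elim (rule mult_right_mono, auto)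
  qed
  also have "\<dots> = Lp_norm \<infinity> u * Lp_norm 1 v"
    by (simp add: nn_integral_cmult Lp_norm_one)
  finally show ?thesis .
qed

theorem Lp_norm_Holder:
  fixes u :: "'a::euclidean_space \<Rightarrow> 'b::{real_normed_vector, second_countable_topology}"
    and v :: "'a \<Rightarrow> 'c::{real_normed_vector, second_countable_topology}"
  assumes [measurable]: "u \<in> borel_measurable borel" "v \<in> borel_measurable borel" and "1 \<le> p"
  shows "(\<integral>\<^sup>+z. ennreal (norm (u z)) * ennreal (norm (v z)) \<partial>lborel) \<le> Lp_norm p u * Lp_norm (conj_exponent p) v"
proof (cases p)
  case top
  then have "conj_exponent p = 1"
    using \<open>1 \<le> p\<close> by (simp add: conj_exponent_eq)
  then show ?thesis
    using Lp_norm_Holder_infinity[of u v] top by simp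
next
  case (real r)
  then have "1 \<le> r" using \<open>1 \<le> p\<close> by (simp flip: ennreal_1)
  show ?thesis
  proof (cases "r = 1")
    case True
    then have "p = 1" using real by simp
    then have "conj_exponent p = \<infinity>" by (simp add: conj_exponent_eq)
    with \<open>p = 1\<close> show ?thesis
      using Lp_norm_Holder_infinity[of v u] by (simp add: mult.commute)
  next
    case False
    with \<open>1 \<le> r\<close> have "1 < r" by simp
    have "conj_exponent p = inverse (1 - inverse (ennreal r))"
      using real \<open>1 \<le> p\<close> by (simp add: conj_exponent_eq)
    also have "\<dots> = ennreal (inverse (1 - inverse r))"
      using \<open>1 < r\<close> by (simp add: inverse_ennreal ennreal_minus field_simps flip: ennreal_1)
    finally have q: "conj_exponent p = ennreal (inverse (1 - inverse r))" .
    have "1 < inverse (1 - inverse r)"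
      using \<open>1 < r\<close> by (simp add: one_less_inverse_iff field_simps)
    then have "(\<integral>\<^sup>+z. ennreal (norm (u z) * norm (v z)) \<partial>lborel) \<le> Lp_norm p (\<lambda>z. norm (u z)) * Lp_norm (conj_exponent p) (\<lambda>z. norm (v z))"
      unfolding q unfolding real(2) by (intro Holder_nn_integral) (use \<open>1 < r\<close> in \<open>auto simp: inverse_eq_divide\<close>)
    then show ?thesis
      by (simp add: Lp_norm_norm ennreal_mult)
  qed
qed

lemma conj_exponent_ge_1: "1 \<le> p \<Longrightarrow> 1 \<le> conj_exponent p"
proof -
  assume p: "1 \<le> p"
  have "1 \<le> inverse x" if "x \<le> 1" for x :: ennreal
  proof (cases x)
    case (real t)
    then show ?thesis
      using that
      by (cases "t = 0") (auto simp: inverse_ennreal ennreal_le_1 one_le_inverse_iff simp flip: ennreal_1)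
  qed (use that in \<open>simp add: top_unique\<close>)
  from this[OF diff_le_self_ennreal] show ?thesis
    using p by (simp add: conj_exponent_eq)
qed

text \<open>Converts the L^(2p) norm of \<open>STFT\<close>, which Hoelder's inequality produces,
  into the L^p norm of the spectrogram.\<close>

lemma Lp_norm_double_square_le:
  fixes F :: "'a::euclidean_space \<Rightarrow> 'b::{real_normed_vector, second_countable_topology}"
  assumes [measurable]: "F \<in> borel_measurable borel" and "1 \<le> p"
  shows "(Lp_norm (2 * p) F)\<^sup>2 \<le> Lp_norm p (\<lambda>z. (norm (F z))\<^sup>2)"
proof (cases p)
  case top
  show ?thesis
  proof (cases "Lp_norm p (\<lambda>z. (norm (F z))\<^sup>2)")
    case (real C)
    have "AE z in lborel. ennreal (norm (F z)) \<le> ennreal (sqrt C)"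
      using AE_le_Lp_norm_infinity[of "\<lambda>z. (norm (F z))\<^sup>2"] real top
      by (auto elim!: eventually_mono simp: real_le_rsqrt)
    then have "esssup lebesgue (\<lambda>z. ennreal (norm (F z))) \<le> ennreal (sqrt C)"
      by (intro esssup_I) (auto intro: AE_completion measurable_completion)
    then have "Lp_norm (2 * p) F \<le> ennreal (sqrt C)"
      using top by (simp add: Lp_norm_def ennreal_mult_top)
    then have "(Lp_norm (2 * p) F)\<^sup>2 \<le> (ennreal (sqrt C))\<^sup>2"
      by (rule power_mono) simp
    also have "\<dots> = ennreal C"
      using real by (simp add: ennreal_power)
    finally show ?thesis using real by simp
  qed simp
next
  case (real r)
  then have "1 \<le> r" using \<open>1 \<le> p\<close> by (simp flip: ennreal_1)
  have p2: "2 * p = ennreal (2 * r)"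
    using real by (simp add: ennreal_mult flip: ennreal_numeral)
  have eq: "(norm (F z))\<^sup>2 powr r = norm (F z) powr (2 * r)" for z
    by (simp add: powr_powr flip: powr_numeral)
  have sq: "(x powr (1 / (2 * r)))\<^sup>2 = x powr (1 / r)" if "0 \<le> x" for x
    using \<open>1 \<le> r\<close> that by (cases "x = 0") (simp_all add: powr_powr flip: powr_numeral)
  show ?thesis
    unfolding p2 unfolding real(2) using \<open>1 \<le> r\<close>
    by (simp add: Lp_norm_finite_exponent eq sq ennreal_power)
qed

lemma Lp_norm_reflect_le:
  fixes F :: "'a::euclidean_space \<Rightarrow> 'b::{real_normed_vector, second_countable_topology}"
  assumes [measurable]: "F \<in> borel_measurable borel" and "1 \<le> p"
  shows "Lp_norm p (\<lambda>w. F (z - w)) \<le> Lp_norm p F"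
proof (cases p)
  case top
  have "distr lborel borel (\<lambda>w. z + (-1) *\<^sub>R w) = lborel"
    using lborel_affine[of "-1" z] by (simp add: density_1)
  then have lb: "distr lborel borel (\<lambda>w. z - w) = lborel" by simp
  have "AE w in distr lborel borel (\<lambda>w. z - w). ennreal (norm (F w)) \<le> Lp_norm \<infinity> F"
    unfolding lb by (rule AE_le_Lp_norm_infinity)
  then have "AE w in lborel. ennreal (norm (F (z - w))) \<le> Lp_norm \<infinity> F"
    by (rule AE_distrD[rotated]) simp
  then have "esssup lebesgue (\<lambda>w. ennreal (norm (F (z - w)))) \<le> Lp_norm \<infinity> F"
    by (intro esssup_I) (auto intro: AE_completion measurable_completion)
  then show ?thesis
    using top by (simp add: Lp_norm_def)
next
  case (real r)
  then have "1 \<le> r" using \<open>1 \<le> p\<close> by (simp flip: ennreal_1)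
  have "(\<integral>\<^sup>+w. ennreal (norm (F (z - w)) powr r) \<partial>lborel) = (\<integral>\<^sup>+w. ennreal (norm (F w) powr r) \<partial>lborel)"
    using nn_integral_lborel_affine[where F="\<lambda>w. ennreal (norm (F w) powr r)" and c="-1" and t=z] by simp
  then show ?thesis
    unfolding real(2) using \<open>1 \<le> r\<close> by (simp add: Lp_norm_finite_exponent)
qed

section \<open>The Wigner transform\<close>

text \<open>No integrability is assumed: a non-integrable function has Bochner integral 0, and then
  the bound is trivial.\<close>

lemma ennreal_norm_integral_le:
  fixes F :: "'a \<Rightarrow> 'b::{banach, second_countable_topology}"
  shows "ennreal (norm (\<integral>x. F x \<partial>M)) \<le> (\<integral>\<^sup>+x. ennreal (norm (F x)) \<partial>M)"
  by (cases "integrable M F") (auto simp: integral_norm_bound_ennreal not_integrable_integral_eq)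

lemma borel_measurable_cnj [measurable (raw)]:
  assumes "F \<in> borel_measurable M"
  shows "(\<lambda>x. cnj (F x)) \<in> borel_measurable M"
  by (rule borel_measurable_continuous_on[OF _ assms]) (intro continuous_intros)

text \<open>Cauchy-Schwarz separates the two factors before the substitutions are undone, so the
  offsets p and q leave no trace and only the Jacobians remain.\<close>

lemma Cauchy_Schwarz_lborel_affine:
  fixes \<phi> \<psi> :: "'a::euclidean_space \<Rightarrow> ennreal"
  assumes [measurable]: "\<phi> \<in> borel_measurable borel" "\<psi> \<in> borel_measurable borel"
    and "c \<noteq> 0" "d \<noteq> 0"
  shows "(\<integral>\<^sup>+t. \<phi> (p + c *\<^sub>R t) * \<psi> (q + d *\<^sub>R t) \<partial>lborel)\<^sup>2
    \<le> ennreal (1 / (\<bar>c\<bar> * \<bar>d\<bar>) ^ DIM('a)) * ((\<integral>\<^sup>+y. (\<phi> y)\<^sup>2 \<partial>lborel) * (\<integral>\<^sup>+y. (\<psi> y)\<^sup>2 \<partial>lborel))"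
proof -
  have "(\<integral>\<^sup>+t. \<phi> (p + c *\<^sub>R t) * \<psi> (q + d *\<^sub>R t) \<partial>lborel)\<^sup>2
     \<le> (\<integral>\<^sup>+t. (\<phi> (p + c *\<^sub>R t))\<^sup>2 \<partial>lborel) * (\<integral>\<^sup>+t. (\<psi> (q + d *\<^sub>R t))\<^sup>2 \<partial>lborel)"
    by (rule Cauchy_Schwarz_nn_integral) auto
  also have "(\<integral>\<^sup>+t. (\<phi> (p + c *\<^sub>R t))\<^sup>2 \<partial>lborel) = ennreal (1 / \<bar>c\<bar> ^ DIM('a)) * (\<integral>\<^sup>+y. (\<phi> y)\<^sup>2 \<partial>lborel)"
    by (rule nn_integral_lborel_affine) (use assms in auto)
  also have "(\<integral>\<^sup>+t. (\<psi> (q + d *\<^sub>R t))\<^sup>2 \<partial>lborel) = ennreal (1 / \<bar>d\<bar> ^ DIM('a)) * (\<integral>\<^sup>+y. (\<psi> y)\<^sup>2 \<partial>lborel)"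
    by (rule nn_integral_lborel_affine) (use assms in auto)
  also have "ennreal (1 / \<bar>c\<bar> ^ DIM('a)) * (\<integral>\<^sup>+y. (\<phi> y)\<^sup>2 \<partial>lborel) * (ennreal (1 / \<bar>d\<bar> ^ DIM('a)) * (\<integral>\<^sup>+y. (\<psi> y)\<^sup>2 \<partial>lborel))
    = (ennreal (1 / \<bar>c\<bar> ^ DIM('a)) * ennreal (1 / \<bar>d\<bar> ^ DIM('a))) * ((\<integral>\<^sup>+y. (\<phi> y)\<^sup>2 \<partial>lborel) * (\<integral>\<^sup>+y. (\<psi> y)\<^sup>2 \<partial>lborel))"
    by (simp only: mult_ac)
  also have "ennreal (1 / \<bar>c\<bar> ^ DIM('a)) * ennreal (1 / \<bar>d\<bar> ^ DIM('a)) = ennreal (1 / (\<bar>c\<bar> * \<bar>d\<bar>) ^ DIM('a))"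
    by (simp add: power_mult_distrib flip: ennreal_mult)
  finally show ?thesis .
qed

text \<open>The sesquilinear form behind \<open>Wig\<close>. Two arguments are needed because
  inversion formulas are later inserted one slot at a time.\<close>

definition cross_Wig :: "real \<Rightarrow> (real ^ 'n \<Rightarrow> complex) \<Rightarrow> (real ^ 'n \<Rightarrow> complex) \<Rightarrow> (real ^ 'n) \<times> (real ^ 'n) \<Rightarrow> complex" where
  "cross_Wig \<tau> h k = (\<lambda>(x, \<xi>). \<integral>t. exp (- (\<i> * of_real (t \<bullet> \<xi>))) * (h (x + \<tau> *\<^sub>R t) * cnj (k (x - (1 - \<tau>) *\<^sub>R t))) \<partial>lborel)"

lemma Wig_eq_cross_Wig:
  assumes [measurable]: "f \<in> borel_measurable borel"
  shows "Wig \<tau> f = cross_Wig \<tau> f f"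
  unfolding Wig_def cross_Wig_def by (subst integral_completion) (auto simp: mult.assoc)

lemma borel_measurable_cross_Wig [measurable]:
  assumes [measurable]: "h \<in> borel_measurable borel" "k \<in> borel_measurable borel"
  shows "cross_Wig \<tau> h k \<in> borel_measurable borel"
proof -
  have "(\<lambda>z. \<integral>t. exp (- (\<i> * of_real (t \<bullet> snd z))) * (h (fst z + \<tau> *\<^sub>R t) * cnj (k (fst z - (1 - \<tau>) *\<^sub>R t))) \<partial>lborel)
      \<in> borel_measurable (borel \<Otimes>\<^sub>M borel)"
    by measurable
  then show ?thesis
    by (simp add: cross_Wig_def case_prod_beta borel_prod)
qed

lemma borel_measurable_Wig [measurable]:
  "f \<in> borel_measurable borel \<Longrightarrow> Wig \<tau> f \<in> borel_measurable borel"
  by (simp add: Wig_eq_cross_Wig)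

text \<open>Reflecting the function interchanges \<tau> and 1 - \<tau> up to conjugation. This
  explains the reflected window in \<open>D5\<close>: it turns the correlation variable w - z into
  the convolution variable z - w.\<close>

lemma norm_cross_Wig_swap: "norm (cross_Wig (1 - \<tau>) (\<lambda>t. k (- t)) (\<lambda>t. k (- t)) z) = norm (cross_Wig \<tau> k k (- z))"
proof (cases z)
  case (Pair x \<xi>)
  have "cross_Wig (1 - \<tau>) (\<lambda>t. k (- t)) (\<lambda>t. k (- t)) (x, \<xi>)
     = (\<integral>t. cnj (exp (- (\<i> * of_real (t \<bullet> (- \<xi>)))) * (k (- x + \<tau> *\<^sub>R t) * cnj (k (- x - (1 - \<tau>) *\<^sub>R t)))) \<partial>lborel)"
    unfolding cross_Wig_def prod.case
    by (rule Bochner_Integration.integral_cong[OF refl]) (simp add: exp_cnj mult_ac)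
  also have "\<dots> = cnj (cross_Wig \<tau> k k (- z))"
    unfolding cross_Wig_def Pair uminus_Pair prod.case by (rule Bochner_Integration.integral_cnj)
  finally show ?thesis using Pair by simp
qed

section \<open>Weighted pointwise bounds for the Wigner transform\<close>

context weight
begin

text \<open>The square of a weighted L2 norm, kept without the root because the bounds contain it as
  a factor; for a = 0 it is the squared L2 norm of F.\<close>

definition weighted_L2 :: "real \<Rightarrow> ('a::euclidean_space \<Rightarrow> complex) \<Rightarrow> real" where
  "weighted_L2 a F = (\<integral>y. (exp (a * \<omega> (norm y)) * norm (F y))\<^sup>2 \<partial>lborel)"

lemma weighted_L2_nonneg: "0 \<le> weighted_L2 a F"
  unfolding weighted_L2_def by simp

lemma nn_integral_weighted_L2:
  fixes F :: "'a::euclidean_space \<Rightarrow> complex"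
  assumes [measurable]: "F \<in> borel_measurable borel" and F: "decays F"
  shows "(\<integral>\<^sup>+y. (ennreal (exp (a * \<omega> (norm y)) * norm (F y)))\<^sup>2 \<partial>lborel) = ennreal (weighted_L2 a F)"
proof -
  obtain C where C: "\<And>x. exp (a * \<omega> (norm x)) * norm (F x) \<le> C"
    using decaysE[OF F] by metis
  have "integrable lborel (\<lambda>y. (exp (a * \<omega> (norm y)) * norm (F y))\<^sup>2)"
  proof (rule Bochner_Integration.integrable_bound)
    show "integrable lborel (\<lambda>y. C * (exp (a * \<omega> (norm y)) * norm (F y)))"
      by (intro integrable_mult_right decays_integrable_weight F) measurable
    have "(exp (a * \<omega> (norm y)) * norm (F y))\<^sup>2 \<le> C * (exp (a * \<omega> (norm y)) * norm (F y))" for y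
      unfolding power2_eq_square by (intro mult_right_mono C) simp
    then show "AE y in lborel. norm ((exp (a * \<omega> (norm y)) * norm (F y))\<^sup>2) \<le> norm (C * (exp (a * \<omega> (norm y)) * norm (F y)))"
      by (intro AE_I2) (auto intro: order_trans[OF _ abs_ge_self])
  qed measurable
  then show ?thesis
    unfolding weighted_L2_def by (simp add: nn_integral_eq_integral ennreal_power)
qed

text \<open>The common core of the bounds in time and in frequency. Since |x| is at most the larger
  of the two norms, \<open>w_max\<close> splits the weight at x into a weight on each factor without
  any K, and Cauchy-Schwarz does the rest.\<close>

lemma weighted_affine_convolution_le:
  fixes \<phi> :: "'a::euclidean_space \<Rightarrow> complex"
  assumes [measurable]: "\<phi> \<in> borel_measurable borel" and \<phi>: "decays \<phi>" and "0 \<le> a" "c \<noteq> 0" "d \<noteq> 0"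
    and le: "\<And>t. norm x \<le> max (norm (p + c *\<^sub>R t)) (norm (q + d *\<^sub>R t))"
    and A: "ennreal A \<le> ennreal B * (\<integral>\<^sup>+t. ennreal (norm (\<phi> (p + c *\<^sub>R t)) * norm (\<phi> (q + d *\<^sub>R t))) \<partial>lborel)"
    and "0 \<le> A" "0 \<le> B"
  shows "(exp (a * \<omega> (norm x)) * A)\<^sup>2 \<le> B\<^sup>2 / (\<bar>c\<bar> * \<bar>d\<bar>) ^ DIM('a) * (weighted_L2 a \<phi>)\<^sup>2"
proof -
  let ?w = "\<lambda>y. ennreal (exp (a * \<omega> (norm y)) * norm (\<phi> y))"
  have "ennreal (exp (a * \<omega> (norm x)) * A) = ennreal (exp (a * \<omega> (norm x))) * ennreal A"
    using \<open>0 \<le> A\<close> by (simp add: ennreal_mult)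
  also have "\<dots> \<le> ennreal (exp (a * \<omega> (norm x))) * (ennreal B * (\<integral>\<^sup>+t. ennreal (norm (\<phi> (p + c *\<^sub>R t)) * norm (\<phi> (q + d *\<^sub>R t))) \<partial>lborel))"
    by (intro mult_left_mono A) simp
  also have "\<dots> = ennreal B * (\<integral>\<^sup>+t. ennreal (exp (a * \<omega> (norm x))) * ennreal (norm (\<phi> (p + c *\<^sub>R t)) * norm (\<phi> (q + d *\<^sub>R t))) \<partial>lborel)"
    by (subst nn_integral_cmult) (auto simp: ac_simps)
  also have "\<dots> \<le> ennreal B * (\<integral>\<^sup>+t. ?w (p + c *\<^sub>R t) * ?w (q + d *\<^sub>R t) \<partial>lborel)"
  proof (intro mult_left_mono nn_integral_mono)
    fix t
    have "a * \<omega> (norm x) \<le> a * (\<omega> (norm (p + c *\<^sub>R t)) + \<omega> (norm (q + d *\<^sub>R t)))"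
      by (intro mult_left_mono w_max le \<open>0 \<le> a\<close>) auto
    then have "exp (a * \<omega> (norm x)) \<le> exp (a * \<omega> (norm (p + c *\<^sub>R t))) * exp (a * \<omega> (norm (q + d *\<^sub>R t)))"
      by (simp add: distrib_left flip: exp_add)
    then have "exp (a * \<omega> (norm x)) * (norm (\<phi> (p + c *\<^sub>R t)) * norm (\<phi> (q + d *\<^sub>R t)))
       \<le> exp (a * \<omega> (norm (p + c *\<^sub>R t))) * exp (a * \<omega> (norm (q + d *\<^sub>R t))) * (norm (\<phi> (p + c *\<^sub>R t)) * norm (\<phi> (q + d *\<^sub>R t)))"
      by (intro mult_right_mono) auto
    then show "ennreal (exp (a * \<omega> (norm x))) * ennreal (norm (\<phi> (p + c *\<^sub>R t)) * norm (\<phi> (q + d *\<^sub>R t))) \<le> ?w (p + c *\<^sub>R t) * ?w (q + d *\<^sub>R t)"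
      by (simp add: ac_simps flip: ennreal_mult)
  qed simp
  finally have "(ennreal (exp (a * \<omega> (norm x)) * A))\<^sup>2 \<le> (ennreal B * (\<integral>\<^sup>+t. ?w (p + c *\<^sub>R t) * ?w (q + d *\<^sub>R t) \<partial>lborel))\<^sup>2"
    by (rule power_mono) simp
  also have "\<dots> = (ennreal B)\<^sup>2 * (\<integral>\<^sup>+t. ?w (p + c *\<^sub>R t) * ?w (q + d *\<^sub>R t) \<partial>lborel)\<^sup>2"
    by (rule power_mult_distrib)
  also have "\<dots> \<le> (ennreal B)\<^sup>2 * (ennreal (1 / (\<bar>c\<bar> * \<bar>d\<bar>) ^ DIM('a)) * ((\<integral>\<^sup>+y. (?w y)\<^sup>2 \<partial>lborel) * (\<integral>\<^sup>+y. (?w y)\<^sup>2 \<partial>lborel)))"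
    by (intro mult_left_mono Cauchy_Schwarz_lborel_affine) (use assms in auto)
  also have "\<dots> = ennreal (B\<^sup>2 / (\<bar>c\<bar> * \<bar>d\<bar>) ^ DIM('a) * (weighted_L2 a \<phi>)\<^sup>2)"
    unfolding nn_integral_weighted_L2[OF assms(1) \<phi>]
    using \<open>0 \<le> B\<close> weighted_L2_nonneg[of a \<phi>]
    by (simp add: power2_eq_square flip: ennreal_mult)
  finally show ?thesis
    using \<open>0 \<le> A\<close> by (simp add: ennreal_power weighted_L2_nonneg)
qed

text \<open>The two points at which f is evaluated have x as their convex combination with weights 1
  - \<tau> and \<tau>. The Jacobians \<tau> and 1 - \<tau> multiply to \<tau> - \<tau>^2.\<close>

lemma Wig_time_bound:
  fixes f :: "real ^ 'n \<Rightarrow> complex"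
  assumes [measurable]: "f \<in> borel_measurable borel" and f: "decays f" and "0 \<le> a" "0 < \<tau>" "\<tau> < 1"
  shows "(exp (a * \<omega> (norm x)) * norm (Wig \<tau> f (x, \<xi>)))\<^sup>2 \<le> 1 / (\<tau> - \<tau>\<^sup>2) ^ CARD('n) * (weighted_L2 a f)\<^sup>2"
proof -
  have "(exp (a * \<omega> (norm x)) * norm (Wig \<tau> f (x, \<xi>)))\<^sup>2 \<le> 1\<^sup>2 / (\<bar>\<tau>\<bar> * \<bar>- (1 - \<tau>)\<bar>) ^ DIM(real^'n) * (weighted_L2 a f)\<^sup>2"
  proof (rule weighted_affine_convolution_le[where p=x and q=x])
    fix t
    have "norm x = norm ((1 - \<tau>) *\<^sub>R (x + \<tau> *\<^sub>R t) + \<tau> *\<^sub>R (x + (- (1 - \<tau>)) *\<^sub>R t))"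
      by (simp add: algebra_simps)
    also have "\<dots> \<le> (1 - \<tau>) * norm (x + \<tau> *\<^sub>R t) + \<tau> * norm (x + (- (1 - \<tau>)) *\<^sub>R t)"
      using norm_triangle_ineq[of "(1 - \<tau>) *\<^sub>R (x + \<tau> *\<^sub>R t)" "\<tau> *\<^sub>R (x + (- (1 - \<tau>)) *\<^sub>R t)"] assms by simp
    also have "\<dots> \<le> max (norm (x + \<tau> *\<^sub>R t)) (norm (x + (- (1 - \<tau>)) *\<^sub>R t))"
      by (rule convex_bound_le) (use assms in auto)
    finally show "norm x \<le> max (norm (x + \<tau> *\<^sub>R t)) (norm (x + (- (1 - \<tau>)) *\<^sub>R t))" .
  next
    have "ennreal (norm (Wig \<tau> f (x, \<xi>))) \<le> (\<integral>\<^sup>+t. ennreal (norm (f (x + \<tau> *\<^sub>R t)) * norm (f (x + (- (1 - \<tau>)) *\<^sub>R t))) \<partial>lborel)"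
      unfolding Wig_eq_cross_Wig[OF assms(1)] cross_Wig_def prod.case
      by (rule order_trans[OF ennreal_norm_integral_le]) (simp add: norm_mult algebra_simps)
    then show "ennreal (norm (Wig \<tau> f (x, \<xi>))) \<le> ennreal 1 * (\<integral>\<^sup>+t. ennreal (norm (f (x + \<tau> *\<^sub>R t)) * norm (f (x + (- (1 - \<tau>)) *\<^sub>R t))) \<partial>lborel)"
      by simp
  qed (use assms in auto)
  moreover have "\<bar>\<tau>\<bar> * \<bar>- (1 - \<tau>)\<bar> = \<tau> - \<tau>\<^sup>2"
    using assms by (simp add: power2_eq_square algebra_simps)
  ultimately show ?thesis by simp
qed

text \<open>For fixed x, \<open>fourier_mult\<close> expresses the transform as a convolution of
  dilated copies of the Fourier transform of f, evaluated up to conjugation and phase at \<eta> /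
  \<tau> and (\<xi> - \<eta>) / (1 - \<tau>). With weights \<tau> and 1 - \<tau> these points
  average to \<xi>, so the argument in time repeats itself.\<close>

lemma Wig_frequency_bound:
  fixes f :: "real ^ 'n \<Rightarrow> complex"
  assumes f: "f \<in> S_space \<omega>" and "0 \<le> a" and \<tau>: "0 < \<tau>" "\<tau> < 1"
  shows "(exp (a * \<omega> (norm \<xi>)) * norm (Wig \<tau> f (x, \<xi>)))\<^sup>2
    \<le> 1 / ((2 * pi) ^ CARD('n))\<^sup>2 / (\<tau> - \<tau>\<^sup>2) ^ CARD('n) * (weighted_L2 a (fourier f))\<^sup>2"
proof -
  let ?N = "CARD('n)"
  note f' = S_spaceD[OF f]
  have [measurable]: "f \<in> borel_measurable borel"
    by (rule borel_measurable_continuous_onI[OF f'(1)])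
  have intf: "integrable lborel f" and intff: "integrable lborel (fourier f)"
    by (auto intro!: decays_integrable f')
  let ?H = "\<lambda>t. f (x + \<tau> *\<^sub>R t)" and ?Gc = "\<lambda>t. f (x + (- (1 - \<tau>)) *\<^sub>R t)"
  let ?G = "\<lambda>t. cnj (?Gc t)"
  have nH: "norm (fourier ?H \<eta>) = norm (fourier f ((1 / \<tau>) *\<^sub>R \<eta>)) / \<tau> ^ ?N" for \<eta>
    using \<tau> by (subst norm_fourier_affine) auto
  have nG: "norm (fourier ?G \<eta>) = norm (fourier f ((1 / (1 - \<tau>)) *\<^sub>R \<eta>)) / (1 - \<tau>) ^ ?N" for \<eta>
  proof -
    have "norm (fourier ?G \<eta>) = norm (cnj (fourier ?Gc (- \<eta>)))"
      by (rule arg_cong[OF fourier_cnj])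
    also have "\<dots> = norm (fourier ?Gc (- \<eta>))"
      by (rule complex_mod_cnj)
    also have "\<dots> = norm (fourier f ((1 / (- (1 - \<tau>))) *\<^sub>R (- \<eta>))) / \<bar>- (1 - \<tau>)\<bar> ^ ?N"
      by (rule norm_fourier_affine) (use \<tau> in auto)
    also have "(1 / (- (1 - \<tau>))) *\<^sub>R (- \<eta>) = (1 / (1 - \<tau>)) *\<^sub>R \<eta>"
      by (simp only: divide_minus_right scaleR_minus_left scaleR_minus_right minus_minus)
    also have "\<bar>- (1 - \<tau>)\<bar> = 1 - \<tau>"
      using \<tau> by simp
    finally show ?thesis .
  qed
  obtain C where C: "\<And>x. norm (f x) \<le> C"
    using decays_bounded[OF f'(3)] by metis
  have fm: "(\<integral>\<eta>. fourier ?H \<eta> * fourier ?G (\<xi> - \<eta>) \<partial>lborel) = of_real ((2 * pi) ^ ?N) * fourier (\<lambda>t. ?H t * ?G t) \<xi>"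
  proof (rule fourier_mult[where B=C])
    show "integrable lborel ?H"
      using \<tau> by (intro integrable_lborel_affine intf) auto
    show "continuous_on UNIV ?G"
      by (intro continuous_intros continuous_on_compose2[OF f'(1)]) auto
    show "integrable lborel ?G"
      using \<tau> by (intro integrable_cnj integrable_lborel_affine intf) auto
    have "integrable lborel (\<lambda>\<eta>. norm (fourier f (0 + (1 / (1 - \<tau>)) *\<^sub>R \<eta>)) / (1 - \<tau>) ^ ?N)"
      using \<tau> by (intro integrable_divide integrable_norm integrable_lborel_affine intff) auto
    then show "integrable lborel (fourier ?G)"
    proof (rule Bochner_Integration.integrable_bound)
      show "AE \<eta> in lborel. norm (fourier ?G \<eta>) \<le> norm (norm (fourier f (0 + (1 / (1 - \<tau>)) *\<^sub>R \<eta>)) / (1 - \<tau>) ^ ?N)"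
        unfolding nG by (rule AE_I2) (use \<tau> in simp)
    qed auto
  qed (use C in auto)
  have W: "Wig \<tau> f (x, \<xi>) = fourier (\<lambda>t. ?H t * ?G t) \<xi>"
    by (simp add: Wig_eq_cross_Wig cross_Wig_def fourier_lborel algebra_simps)
  have le: "(exp (a * \<omega> (norm \<xi>)) * norm (Wig \<tau> f (x, \<xi>)))\<^sup>2
    \<le> (1 / (2 * pi) ^ ?N / (\<tau> - \<tau>\<^sup>2) ^ ?N)\<^sup>2 / (\<bar>1 / \<tau>\<bar> * \<bar>- (1 / (1 - \<tau>))\<bar>) ^ DIM(real^'n) * (weighted_L2 a (fourier f))\<^sup>2"
  proof (rule weighted_affine_convolution_le[where p=0 and q="(1 / (1 - \<tau>)) *\<^sub>R \<xi>"])
    fix t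
    let ?u = "0 + (1 / \<tau>) *\<^sub>R t" and ?v = "(1 / (1 - \<tau>)) *\<^sub>R \<xi> + (- (1 / (1 - \<tau>))) *\<^sub>R t"
    have "(1 - \<tau>) *\<^sub>R ?v = \<xi> - t"
      using \<tau> by (simp add: scaleR_diff_right)
    then have "norm \<xi> = norm (\<tau> *\<^sub>R ?u + (1 - \<tau>) *\<^sub>R ?v)"
      using \<tau> by simp
    also have "\<dots> \<le> \<tau> * norm ?u + (1 - \<tau>) * norm ?v"
      using norm_triangle_ineq[of "\<tau> *\<^sub>R ?u" "(1 - \<tau>) *\<^sub>R ?v"] \<tau> by simp
    also have "\<dots> \<le> max (norm ?u) (norm ?v)"
      by (rule convex_bound_le) (use \<tau> in auto)
    finally show "norm \<xi> \<le> max (norm ?u) (norm ?v)" .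
  next
    have eq: "ennreal (norm (fourier ?H \<eta> * fourier ?G (\<xi> - \<eta>)))
       = ennreal (1 / (\<tau> - \<tau>\<^sup>2) ^ ?N) * ennreal (norm (fourier f (0 + (1 / \<tau>) *\<^sub>R \<eta>)) * norm (fourier f ((1 / (1 - \<tau>)) *\<^sub>R \<xi> + (- (1 / (1 - \<tau>))) *\<^sub>R \<eta>)))" for \<eta>
    proof -
      have "\<tau> - \<tau>\<^sup>2 = \<tau> * (1 - \<tau>)"
        by (simp add: power2_eq_square algebra_simps)
      then show ?thesis
        using \<tau> unfolding norm_mult nH nG by (simp add: power_mult_distrib scaleR_diff_right flip: ennreal_mult)
    qed
    have "ennreal ((2 * pi) ^ ?N) * ennreal (norm (Wig \<tau> f (x, \<xi>))) = ennreal (norm (\<integral>\<eta>. fourier ?H \<eta> * fourier ?G (\<xi> - \<eta>) \<partial>lborel))"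
      unfolding fm W by (simp add: norm_mult norm_power flip: ennreal_mult)
    also have "\<dots> \<le> (\<integral>\<^sup>+\<eta>. ennreal (norm (fourier ?H \<eta> * fourier ?G (\<xi> - \<eta>))) \<partial>lborel)"
      by (rule ennreal_norm_integral_le)
    also have "\<dots> = ennreal (1 / (\<tau> - \<tau>\<^sup>2) ^ ?N) * (\<integral>\<^sup>+\<eta>. ennreal (norm (fourier f (0 + (1 / \<tau>) *\<^sub>R \<eta>)) * norm (fourier f ((1 / (1 - \<tau>)) *\<^sub>R \<xi> + (- (1 / (1 - \<tau>))) *\<^sub>R \<eta>))) \<partial>lborel)"
      (is "_ = _ * ?I")
      unfolding eq by (rule nn_integral_cmult) measurable
    finally have "ennreal (1 / (2 * pi) ^ ?N) * (ennreal ((2 * pi) ^ ?N) * ennreal (norm (Wig \<tau> f (x, \<xi>)))) \<le> ennreal (1 / (2 * pi) ^ ?N) * (ennreal (1 / (\<tau> - \<tau>\<^sup>2) ^ ?N) * ?I)"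
      by (rule mult_left_mono) simp
    moreover have "0 \<le> \<tau> - \<tau>\<^sup>2"
      using \<tau> by (simp add: power2_eq_square mult_left_le)
    ultimately show "ennreal (norm (Wig \<tau> f (x, \<xi>))) \<le> ennreal (1 / (2 * pi) ^ ?N / (\<tau> - \<tau>\<^sup>2) ^ ?N) * ?I"
      by (simp flip: mult.assoc ennreal_mult)
  qed (use \<tau> f' \<open>0 \<le> a\<close> in \<open>auto simp: power2_eq_square mult_left_le\<close>)
  \<comment> \<open>The squared prefactor contains \<tau> - \<tau>^2 to the power -2N; undoing the
    dilations by 1/\<tau> and 1/(1 - \<tau>) returns a power N.\<close>
  have "(1 / (2 * pi) ^ ?N / (\<tau> - \<tau>\<^sup>2) ^ ?N)\<^sup>2 / (\<bar>1 / \<tau>\<bar> * \<bar>- (1 / (1 - \<tau>))\<bar>) ^ DIM(real^'n)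
    = 1 / ((2 * pi) ^ ?N)\<^sup>2 / (\<tau> - \<tau>\<^sup>2) ^ ?N"
  proof -
    have pos: "0 < \<tau> - \<tau>\<^sup>2"
      using \<tau> by (simp add: power2_eq_square)
    have "\<bar>1 / \<tau>\<bar> * \<bar>- (1 / (1 - \<tau>))\<bar> = 1 / (\<tau> - \<tau>\<^sup>2)"
      using \<tau> by (simp add: power2_eq_square algebra_simps)
    then show ?thesis
      using pos by (simp add: power_divide power2_eq_square)
  qed
  from le[unfolded this] show ?thesis .
qed

text \<open>The two previous bounds are multiplied and the root is taken, which leaves the square of
  the modulus of \<open>Wig\<close>. The weight is the sum \<omega>(|x|) + \<omega>(|\<xi>|);
  replacing it by \<omega>(|(x,\<xi>)|) costs a factor K and is left to
  \<open>exp_w_Pair_le\<close>.\<close>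

lemma Wig_bound:
  fixes f :: "real ^ 'n \<Rightarrow> complex"
  assumes f: "f \<in> S_space \<omega>" and "0 \<le> a" and \<tau>: "0 < \<tau>" "\<tau> < 1"
  shows "exp (a * (\<omega> (norm x) + \<omega> (norm \<xi>))) * (norm (Wig \<tau> f (x, \<xi>)))\<^sup>2
    \<le> 1 / (2 * pi) ^ CARD('n) / (\<tau> - \<tau>\<^sup>2) ^ CARD('n) * (weighted_L2 a f * weighted_L2 a (fourier f))"
proof (rule power2_le_imp_le)
  note f' = S_spaceD[OF f]
  have [measurable]: "f \<in> borel_measurable borel"
    by (rule borel_measurable_continuous_onI[OF f'(1)])
  let ?W = "norm (Wig \<tau> f (x, \<xi>))"
  have "(exp (a * (\<omega> (norm x) + \<omega> (norm \<xi>))) * ?W\<^sup>2)\<^sup>2 = (exp (a * \<omega> (norm x)) * ?W)\<^sup>2 * (exp (a * \<omega> (norm \<xi>)) * ?W)\<^sup>2"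
    by (simp add: distrib_left exp_add power_mult_distrib power2_eq_square)
  also have "\<dots> \<le> (1 / (\<tau> - \<tau>\<^sup>2) ^ CARD('n) * (weighted_L2 a f)\<^sup>2)
     * (1 / ((2 * pi) ^ CARD('n))\<^sup>2 / (\<tau> - \<tau>\<^sup>2) ^ CARD('n) * (weighted_L2 a (fourier f))\<^sup>2)"
    by (intro mult_mono Wig_time_bound Wig_frequency_bound f f' \<open>0 \<le> a\<close> \<tau>)
       (use \<tau> in \<open>auto simp: power2_eq_square mult_left_le\<close>)
  also have "\<dots> = (1 / (2 * pi) ^ CARD('n) / (\<tau> - \<tau>\<^sup>2) ^ CARD('n) * (weighted_L2 a f * weighted_L2 a (fourier f)))\<^sup>2"
    by (simp add: power_mult_distrib power_divide power2_eq_square mult_ac)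
  finally show "(exp (a * (\<omega> (norm x) + \<omega> (norm \<xi>))) * ?W\<^sup>2)\<^sup>2
    \<le> (1 / (2 * pi) ^ CARD('n) / (\<tau> - \<tau>\<^sup>2) ^ CARD('n) * (weighted_L2 a f * weighted_L2 a (fourier f)))\<^sup>2" .
  show "0 \<le> 1 / (2 * pi) ^ CARD('n) / (\<tau> - \<tau>\<^sup>2) ^ CARD('n) * (weighted_L2 a f * weighted_L2 a (fourier f))"
    using \<tau> by (simp add: power2_eq_square mult_left_le weighted_L2_nonneg)
qed

lemma exp_w_Pair_le:
  assumes "0 \<le> m"
  shows "exp (m * \<omega> (norm (x, \<xi>))) \<le> exp (m * K) * exp (m * K * (\<omega> (norm x) + \<omega> (norm \<xi>)))"
proof -
  have "m * \<omega> (norm (x, \<xi>)) \<le> m * (K * (1 + \<omega> (norm x) + \<omega> (norm \<xi>)))"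
    using assms by (intro mult_left_mono w_norm_Pair)
  also have "\<dots> = m * K + m * K * (\<omega> (norm x) + \<omega> (norm \<xi>))"
    by (simp add: algebra_simps)
  finally show ?thesis by (simp flip: exp_add)
qed

lemma decays_Wig:
  fixes f :: "real ^ 'n \<Rightarrow> complex"
  assumes f: "f \<in> S_space \<omega>" and \<tau>: "0 < \<tau>" "\<tau> < 1"
  shows "decays (Wig \<tau> f)"
  unfolding decays_def
proof
  fix m0 :: real
  define m where "m = max m0 0"
  \<comment> \<open>The 2 compensates for the square in \<open>Wig_bound\<close>, the K for the
    passage from the pair to its components.\<close>
  define R where "R = 1 / (2 * pi) ^ CARD('n) / (\<tau> - \<tau>\<^sup>2) ^ CARD('n) * (weighted_L2 (2 * (m * K)) f * weighted_L2 (2 * (m * K)) (fourier f))"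
  have "exp (m0 * \<omega> (norm z)) * norm (Wig \<tau> f z) \<le> exp (m * K) * sqrt R" for z
  proof (cases z)
    case (Pair x \<xi>)
    have "0 \<le> m" by (simp add: m_def)
    have "exp (2 * (m * K) * (\<omega> (norm x) + \<omega> (norm \<xi>))) * (norm (Wig \<tau> f (x, \<xi>)))\<^sup>2 \<le> R"
      unfolding R_def using \<open>0 \<le> m\<close> K_ge_1 by (intro Wig_bound f \<tau>) auto
    moreover have "exp (2 * (m * K) * (\<omega> (norm x) + \<omega> (norm \<xi>))) = (exp (m * K * (\<omega> (norm x) + \<omega> (norm \<xi>))))\<^sup>2"
      by (simp add: power2_eq_square flip: exp_add)
    ultimately have "exp (m * K * (\<omega> (norm x) + \<omega> (norm \<xi>))) * norm (Wig \<tau> f (x, \<xi>)) \<le> sqrt R"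
      by (intro real_le_rsqrt) (simp add: power_mult_distrib)
    then have "exp (m * K) * (exp (m * K * (\<omega> (norm x) + \<omega> (norm \<xi>))) * norm (Wig \<tau> f (x, \<xi>))) \<le> exp (m * K) * sqrt R"
      by (rule mult_left_mono) simp
    moreover have "exp (m0 * \<omega> (norm z)) \<le> exp (m * \<omega> (norm z))"
      by (simp add: m_def mult_right_mono)
    then have "exp (m0 * \<omega> (norm z)) * norm (Wig \<tau> f z) \<le> (exp (m * K) * exp (m * K * (\<omega> (norm x) + \<omega> (norm \<xi>)))) * norm (Wig \<tau> f z)"
      using order_trans[OF _ exp_w_Pair_le[OF \<open>0 \<le> m\<close>, of x \<xi>]] Pair by (intro mult_right_mono) auto
    ultimately show ?thesis
      unfolding Pair mult.assoc by (rule order_trans[rotated])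
  qed
  then show "\<exists>C. \<forall>z. exp (m0 * \<omega> (norm z)) * norm (Wig \<tau> f z) \<le> C" by blast
qed

end

section \<open>The spectrogram as a convolution of Wigner transforms\<close>

text \<open>The substitution \<open>(u, v) = (y + \<tau>t, y - (1 - \<tau>)t)\<close> has Jacobian 1; it is carried out as a
  reflection in \<open>v\<close> followed by a translation in \<open>u\<close>.\<close>

lemma integral_shear:
  fixes \<phi> \<psi> :: "'a::euclidean_space \<Rightarrow> complex"
  assumes \<phi>: "integrable lborel \<phi>" and \<psi>: "integrable lborel \<psi>"
  shows
    "(\<integral>y. (\<integral>t. \<phi> (y + \<tau> *\<^sub>R t) * \<psi> (y - (1 - \<tau>) *\<^sub>R t) \<partial>lborel) \<partial>lborel) = (\<integral>y. \<phi> y \<partial>lborel) * (\<integral>y. \<psi> y \<partial>lborel)"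
proof -
  have [measurable]: "\<phi> \<in> borel_measurable borel" "\<psi> \<in> borel_measurable borel"
    using \<phi> \<psi> by (auto dest: borel_measurable_integrable)
  define F where "F u t = \<phi> u * \<psi> (u - t)" for u t
  have reflect: "integrable lborel (\<lambda>t. \<psi> (u - t))" "(\<integral>t. \<psi> (u - t) \<partial>lborel) = (\<integral>y. \<psi> y \<partial>lborel)"
    "(\<integral>t. norm (\<psi> (u - t)) \<partial>lborel) = (\<integral>y. norm (\<psi> y) \<partial>lborel)" for u
    using integrable_lborel_affine[OF \<psi>, of "-1" u] integral_lborel_affine[of \<psi> "-1" u]
      integral_lborel_affine[of "\<lambda>y. norm (\<psi> y)" "-1" u] by simp_all
  have F: "integrable (lborel \<Otimes>\<^sub>M lborel) (case_prod F)"
  proof (rule lborel_pair.Fubini_integrable)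
    show "case_prod F \<in> borel_measurable (lborel \<Otimes>\<^sub>M lborel)"
      unfolding F_def by measurable
    show "integrable lborel (\<lambda>u. \<integral>t. norm (case (u, t) of (u, t) \<Rightarrow> F u t) \<partial>lborel)"
      using \<phi> by (simp add: F_def norm_mult reflect)
    show "AE u in lborel. integrable lborel (\<lambda>t. case (u, t) of (u, t) \<Rightarrow> F u t)"
      using reflect(1) by (simp add: F_def)
  qed
  have shift: "(\<integral>y. G (y + \<tau> *\<^sub>R t) \<partial>lborel) = (\<integral>u. G u \<partial>lborel)" if "G \<in> borel_measurable borel"
    for G :: "'a \<Rightarrow> 'b::{banach, second_countable_topology}" and t
    using integral_lborel_affine[OF that, of 1 "\<tau> *\<^sub>R t"] by (simp add: add.commute)
  have eq: "\<phi> (y + \<tau> *\<^sub>R t) * \<psi> (y - (1 - \<tau>) *\<^sub>R t) = F (y + \<tau> *\<^sub>R t) t" for y t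
    by (simp add: F_def algebra_simps)
  \<comment> \<open>With t as the outer variable the shift by \<tau> t is a translation in y on each
    slice, so the Fubini criterion is inherited from \<open>F\<close>.\<close>
  have S: "integrable (lborel \<Otimes>\<^sub>M lborel) (\<lambda>(t, y). F (y + \<tau> *\<^sub>R t) t)"
  proof (rule lborel_pair.Fubini_integrable)
    show "(\<lambda>(t, y). F (y + \<tau> *\<^sub>R t) t) \<in> borel_measurable (lborel \<Otimes>\<^sub>M lborel)"
      unfolding F_def by measurable
    have "integrable (lborel \<Otimes>\<^sub>M lborel) (\<lambda>(u, t). norm (F u t))"
      using integrable_norm[OF F] by (simp add: case_prod_beta')
    then have "integrable lborel (\<lambda>t. \<integral>u. norm (F u t) \<partial>lborel)"
      by (rule lborel_pair.integrable_snd)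
    moreover have "(\<integral>y. norm (F (y + \<tau> *\<^sub>R t) t) \<partial>lborel) = (\<integral>u. norm (F u t) \<partial>lborel)" for t
      by (rule shift[of "\<lambda>u. norm (F u t)"]) (unfold F_def, measurable)
    ultimately show "integrable lborel (\<lambda>t. \<integral>y. norm (case (t, y) of (t, y) \<Rightarrow> F (y + \<tau> *\<^sub>R t) t) \<partial>lborel)"
      by simp
    have "AE t in lborel. integrable lborel (\<lambda>u. F u t)"
      using lborel_pair.AE_integrable_snd[OF F] by simp
    then show "AE t in lborel. integrable lborel (\<lambda>y. case (t, y) of (t, y) \<Rightarrow> F (y + \<tau> *\<^sub>R t) t)"
    proof eventually_elim
      fix t assume "integrable lborel (\<lambda>u. F u t)"
      from integrable_lborel_affine[OF this, of 1 "\<tau> *\<^sub>R t"]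
      show "integrable lborel (\<lambda>y. case (t, y) of (t, y) \<Rightarrow> F (y + \<tau> *\<^sub>R t) t)"
        by (simp add: add.commute)
    qed
  qed
  have "(\<integral>y. (\<integral>t. \<phi> (y + \<tau> *\<^sub>R t) * \<psi> (y - (1 - \<tau>) *\<^sub>R t) \<partial>lborel) \<partial>lborel) = (\<integral>t. (\<integral>y. F (y + \<tau> *\<^sub>R t) t \<partial>lborel) \<partial>lborel)"
    unfolding eq by (rule lborel_pair.Fubini_integral[OF S])
  also have "\<dots> = (\<integral>t. (\<integral>u. F u t \<partial>lborel) \<partial>lborel)"
    by (rule Bochner_Integration.integral_cong[OF refl], rule shift[of "\<lambda>u. F u _"], unfold F_def, measurable)
  also have "\<dots> = (\<integral>u. (\<integral>t. F u t \<partial>lborel) \<partial>lborel)"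
    by (rule lborel_pair.Fubini_integral[OF F])
  also have "\<dots> = (\<integral>y. \<phi> y \<partial>lborel) * (\<integral>y. \<psi> y \<partial>lborel)"
    by (simp add: F_def reflect)
  finally show ?thesis .
qed

lemma STFT_eq_fourier:
  "STFT g f (x, \<xi>) = fourier (\<lambda>y. f y * cnj (g (y - x))) \<xi>"
  by (simp add: STFT_def fourier_def mult_ac)

lemma borel_measurable_STFT [measurable]:
  assumes [measurable]: "f \<in> borel_measurable borel" "g \<in> borel_measurable borel"
  shows "STFT g f \<in> borel_measurable borel"
proof -
  have "(\<lambda>z. \<integral>y. exp (- (\<i> * of_real (y \<bullet> snd z))) * (f y * cnj (g (y - fst z))) \<partial>lborel)
      \<in> borel_measurable (borel \<Otimes>\<^sub>M borel)"
    by measurable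
  also have "(\<lambda>z. \<integral>y. exp (- (\<i> * of_real (y \<bullet> snd z))) * (f y * cnj (g (y - fst z))) \<partial>lborel) = STFT g f"
    by (auto simp: STFT_eq_fourier fourier_lborel)
  finally show ?thesis
    by (simp add: borel_prod)
qed

lemma integrable_bounded_mult:
  fixes F G :: "'a::euclidean_space \<Rightarrow> complex"
  assumes F: "integrable lborel F" and [measurable]: "G \<in> borel_measurable borel" and G: "\<And>x. norm (G x) \<le> C"
  shows "integrable lborel (\<lambda>x. F x * G x)"
proof (rule Bochner_Integration.integrable_bound)
  show "integrable lborel (\<lambda>x. C * norm (F x))"
    using F by simp
  have "norm (F x * G x) \<le> C * norm (F x)" for x
    using mult_left_mono[OF G[of x], of "norm (F x)"] by (simp add: norm_mult mult.commute)
  then show "AE x in lborel. norm (F x * G x) \<le> norm (C * norm (F x))"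
    by (intro AE_I2) (auto intro: order_trans[OF _ abs_ge_self])
  show "(\<lambda>x. F x * G x) \<in> borel_measurable lborel"
    using F by (auto dest: borel_measurable_integrable)
qed

context weight
begin

lemma borel_measurable_S_space: "f \<in> S_space \<omega> \<Longrightarrow> f \<in> borel_measurable borel"
  by (rule borel_measurable_continuous_onI[OF S_spaceD(1)])

lemma integrable_S_space: "f \<in> S_space \<omega> \<Longrightarrow> integrable lborel f"
  by (rule decays_integrable) (auto intro: borel_measurable_S_space S_spaceD)

text \<open>Integrability of every frequency slice, where Fubini's theorem would give it for almost
  every slice only; Fourier inversion is applied on individual slices.\<close>

lemma decays_Pair:
  assumes "decays F"
  shows "decays (\<lambda>y. F (x, y))"
  unfolding decays_def
proof
  fix m0 :: real
  define m where "m = max m0 0"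
  obtain C where C: "\<And>z. exp (m * \<omega> (norm z)) * norm (F z) \<le> C"
    using decaysE[OF assms] by metis
  have "exp (m0 * \<omega> (norm y)) * norm (F (x, y)) \<le> C" for y
  proof -
    have "m0 * \<omega> (norm y) \<le> m * \<omega> (norm y)"
      by (simp add: m_def mult_right_mono)
    also have "\<dots> \<le> m * \<omega> (norm (x, y))"
      by (intro mult_left_mono w_mono) (auto simp: m_def norm_snd_le)
    finally have "exp (m0 * \<omega> (norm y)) * norm (F (x, y)) \<le> exp (m * \<omega> (norm (x, y))) * norm (F (x, y))"
      by (intro mult_right_mono) auto
    also note C
    finally show ?thesis .
  qed
  then show "\<exists>C. \<forall>y. exp (m0 * \<omega> (norm y)) * norm (F (x, y)) \<le> C" by blast
qed

text \<open>The squared modulus is the product of the integral of \<phi> with that of its conjugate,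
  which \<open>integral_shear\<close> rewrites as a double integral over midpoints y and differences
  t. For fixed y the t-integral is the Fourier transform of the product of a Wigner kernel of f with
  a conjugated one of g, so \<open>fourier_mult\<close> yields a convolution in frequency; the
  y-integral supplies the one in time.\<close>

lemma spectrogram_le_convolution:
  fixes f g :: "real ^ 'n \<Rightarrow> complex"
  assumes f: "f \<in> S_space \<omega>" and g: "g \<in> S_space \<omega>" and \<tau>: "0 < \<tau>" "\<tau> < 1"
  shows "ennreal (spectrogram g f z)
    \<le> ennreal (1 / (2 * pi) ^ CARD('n)) * (\<integral>\<^sup>+w. ennreal (norm (Wig \<tau> f w)) * ennreal (norm (Wig \<tau> g (w - z))) \<partial>lborel)"
proof (cases z)
  case (Pair x \<xi>)
  let ?N = "CARD('n)"
  note [measurable] = borel_measurable_S_space[OF f] borel_measurable_S_space[OF g]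
  note g' = S_spaceD[OF g]
  obtain Cg where Cg: "\<And>x. norm (g x) \<le> Cg"
    using decays_bounded[OF g'(3)] by metis
  define \<phi> where "\<phi> y = f y * cnj (g (y - x)) * exp (- (\<i> * of_real (y \<bullet> \<xi>)))" for y
  have \<phi>: "integrable lborel \<phi>"
    unfolding \<phi>_def mult.assoc by (rule integrable_bounded_mult[OF integrable_S_space[OF f], where C=Cg])
      (use Cg in \<open>auto simp: norm_mult\<close>)
  have V: "STFT g f z = (\<integral>y. \<phi> y \<partial>lborel)"
    unfolding Pair STFT_def prod.case \<phi>_def by (rule integral_completion) measurable
  define H G where "H y t = f (y + \<tau> *\<^sub>R t) * cnj (f (y - (1 - \<tau>) *\<^sub>R t))"
    and "G y t = cnj (g ((y - x) + \<tau> *\<^sub>R t) * cnj (g ((y - x) - (1 - \<tau>) *\<^sub>R t)))" for y t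
  have [measurable]: "H y \<in> borel_measurable borel" "G y \<in> borel_measurable borel" for y
    unfolding H_def G_def by measurable
  have iprod: "integrable lborel (\<lambda>t. k (y + \<tau> *\<^sub>R t) * cnj (k (y - (1 - \<tau>) *\<^sub>R t)))" if k: "k \<in> S_space \<omega>" for k :: "real ^ 'n \<Rightarrow> complex" and y
  proof -
    note [measurable] = borel_measurable_S_space[OF k]
    obtain C where C: "\<And>x. norm (k x) \<le> C"
      using decays_bounded[OF S_spaceD(3)[OF k]] by metis
    show ?thesis
     by (rule integrable_bounded_mult[where C=C]) (use C \<tau> in \<open>auto intro!: integrable_lborel_affine integrable_S_space[OF k]\<close>)
  qed
  have WH: "fourier (H y) \<eta> = Wig \<tau> f (y, \<eta>)" for y \<eta>
    unfolding H_def by (simp add: Wig_eq_cross_Wig cross_Wig_def fourier_lborel)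
  have WG: "fourier (G y) \<eta> = cnj (Wig \<tau> g (y - x, - \<eta>))" for y \<eta>
    unfolding G_def fourier_cnj by (simp add: Wig_eq_cross_Wig cross_Wig_def fourier_lborel)
  have fm: "(\<integral>\<eta>. fourier (H y) \<eta> * fourier (G y) (\<xi> - \<eta>) \<partial>lborel) = of_real ((2 * pi) ^ ?N) * fourier (\<lambda>t. H y t * G y t) \<xi>" for y
  proof (rule fourier_mult)
    show "integrable lborel (H y)"
      unfolding H_def by (rule iprod[OF f])
    show "integrable lborel (G y)"
      unfolding G_def by (intro integrable_cnj iprod[OF g])
    show "continuous_on UNIV (G y)"
      unfolding G_def by (intro continuous_intros continuous_on_compose2[OF g'(1)]) auto
    show "norm (G y t) \<le> Cg * Cg" for t
      unfolding G_def complex_mod_cnj norm_mult by (intro mult_mono Cg norm_ge_zero order_trans[OF norm_ge_zero Cg])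
    have "integrable lborel (\<lambda>\<eta>. Wig \<tau> g (y - x, \<eta>))"
      by (intro decays_integrable decays_Pair decays_Wig g \<tau>) measurable
    from integrable_cnj[OF integrable_lborel_affine[OF this, of "-1" 0]]
    show "integrable lborel (fourier (G y))"
      unfolding WG by simp
  qed
  have inner: "(\<integral>t. \<phi> (y + \<tau> *\<^sub>R t) * cnj (\<phi> (y - (1 - \<tau>) *\<^sub>R t)) \<partial>lborel) = fourier (\<lambda>t. H y t * G y t) \<xi>" for y
  proof -
    have "\<phi> (y + \<tau> *\<^sub>R t) * cnj (\<phi> (y - (1 - \<tau>) *\<^sub>R t)) = exp (- (\<i> * of_real (t \<bullet> \<xi>))) * (H y t * G y t)" for t
    proof -
      \<comment> \<open>The two evaluation points differ by exactly t, so the y-dependence of the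
        exponentials cancels.\<close>
      let ?e = "\<lambda>v. exp (- (\<i> * of_real (v \<bullet> \<xi>)))"
      have e: "?e (y + \<tau> *\<^sub>R t) * cnj (?e (y - (1 - \<tau>) *\<^sub>R t)) = ?e t"
        by (simp add: exp_cnj inner_add_left inner_diff_left left_diff_distrib right_diff_distrib distrib_left flip: exp_add)
      have "\<phi> (y + \<tau> *\<^sub>R t) * cnj (\<phi> (y - (1 - \<tau>) *\<^sub>R t)) = (?e (y + \<tau> *\<^sub>R t) * cnj (?e (y - (1 - \<tau>) *\<^sub>R t)))
         * (f (y + \<tau> *\<^sub>R t) * cnj (g (y + \<tau> *\<^sub>R t - x)) * (cnj (f (y - (1 - \<tau>) *\<^sub>R t)) * g (y - (1 - \<tau>) *\<^sub>R t - x)))"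
        unfolding \<phi>_def complex_cnj_mult complex_cnj_cnj by (simp only: mult_ac)
      moreover have shift: "y - x + \<tau> *\<^sub>R t = y + \<tau> *\<^sub>R t - x" "y - x - (1 - \<tau>) *\<^sub>R t = y - (1 - \<tau>) *\<^sub>R t - x"
        by (simp_all add: algebra_simps)
      ultimately show ?thesis
        unfolding e H_def G_def shift by (simp add: mult_ac)
    qed
    then show ?thesis by (simp add: fourier_lborel)
  qed
  have key: "ennreal (norm (fourier (\<lambda>t. H y t * G y t) \<xi>))
     \<le> ennreal (1 / (2 * pi) ^ ?N) * (\<integral>\<^sup>+\<eta>. ennreal (norm (Wig \<tau> f (y, \<eta>))) * ennreal (norm (Wig \<tau> g ((y, \<eta>) - z))) \<partial>lborel)" for y
  proof -
    have "fourier (\<lambda>t. H y t * G y t) \<xi> = of_real (1 / (2 * pi) ^ ?N) * (\<integral>\<eta>. fourier (H y) \<eta> * fourier (G y) (\<xi> - \<eta>) \<partial>lborel)"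
      unfolding fm by simp
    then have "ennreal (norm (fourier (\<lambda>t. H y t * G y t) \<xi>)) = ennreal (1 / (2 * pi) ^ ?N) * ennreal (norm (\<integral>\<eta>. fourier (H y) \<eta> * fourier (G y) (\<xi> - \<eta>) \<partial>lborel))"
      by (simp only: norm_mult norm_of_real abs_of_nonneg[of "1 / (2 * pi) ^ ?N"] zero_le_divide_1_iff zero_le_power pi_ge_zero
          mult_nonneg_nonneg zero_le_numeral) (rule ennreal_mult, auto)
    also have "\<dots> \<le> ennreal (1 / (2 * pi) ^ ?N) * (\<integral>\<^sup>+\<eta>. ennreal (norm (fourier (H y) \<eta> * fourier (G y) (\<xi> - \<eta>))) \<partial>lborel)"
      by (intro mult_left_mono ennreal_norm_integral_le) simp
    finally show ?thesis
      by (simp add: WH WG Pair norm_mult ennreal_mult)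
  qed
  have "ennreal (spectrogram g f z) = ennreal (norm ((\<integral>y. \<phi> y \<partial>lborel) * (\<integral>y. cnj (\<phi> y) \<partial>lborel)))"
    unfolding Bochner_Integration.integral_cnj by (simp add: spectrogram_def V norm_mult power2_eq_square)
  also have "\<dots> = ennreal (norm (\<integral>y. fourier (\<lambda>t. H y t * G y t) \<xi> \<partial>lborel))"
    unfolding integral_shear[OF \<phi> integrable_cnj[OF \<phi>], of \<tau>, symmetric] inner ..
  also have "\<dots> \<le> (\<integral>\<^sup>+y. ennreal (norm (fourier (\<lambda>t. H y t * G y t) \<xi>)) \<partial>lborel)"
    by (rule ennreal_norm_integral_le)
  also have "\<dots> \<le> (\<integral>\<^sup>+y. ennreal (1 / (2 * pi) ^ ?N) * (\<integral>\<^sup>+\<eta>. ennreal (norm (Wig \<tau> f (y, \<eta>))) * ennreal (norm (Wig \<tau> g ((y, \<eta>) - z))) \<partial>lborel) \<partial>lborel)"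
    by (intro nn_integral_mono key)
  also have "\<dots> = ennreal (1 / (2 * pi) ^ ?N) * (\<integral>\<^sup>+y. (\<integral>\<^sup>+\<eta>. ennreal (norm (Wig \<tau> f (y, \<eta>))) * ennreal (norm (Wig \<tau> g ((y, \<eta>) - z))) \<partial>lborel) \<partial>lborel)"
    by (rule nn_integral_cmult) measurable
  also have "(\<integral>\<^sup>+y. (\<integral>\<^sup>+\<eta>. ennreal (norm (Wig \<tau> f (y, \<eta>))) * ennreal (norm (Wig \<tau> g ((y, \<eta>) - z))) \<partial>lborel) \<partial>lborel)
     = (\<integral>\<^sup>+w. ennreal (norm (Wig \<tau> f w)) * ennreal (norm (Wig \<tau> g (w - z))) \<partial>(lborel \<Otimes>\<^sub>M lborel))"
    by (rule lborel.nn_integral_fst) (simp add: lborel_prod)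
  finally show ?thesis
    by (simp add: lborel_prod)
qed

lemma borel_measurable_weighted [measurable]:
  fixes F :: "'a::euclidean_space \<Rightarrow> 'b::{real_normed_vector, second_countable_topology}"
  assumes [measurable]: "F \<in> borel_measurable borel"
  shows "weighted \<omega> m F \<in> borel_measurable borel"
  unfolding weighted_def by measurable

lemma norm_weighted: "norm (weighted \<omega> m F z) = exp (m * \<omega> (norm z)) * norm (F z)"
  by (simp add: weighted_def)

lemma norm_Wig_reflect:
  assumes [measurable]: "g \<in> borel_measurable borel"
  shows "norm (Wig (1 - \<tau>) (\<lambda>t. g (- t)) z) = norm (Wig \<tau> g (- z))"
proof -
  have "(\<lambda>t. g (- t)) \<in> borel_measurable borel" by measurable
  then show ?thesis
    using norm_cross_Wig_swap[of \<tau> g z] by (simp add: Wig_eq_cross_Wig)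
qed

theorem spectrogram_bound:
  fixes f g :: "real ^ 'n \<Rightarrow> complex"
  assumes f: "f \<in> S_space \<omega>" and g: "g \<in> S_space \<omega>" and \<tau>: "0 < \<tau>" "\<tau> < 1" and "0 \<le> m" "1 \<le> p"
  shows "ennreal (exp (m * \<omega> (norm z)) * \<bar>spectrogram g f z\<bar>) \<le> D5 \<omega> K \<tau> p m g * Lp_norm p (weighted \<omega> (K * m) (Wig \<tau> f))"
proof -
  note [measurable] = borel_measurable_S_space[OF f] borel_measurable_S_space[OF g]
  let ?u = "weighted \<omega> (K * m) (Wig \<tau> f)" and ?v = "weighted \<omega> (K * m) (Wig (1 - \<tau>) (\<lambda>t. g (- t)))"
  have [measurable]: "?u \<in> borel_measurable borel" "?v \<in> borel_measurable borel"
    by measurable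
  have pw: "ennreal (exp (m * \<omega> (norm z))) * (ennreal (norm (Wig \<tau> f w)) * ennreal (norm (Wig \<tau> g (w - z))))
     \<le> ennreal (exp (K * m)) * (ennreal (norm (?u w)) * ennreal (norm (?v (z - w))))" for w
  proof -
    have "m * \<omega> (norm z) \<le> m * (K * (1 + \<omega> (norm w) + \<omega> (norm (z - w))))"
      using w_norm_add[of w "z - w"] \<open>0 \<le> m\<close> by (intro mult_left_mono) simp_all
    also have "\<dots> = K * m + (K * m * \<omega> (norm w) + K * m * \<omega> (norm (z - w)))"
      by (simp add: algebra_simps)
    finally have "exp (m * \<omega> (norm z)) \<le> exp (K * m) * (exp (K * m * \<omega> (norm w)) * exp (K * m * \<omega> (norm (z - w))))"
      by (simp flip: exp_add)
    then have "exp (m * \<omega> (norm z)) * (norm (Wig \<tau> f w) * norm (Wig \<tau> g (w - z)))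
       \<le> (exp (K * m) * (exp (K * m * \<omega> (norm w)) * exp (K * m * \<omega> (norm (z - w))))) * (norm (Wig \<tau> f w) * norm (Wig \<tau> g (w - z)))"
      by (rule mult_right_mono) simp
    also have "\<dots> = exp (K * m) * (norm (?u w) * norm (?v (z - w)))"
      unfolding norm_weighted by (simp add: norm_Wig_reflect mult_ac)
    finally show ?thesis
      by (simp flip: ennreal_mult add: ennreal_leI)
  qed
  have "ennreal (exp (m * \<omega> (norm z)) * \<bar>spectrogram g f z\<bar>) = ennreal (exp (m * \<omega> (norm z))) * ennreal (spectrogram g f z)"
    by (simp add: spectrogram_def ennreal_mult)
  also have "\<dots> \<le> ennreal (exp (m * \<omega> (norm z))) * (ennreal (1 / (2 * pi) ^ CARD('n)) * (\<integral>\<^sup>+w. ennreal (norm (Wig \<tau> f w)) * ennreal (norm (Wig \<tau> g (w - z))) \<partial>lborel))"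
    by (intro mult_left_mono spectrogram_le_convolution f g \<tau>) simp
  \<comment> \<open>\<open>D5\<close> carries no power of 2 pi; the factor is at most 1 and is given
    away.\<close>
  also have "\<dots> \<le> ennreal (exp (m * \<omega> (norm z))) * (1 * (\<integral>\<^sup>+w. ennreal (norm (Wig \<tau> f w)) * ennreal (norm (Wig \<tau> g (w - z))) \<partial>lborel))"
  proof (intro mult_left_mono mult_right_mono)
    have "1 \<le> (2 * pi) ^ CARD('n)"
      using pi_gt3 by (intro one_le_power) simp
    then show "ennreal (1 / (2 * pi) ^ CARD('n)) \<le> 1"
      by simp
  qed auto
  also have "\<dots> = (\<integral>\<^sup>+w. ennreal (exp (m * \<omega> (norm z))) * (ennreal (norm (Wig \<tau> f w)) * ennreal (norm (Wig \<tau> g (w - z)))) \<partial>lborel)"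
    by (simp add: nn_integral_cmult)
  also have "\<dots> \<le> (\<integral>\<^sup>+w. ennreal (exp (K * m)) * (ennreal (norm (?u w)) * ennreal (norm (?v (z - w)))) \<partial>lborel)"
    by (intro nn_integral_mono pw)
  also have "\<dots> = ennreal (exp (K * m)) * (\<integral>\<^sup>+w. ennreal (norm (?u w)) * ennreal (norm (?v (z - w))) \<partial>lborel)"
    by (rule nn_integral_cmult) measurable
  also have "\<dots> \<le> ennreal (exp (K * m)) * (Lp_norm p ?u * Lp_norm (conj_exponent p) (\<lambda>w. ?v (z - w)))"
    by (intro mult_left_mono Lp_norm_Holder \<open>1 \<le> p\<close>) (auto intro: measurable_compose[of "\<lambda>w. z - w" borel borel ?v])
  also have "\<dots> \<le> ennreal (exp (K * m)) * (Lp_norm p ?u * Lp_norm (conj_exponent p) ?v)"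
    by (intro mult_left_mono Lp_norm_reflect_le conj_exponent_ge_1 \<open>1 \<le> p\<close>) auto
  finally show ?thesis
    by (simp add: D5_def mult_ac)
qed

section \<open>Decay, inversion and non-vanishing of the short-time Fourier transform\<close>

text \<open>The bound on the spectrogram with p = 1 pairs an L1 norm of the Wigner transform of f
  with a supremum for g, and both are finite by \<open>decays_Wig\<close>. Any \<tau> strictly
  between 0 and 1 would serve; 1/2 is chosen. The doubled exponent accounts for the square in the
  spectrogram.\<close>

lemma decays_STFT:
  fixes f g :: "real ^ 'n \<Rightarrow> complex"
  assumes f: "f \<in> S_space \<omega>" and g: "g \<in> S_space \<omega>"
  shows "decays (STFT g f)"
  unfolding decays_def
proof
  fix m0 :: real
  define m where "m = max (2 * m0) 0"
  note [measurable] = borel_measurable_S_space[OF f] borel_measurable_S_space[OF g]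
  have half: "(0::real) < 1 / 2" "(1 / 2 :: real) < 1" by simp_all
  let ?R = "D5 \<omega> K (1 / 2) 1 m g * Lp_norm 1 (weighted \<omega> (K * m) (Wig (1 / 2) f))"
  obtain C where C: "0 \<le> C" "\<And>z. exp ((K * m) * \<omega> (norm z)) * norm (Wig (1 / 2) g z) \<le> C"
    using decaysE[OF decays_Wig[OF g half]] by metis
  have "norm (weighted \<omega> (K * m) (Wig (1 - 1 / 2) (\<lambda>t. g (- t))) z) \<le> C" for z
    using C(2)[of "- z"] by (simp only: norm_weighted norm_Wig_reflect[OF borel_measurable_S_space[OF g]]) simp
  then have "esssup lebesgue (\<lambda>z. ennreal (norm (weighted \<omega> (K * m) (Wig (1 - 1 / 2) (\<lambda>t. g (- t))) z))) \<le> ennreal C"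
    by (intro esssup_I) (auto intro!: measurable_completion ennreal_leI)
  then have 1: "D5 \<omega> K (1 / 2) 1 m g < \<infinity>"
    by (auto simp: D5_def conj_exponent_eq Lp_norm_def ennreal_mult_less_top intro: order.strict_trans1)
  have "integrable lborel (\<lambda>z. exp ((K * m) * \<omega> (norm z)) * norm (Wig (1 / 2) f z))"
    by (intro decays_integrable_weight decays_Wig f half) measurable
  then have 2: "Lp_norm 1 (weighted \<omega> (K * m) (Wig (1 / 2) f)) < \<infinity>"
    by (simp add: Lp_norm_one norm_weighted integrable_iff_bounded)
  from 1 2 have fin: "?R < \<infinity>"
    by (simp add: ennreal_mult_less_top)
  have "exp (m0 * \<omega> (norm z)) * norm (STFT g f z) \<le> sqrt (enn2real ?R)" for z
  proof (rule real_le_rsqrt)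
    have "(exp (m0 * \<omega> (norm z)) * norm (STFT g f z))\<^sup>2 = exp ((2 * m0) * \<omega> (norm z)) * spectrogram g f z"
      by (simp add: spectrogram_def power_mult_distrib mult.assoc exp_double)
    also have "\<dots> \<le> exp (m * \<omega> (norm z)) * \<bar>spectrogram g f z\<bar>"
      by (intro mult_mono) (auto simp: m_def mult_right_mono spectrogram_def)
    also have "\<dots> = enn2real (ennreal (exp (m * \<omega> (norm z)) * \<bar>spectrogram g f z\<bar>))"
      by simp
    also have "\<dots> \<le> enn2real ?R"
      using fin by (intro enn2real_mono spectrogram_bound f g half) (auto simp: m_def)
    finally show "(exp (m0 * \<omega> (norm z)) * norm (STFT g f z))\<^sup>2 \<le> enn2real ?R" .
  qed
  then show "\<exists>C. \<forall>z. exp (m0 * \<omega> (norm z)) * norm (STFT g f z) \<le> C" by blast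
qed

text \<open>At fixed x the STFT is the Fourier transform of f times the conjugated translated
  window, and decay makes it integrable in \<xi>, so Fourier inversion recovers this product at
  every y.\<close>

lemma integral_STFT_exp:
  fixes f g :: "real ^ 'n \<Rightarrow> complex"
  assumes f: "f \<in> S_space \<omega>" and g: "g \<in> S_space \<omega>"
  shows "(\<integral>\<xi>. exp (\<i> * of_real (y \<bullet> \<xi>)) * STFT g f (x, \<xi>) \<partial>lborel) = of_real ((2 * pi) ^ CARD('n)) * (f y * cnj (g (y - x)))"
proof -
  note [measurable] = borel_measurable_S_space[OF f] borel_measurable_S_space[OF g]
  obtain Cf where Cf: "\<And>x. norm (f x) \<le> Cf"
    using decays_bounded[OF S_spaceD(3)[OF f]] by metis
  obtain Cg where Cg: "\<And>x. norm (g x) \<le> Cg"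
    using decays_bounded[OF S_spaceD(3)[OF g]] by metis
  show ?thesis
    unfolding STFT_eq_fourier
  proof (rule fourier_inversion)
    show "continuous_on UNIV (\<lambda>y. f y * cnj (g (y - x)))"
      by (intro continuous_intros S_spaceD(1)[OF f] continuous_on_compose2[OF S_spaceD(1)[OF g]]) auto
    show "norm (f y * cnj (g (y - x))) \<le> Cf * Cg" for y
      unfolding complex_mod_cnj norm_mult by (intro mult_mono Cf Cg norm_ge_zero order_trans[OF norm_ge_zero Cf])
    show "integrable lborel (\<lambda>y. f y * cnj (g (y - x)))"
     by (rule integrable_bounded_mult[OF integrable_S_space[OF f], where C=Cg]) (use Cg in auto)
    have "integrable lborel (\<lambda>\<xi>. STFT g f (x, \<xi>))"
      by (intro decays_integrable decays_Pair decays_STFT f g) measurable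
    then show "integrable lborel (fourier (\<lambda>y. f y * cnj (g (y - x))))"
      unfolding STFT_eq_fourier .
  qed
qed

lemma STFT_nonzero:
  fixes f g :: "real ^ 'n \<Rightarrow> complex"
  assumes f: "f \<in> S_space \<omega>" and g: "g \<in> S_space \<omega>" and nz: "f \<noteq> (\<lambda>_. 0)" "g \<noteq> (\<lambda>_. 0)"
  obtains z where "STFT g f z \<noteq> 0"
proof (rule ccontr)
  assume "\<not> thesis"
  then have z: "STFT g f z = 0" for z using that by blast
  obtain y u where "f y \<noteq> 0" "g u \<noteq> 0" using nz by (auto simp: fun_eq_iff)
  then show False
    \<comment> \<open>At x = y - u the recovered product is f(y) times the conjugate of g(u), which
      is nonzero.\<close>
    using integral_STFT_exp[OF f g, of y "y - u"] by (simp add: z)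
qed

end

section \<open>Bounding the Wigner transform by the short-time Fourier transform\<close>

lemma ennreal_power2_le_imp_le:
  fixes x y :: ennreal
  assumes "x\<^sup>2 \<le> y\<^sup>2"
  shows "x \<le> y"
proof (rule ccontr)
  assume "\<not> x \<le> y"
  then have "y < x" by simp
  then obtain c where c: "y = ennreal c" "0 \<le> c"
    by (cases y) auto
  have "y\<^sup>2 < x\<^sup>2"
  proof (cases x)
    case (real a)
    with \<open>y < x\<close> c have "c < a" by (simp add: ennreal_less_iff)
    then show ?thesis
      using c real by (simp add: ennreal_power ennreal_less_iff power_strict_mono)
  qed (use c in \<open>simp add: power2_eq_square ennreal_mult_less_top\<close>)
  with assms show False by simp
qed

lemma Lp_norm_two_square:
  "(Lp_norm 2 F)\<^sup>2 = (\<integral>\<^sup>+z. (ennreal (norm (F z)))\<^sup>2 \<partial>lborel)"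
proof -
  have "Lp_norm 2 F = Lp_norm (ennreal 2) F" by simp
  also have "\<dots> = (if (\<integral>\<^sup>+z. (ennreal (norm (F z)))\<^sup>2 \<partial>lborel) = \<infinity> then \<infinity>
     else ennreal (sqrt (enn2real (\<integral>\<^sup>+z. (ennreal (norm (F z)))\<^sup>2 \<partial>lborel))))"
    by (subst Lp_norm_finite_exponent) (simp_all add: ennreal_power powr_half_sqrt)
  finally show ?thesis
    by (auto simp: ennreal_power less_top)
qed

lemma borel_measurable_fst [measurable (raw)]:
  fixes F :: "'c \<Rightarrow> 'a::second_countable_topology \<times> 'b::second_countable_topology"
  assumes "F \<in> borel_measurable M"
  shows "(\<lambda>x. fst (F x)) \<in> borel_measurable M"
  by (rule borel_measurable_continuous_on[OF _ assms]) (intro continuous_intros)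

lemma borel_measurable_snd [measurable (raw)]:
  fixes F :: "'c \<Rightarrow> 'a::second_countable_topology \<times> 'b::second_countable_topology"
  assumes "F \<in> borel_measurable M"
  shows "(\<lambda>x. snd (F x)) \<in> borel_measurable M"
  by (rule borel_measurable_continuous_on[OF _ assms]) (intro continuous_intros)

section \<open>Wigner transforms of time-frequency shifts\<close>

text \<open>Translation followed by modulation; \<open>STFT g f z\<close> is the L2 inner product of
  f with this function.\<close>

definition tf_shift :: "(real ^ 'n) \<times> (real ^ 'n) \<Rightarrow> (real ^ 'n \<Rightarrow> complex) \<Rightarrow> real ^ 'n \<Rightarrow> complex" where
  "tf_shift z g y = exp (\<i> * of_real (y \<bullet> snd z)) * g (y - fst z)"

lemma borel_measurable_tf_shift [measurable (raw)]:
  assumes [measurable]: "g \<in> borel_measurable borel" "Z \<in> borel_measurable M" "Y \<in> borel_measurable M"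
  shows "(\<lambda>x. tf_shift (Z x) g (Y x)) \<in> borel_measurable M"
  unfolding tf_shift_def by measurable

lemma norm_tf_shift: "norm (tf_shift z g y) = norm (g (y - fst z))"
  by (simp add: tf_shift_def norm_mult)

text \<open>The substitution t to -t exchanges the slots together with \<tau> and 1 - \<tau>. An
  expansion proved for the first slot can thereby be applied to the second.\<close>

lemma norm_cross_Wig_commute: "norm (cross_Wig \<tau> h k z) = norm (cross_Wig (1 - \<tau>) k h z)"
  if [measurable]: "h \<in> borel_measurable borel" "k \<in> borel_measurable borel"
proof (cases z)
  case (Pair x \<xi>)
  let ?F = "\<lambda>t. exp (- (\<i> * of_real (t \<bullet> \<xi>))) * (h (x + \<tau> *\<^sub>R t) * cnj (k (x - (1 - \<tau>) *\<^sub>R t)))"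
  have "cross_Wig \<tau> h k z = (\<integral>t. ?F (0 + (-1) *\<^sub>R t) \<partial>lborel)"
    unfolding Pair cross_Wig_def prod.case by (subst integral_lborel_affine[where F="?F"]) auto
  also have "\<dots> = (\<integral>t. cnj (exp (- (\<i> * of_real (t \<bullet> \<xi>))) * (k (x + (1 - \<tau>) *\<^sub>R t) * cnj (h (x - (1 - (1 - \<tau>)) *\<^sub>R t)))) \<partial>lborel)"
    by (rule Bochner_Integration.integral_cong[OF refl]) (simp add: exp_cnj mult_ac)
  also have "\<dots> = cnj (cross_Wig (1 - \<tau>) k h z)"
    unfolding Pair cross_Wig_def prod.case by (rule Bochner_Integration.integral_cnj)
  finally show ?thesis by simp
qed

text \<open>The point by which the Wigner transform of two shifted windows is translated. The
  weights are crossed: z enters with 1 - \<tau> in position but with \<tau> in frequency.\<close>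

definition Wig_center :: "real \<Rightarrow> 'a \<times> 'b \<Rightarrow> 'a \<times> 'b \<Rightarrow> 'a::real_vector \<times> 'b::real_vector" where
  "Wig_center \<tau> z w = ((1 - \<tau>) *\<^sub>R fst z + \<tau> *\<^sub>R fst w, \<tau> *\<^sub>R snd z + (1 - \<tau>) *\<^sub>R snd w)"

lemma exp_ii_diff: "exp (\<i> * of_real (a - b)) = exp (\<i> * of_real a) * exp (- (\<i> * of_real b))"
  by (simp add: right_diff_distrib flip: exp_add)

lemma norm_cross_Wig_tf_shift:
  assumes [measurable]: "g \<in> borel_measurable borel"
  shows "norm (cross_Wig \<tau> (tf_shift z g) (tf_shift w g) u) = norm (cross_Wig \<tau> g g (u - Wig_center \<tau> z w))"
proof (cases u)
  case (Pair x \<xi>)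
  \<comment> \<open>With s = t + \<delta> both arguments of g take the form required by a Wigner
    transform centred at x'. The phases independent of s are collected in \<open>c\<close>, which
    has modulus 1.\<close>
  define \<delta> where "\<delta> = fst w - fst z"
  define x' where "x' = x - ((1 - \<tau>) *\<^sub>R fst z + \<tau> *\<^sub>R fst w)"
  define \<xi>' where "\<xi>' = \<xi> - (\<tau> *\<^sub>R snd z + (1 - \<tau>) *\<^sub>R snd w)"
  define F where "F s = exp (- (\<i> * of_real (s \<bullet> \<xi>'))) * (g (x' + \<tau> *\<^sub>R s) * cnj (g (x' - (1 - \<tau>) *\<^sub>R s)))" for s
  have [measurable]: "F \<in> borel_measurable borel"
    unfolding F_def by measurable
  define c where "c = exp (\<i> * of_real (x \<bullet> (snd z - snd w) + \<delta> \<bullet> \<xi>'))"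
  have "exp (- (\<i> * of_real (t \<bullet> \<xi>))) * (tf_shift z g (x + \<tau> *\<^sub>R t) * cnj (tf_shift w g (x - (1 - \<tau>) *\<^sub>R t))) = c * F (\<delta> + 1 *\<^sub>R t)" for t
  proof -
    have a: "x' + \<tau> *\<^sub>R (\<delta> + 1 *\<^sub>R t) = x + \<tau> *\<^sub>R t - fst z" "x' - (1 - \<tau>) *\<^sub>R (\<delta> + 1 *\<^sub>R t) = x - (1 - \<tau>) *\<^sub>R t - fst w"
      by (simp_all add: x'_def \<delta>_def algebra_simps)
    have r: "- (t \<bullet> \<xi>) + (x + \<tau> *\<^sub>R t) \<bullet> snd z - (x - (1 - \<tau>) *\<^sub>R t) \<bullet> snd w
      = (x \<bullet> (snd z - snd w) + \<delta> \<bullet> \<xi>') - (\<delta> + 1 *\<^sub>R t) \<bullet> \<xi>'"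
      by (simp add: \<xi>'_def inner_simps algebra_simps)
    have "exp (- (\<i> * of_real (t \<bullet> \<xi>))) * (exp (\<i> * of_real ((x + \<tau> *\<^sub>R t) \<bullet> snd z)) * cnj (exp (\<i> * of_real ((x - (1 - \<tau>) *\<^sub>R t) \<bullet> snd w))))
      = exp (\<i> * of_real (- (t \<bullet> \<xi>) + (x + \<tau> *\<^sub>R t) \<bullet> snd z - (x - (1 - \<tau>) *\<^sub>R t) \<bullet> snd w))"
      by (simp only: exp_cnj complex_cnj_mult complex_cnj_i complex_cnj_complex_of_real exp_add[symmetric] of_real_add of_real_diff of_real_minus)
        (simp add: algebra_simps)
    also have "\<dots> = c * exp (- (\<i> * of_real ((\<delta> + 1 *\<^sub>R t) \<bullet> \<xi>')))"
      unfolding r c_def by (rule exp_ii_diff)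
    finally have "(exp (- (\<i> * of_real (t \<bullet> \<xi>))) * (exp (\<i> * of_real ((x + \<tau> *\<^sub>R t) \<bullet> snd z)) * cnj (exp (\<i> * of_real ((x - (1 - \<tau>) *\<^sub>R t) \<bullet> snd w)))))
       * (g (x + \<tau> *\<^sub>R t - fst z) * cnj (g (x - (1 - \<tau>) *\<^sub>R t - fst w)))
      = c * exp (- (\<i> * of_real ((\<delta> + 1 *\<^sub>R t) \<bullet> \<xi>'))) * (g (x + \<tau> *\<^sub>R t - fst z) * cnj (g (x - (1 - \<tau>) *\<^sub>R t - fst w)))"
      by (rule arg_cong)
    then show ?thesis
      unfolding F_def a tf_shift_def complex_cnj_mult by (simp only: mult_ac)
  qed
  then have "cross_Wig \<tau> (tf_shift z g) (tf_shift w g) u = (\<integral>t. c * F (\<delta> + 1 *\<^sub>R t) \<partial>lborel)"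
    unfolding Pair cross_Wig_def prod.case by simp
  also have "\<dots> = c * (\<integral>t. F (\<delta> + 1 *\<^sub>R t) \<partial>lborel)"
    by (rule integral_mult_right_zero)
  also have "(\<integral>t. F (\<delta> + 1 *\<^sub>R t) \<partial>lborel) = (\<integral>s. F s \<partial>lborel)"
    by (subst integral_lborel_affine) auto
  also have "\<dots> = cross_Wig \<tau> g g (u - Wig_center \<tau> z w)"
    by (simp add: Pair Wig_center_def cross_Wig_def F_def x'_def \<xi>'_def)
  finally show ?thesis
    by (simp only: norm_mult c_def norm_exp_ii mult_1)
qed

text \<open>Each component is a convex combination, hence bounded by the maximum; adding the two
  components gives the factor 2, which is just what \<open>w_double\<close> handles at the price of
  one K.\<close>

lemma norm_Wig_center_le:
  fixes z w :: "'a::real_inner \<times> 'b::real_inner"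
  assumes "0 < \<tau>" "\<tau> < 1"
  shows "norm (Wig_center \<tau> z w) \<le> 2 * max (norm z) (norm w)"
proof -
  let ?M = "max (norm z) (norm w)"
  have z: "norm (fst z) \<le> ?M" "norm (snd z) \<le> ?M" "norm (fst w) \<le> ?M" "norm (snd w) \<le> ?M"
    using norm_fst_le[of "fst z" "snd z"] norm_snd_le[of "snd z" "fst z"]
      norm_fst_le[of "fst w" "snd w"] norm_snd_le[of "snd w" "fst w"] by auto
  have "norm ((1 - \<tau>) *\<^sub>R fst z + \<tau> *\<^sub>R fst w) \<le> (1 - \<tau>) * norm (fst z) + \<tau> * norm (fst w)"
    using norm_triangle_ineq[of "(1 - \<tau>) *\<^sub>R fst z" "\<tau> *\<^sub>R fst w"] assms by simp
  also have "\<dots> \<le> ?M"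
    by (rule convex_bound_le) (use assms z in auto)
  finally have 1: "norm ((1 - \<tau>) *\<^sub>R fst z + \<tau> *\<^sub>R fst w) \<le> ?M" .
  have "norm (\<tau> *\<^sub>R snd z + (1 - \<tau>) *\<^sub>R snd w) \<le> \<tau> * norm (snd z) + (1 - \<tau>) * norm (snd w)"
    using norm_triangle_ineq[of "\<tau> *\<^sub>R snd z" "(1 - \<tau>) *\<^sub>R snd w"] assms by simp
  also have "\<dots> \<le> ?M"
    by (rule convex_bound_le) (use assms z in auto)
  finally have 2: "norm (\<tau> *\<^sub>R snd z + (1 - \<tau>) *\<^sub>R snd w) \<le> ?M" .
  show ?thesis
    unfolding Wig_center_def using norm_Pair_le 1 2 by (smt (verit))
qed

section \<open>The weighted supremum of the Wigner transform of the window\<close>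

context weight
begin

text \<open>The exponent s is shared out: e^(s \<omega>) goes with F into the supremum norm, and
  e^(-c \<omega>) stays behind to make the integral converge.\<close>

lemma weighted_L2_le:
  fixes F :: "'a::euclidean_space \<Rightarrow> complex"
  assumes F: "continuous_on UNIV F" "decays F" and "a + c \<le> s"
  shows "ennreal (weighted_L2 a F) \<le> (Lp_norm \<infinity> (weighted \<omega> s F))\<^sup>2 * (\<integral>\<^sup>+y. (ennreal (exp (- c * \<omega> (norm (y::'a)))))\<^sup>2 \<partial>lborel)"
proof -
  have [measurable]: "F \<in> borel_measurable borel"
    by (rule borel_measurable_continuous_onI[OF F(1)])
  have "ennreal (weighted_L2 a F) = (\<integral>\<^sup>+y. (ennreal (exp (a * \<omega> (norm y)) * norm (F y)))\<^sup>2 \<partial>lborel)"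
    by (simp add: nn_integral_weighted_L2 F)
  also have "\<dots> \<le> (\<integral>\<^sup>+y. (Lp_norm \<infinity> (weighted \<omega> s F))\<^sup>2 * (ennreal (exp (- c * \<omega> (norm (y::'a)))))\<^sup>2 \<partial>lborel)"
  proof (rule nn_integral_mono)
    fix y :: 'a
    have "a * \<omega> (norm y) \<le> (s - c) * \<omega> (norm y)"
      using assms(3) by (intro mult_right_mono) auto
    then have "exp (a * \<omega> (norm y)) \<le> exp (s * \<omega> (norm y)) * exp (- c * \<omega> (norm y))"
      by (simp add: left_diff_distrib flip: exp_add)
    then have "exp (a * \<omega> (norm y)) * norm (F y) \<le> exp (s * \<omega> (norm y)) * exp (- c * \<omega> (norm y)) * norm (F y)"
      by (rule mult_right_mono) simp
    also have "\<dots> = norm (weighted \<omega> s F y) * exp (- c * \<omega> (norm y))"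
      by (simp only: norm_weighted mult_ac)
    finally have "ennreal (exp (a * \<omega> (norm y)) * norm (F y)) \<le> ennreal (norm (weighted \<omega> s F y)) * ennreal (exp (- c * \<omega> (norm y)))"
      by (simp add: ennreal_leI flip: ennreal_mult)
    also have "\<dots> \<le> Lp_norm \<infinity> (weighted \<omega> s F) * ennreal (exp (- c * \<omega> (norm y)))"
    proof (intro mult_right_mono continuous_le_Lp_norm_infinity)
      show "continuous_on UNIV (weighted \<omega> s F)"
        unfolding weighted_def by (intro continuous_intros F)
    qed simp
    finally show "(ennreal (exp (a * \<omega> (norm y)) * norm (F y)))\<^sup>2 \<le> (Lp_norm \<infinity> (weighted \<omega> s F))\<^sup>2 * (ennreal (exp (- c * \<omega> (norm y))))\<^sup>2"
      unfolding power_mult_distrib[symmetric] by (rule power_mono) simp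
  qed
  also have "\<dots> = (Lp_norm \<infinity> (weighted \<omega> s F))\<^sup>2 * (\<integral>\<^sup>+y. (ennreal (exp (- c * \<omega> (norm (y::'a)))))\<^sup>2 \<partial>lborel)"
    by (rule nn_integral_cmult) measurable
  finally show ?thesis .
qed

text \<open>The integrals left over from g and from its Fourier transform combine into one L2 norm
  over the product space. The exponent K \<mu> on the left is what passing from component weights to
  the weight of the pair requires.\<close>

lemma nn_integral_exp_weight_square_le:
  assumes "0 \<le> \<mu>"
  shows "(\<integral>\<^sup>+y. (ennreal (exp (- (K * \<mu>) * \<omega> (norm (y::'a::euclidean_space)))))\<^sup>2 \<partial>lborel) * (\<integral>\<^sup>+y. (ennreal (exp (- (K * \<mu>) * \<omega> (norm (y::'b::euclidean_space)))))\<^sup>2 \<partial>lborel)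
    \<le> (ennreal (exp (K * \<mu>)) * Lp_norm 2 (\<lambda>z :: 'a \<times> 'b. exp (- \<mu> * \<omega> (norm z))))\<^sup>2"
proof -
  let ?e = "\<lambda>t. (ennreal (exp (- (K * \<mu>) * \<omega> t)))\<^sup>2"
  have "(\<integral>\<^sup>+x. ?e (norm (x::'a)) \<partial>lborel) * (\<integral>\<^sup>+y. ?e (norm (y::'b)) \<partial>lborel)
     = (\<integral>\<^sup>+x. (\<integral>\<^sup>+y. ?e (norm (x::'a)) * ?e (norm (y::'b)) \<partial>lborel) \<partial>lborel)"
    by (simp add: nn_integral_cmult nn_integral_multc)
  also have "\<dots> \<le> (\<integral>\<^sup>+x. (\<integral>\<^sup>+y. (ennreal (exp (K * \<mu>)))\<^sup>2 * (ennreal (exp (- \<mu> * \<omega> (norm (x::'a, y::'b)))))\<^sup>2 \<partial>lborel) \<partial>lborel)"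
  proof (intro nn_integral_mono)
    fix x :: 'a and y :: 'b
    have "exp (- (K * \<mu>) * \<omega> (norm x)) * exp (- (K * \<mu>) * \<omega> (norm y)) = exp (- (\<mu> * K * (\<omega> (norm x) + \<omega> (norm y))))"
      by (simp add: algebra_simps flip: exp_add)
    also have "\<dots> \<le> exp (K * \<mu>) * exp (- \<mu> * \<omega> (norm (x, y)))"
      using exp_w_Pair_le[OF assms, of x y] by (simp add: algebra_simps flip: exp_add)
    finally have "ennreal (exp (- (K * \<mu>) * \<omega> (norm x))) * ennreal (exp (- (K * \<mu>) * \<omega> (norm y)))
        \<le> ennreal (exp (K * \<mu>)) * ennreal (exp (- \<mu> * \<omega> (norm (x, y))))"
      by (simp only: ennreal_mult[symmetric] exp_ge_zero ennreal_leI)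
    then show "?e (norm x) * ?e (norm y) \<le> (ennreal (exp (K * \<mu>)))\<^sup>2 * (ennreal (exp (- \<mu> * \<omega> (norm (x, y)))))\<^sup>2"
      unfolding power_mult_distrib[symmetric] by (rule power_mono) simp
  qed
  also have "\<dots> = (\<integral>\<^sup>+z. (ennreal (exp (K * \<mu>)))\<^sup>2 * (ennreal (exp (- \<mu> * \<omega> (norm (z::'a \<times> 'b)))))\<^sup>2 \<partial>(lborel \<Otimes>\<^sub>M lborel))"
    by (rule lborel.nn_integral_fst[where f="\<lambda>z. (ennreal (exp (K * \<mu>)))\<^sup>2 * (ennreal (exp (- \<mu> * \<omega> (norm z))))\<^sup>2"])
      (simp add: lborel_prod)
  also have "\<dots> = (ennreal (exp (K * \<mu>)))\<^sup>2 * (Lp_norm 2 (\<lambda>z :: 'a \<times> 'b. exp (- \<mu> * \<omega> (norm z))))\<^sup>2"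
    unfolding lborel_prod Lp_norm_two_square by (subst nn_integral_cmult) auto
  finally show ?thesis
    by (simp only: power_mult_distrib)
qed

lemma weighted_Wig_bound:
  fixes g :: "real ^ 'n \<Rightarrow> complex"
  assumes g: "g \<in> S_space \<omega>" and \<tau>: "0 < \<tau>" "\<tau> < 1" and "0 \<le> m" "0 \<le> \<mu>" and s: "s = K\<^sup>2 * (4 * K\<^sup>2 * m + \<mu>)"
  shows "ennreal (exp (K * m * \<omega> (norm v)) * norm (Wig \<tau> g v))
    \<le> ennreal (exp (K\<^sup>2 * m + K * \<mu>) / ((2 * pi) powr (CARD('n) / 2) * (\<tau> - \<tau>\<^sup>2) powr (CARD('n) / 2)))
      * (Lp_norm \<infinity> (weighted \<omega> s g) * Lp_norm \<infinity> (weighted \<omega> s (fourier g)) * Lp_norm 2 (\<lambda>z :: (real ^ 'n) \<times> (real ^ 'n). exp (- \<mu> * \<omega> (norm z))))"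
proof (rule ennreal_power2_le_imp_le, cases v)
  case (Pair x \<xi>)
  let ?N = "CARD('n)"
  let ?G = "Lp_norm \<infinity> (weighted \<omega> s g)" and ?H = "Lp_norm \<infinity> (weighted \<omega> s (fourier g))"
    and ?L = "Lp_norm 2 (\<lambda>z :: (real ^ 'n) \<times> (real ^ 'n). exp (- \<mu> * \<omega> (norm z)))"
    and ?J = "\<integral>\<^sup>+y. (ennreal (exp (- (K * \<mu>) * \<omega> (norm (y::real^'n)))))\<^sup>2 \<partial>lborel"
  \<comment> \<open>The 2 comes from squaring the claim, the last K from
    \<open>exp_w_Pair_le\<close>.\<close>
  define a where "a = 2 * (K * m) * K"
  define D where "D = (2 * pi) powr (?N / 2) * (\<tau> - \<tau>\<^sup>2) powr (?N / 2)"
  have pos: "0 < \<tau> - \<tau>\<^sup>2"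
    using \<tau> by (simp add: power2_eq_square)
  have D: "0 < D" "D\<^sup>2 = (2 * pi) ^ ?N * (\<tau> - \<tau>\<^sup>2) ^ ?N"
    using pos by (auto simp: D_def power_mult_distrib powr_realpow powr_power)
  have "0 \<le> a"
    using \<open>0 \<le> m\<close> K_ge_1 by (simp add: a_def)
  \<comment> \<open>The exponent s is dictated by \<open>D6\<close>; the argument consumes 2 K^2 m +
    K \<mu> of it, and K \<ge> 1 supplies the rest.\<close>
  have as: "a + K * \<mu> \<le> s"
  proof -
    have "1 * 1 \<le> K * K" using K_ge_1 by (intro mult_mono) auto
    then have "1 * K\<^sup>2 \<le> K\<^sup>2 * K\<^sup>2" by (intro mult_right_mono) (auto simp: power2_eq_square)
    then have "2 * K\<^sup>2 \<le> 4 * (K\<^sup>2 * K\<^sup>2)"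
      using zero_le_power2[of K] by linarith
    then have "2 * K\<^sup>2 * m \<le> 4 * (K\<^sup>2 * K\<^sup>2) * m"
      using \<open>0 \<le> m\<close> by (rule mult_right_mono)
    moreover have "K * \<mu> \<le> K\<^sup>2 * \<mu>"
      using K_ge_1 \<open>0 \<le> \<mu>\<close> by (intro mult_right_mono) (auto simp: power2_eq_square)
    ultimately show ?thesis
      by (simp add: a_def s power2_eq_square algebra_simps)
  qed
  have "(exp (K * m * \<omega> (norm v)) * norm (Wig \<tau> g v))\<^sup>2 = exp (2 * (K * m) * \<omega> (norm (x, \<xi>))) * (norm (Wig \<tau> g (x, \<xi>)))\<^sup>2"
    unfolding Pair by (simp add: power_mult_distrib mult.assoc exp_double)
  also have "\<dots> \<le> (exp (a) * exp (a * (\<omega> (norm x) + \<omega> (norm \<xi>)))) * (norm (Wig \<tau> g (x, \<xi>)))\<^sup>2"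
    unfolding a_def using \<open>0 \<le> m\<close> K_ge_1 by (intro mult_right_mono exp_w_Pair_le) auto
  also have "\<dots> = exp a * (exp (a * (\<omega> (norm x) + \<omega> (norm \<xi>))) * (norm (Wig \<tau> g (x, \<xi>)))\<^sup>2)"
    by (rule mult.assoc)
  also have "\<dots> \<le> exp a * (1 / (2 * pi) ^ ?N / (\<tau> - \<tau>\<^sup>2) ^ ?N * (weighted_L2 a g * weighted_L2 a (fourier g)))"
    by (intro mult_left_mono Wig_bound g \<tau> \<open>0 \<le> a\<close>) simp
  also have "\<dots> = exp a / D\<^sup>2 * (weighted_L2 a g * weighted_L2 a (fourier g))"
    unfolding D(2) by simp
  finally have "(ennreal (exp (K * m * \<omega> (norm v)) * norm (Wig \<tau> g v)))\<^sup>2 \<le> ennreal (exp a / D\<^sup>2) * (ennreal (weighted_L2 a g) * ennreal (weighted_L2 a (fourier g)))"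
    by (simp add: ennreal_power ennreal_leI weighted_L2_nonneg flip: ennreal_mult)
  also have "\<dots> \<le> ennreal (exp a / D\<^sup>2) * ((?G\<^sup>2 * ?J) * (?H\<^sup>2 * ?J))"
    by (intro mult_left_mono mult_mono weighted_L2_le S_spaceD g as) auto
  also have "\<dots> = ennreal (exp a / D\<^sup>2) * (?G\<^sup>2 * ?H\<^sup>2 * (?J * ?J))"
    by (simp only: mult_ac)
  also have "\<dots> \<le> ennreal (exp a / D\<^sup>2) * (?G\<^sup>2 * ?H\<^sup>2 * (ennreal (exp (K * \<mu>)) * ?L)\<^sup>2)"
    by (intro mult_left_mono nn_integral_exp_weight_square_le \<open>0 \<le> \<mu>\<close>) auto
  also have "exp a / D\<^sup>2 = (exp (K\<^sup>2 * m) / D)\<^sup>2"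
    by (simp add: a_def power_divide power2_eq_square mult_ac flip: exp_add)
  also have "ennreal ((exp (K\<^sup>2 * m) / D)\<^sup>2) = (ennreal (exp (K\<^sup>2 * m) / D))\<^sup>2"
    using D by (simp add: ennreal_power)
  also have "(ennreal (exp (K\<^sup>2 * m) / D))\<^sup>2 * (?G\<^sup>2 * ?H\<^sup>2 * (ennreal (exp (K * \<mu>)) * ?L)\<^sup>2)
     = ((ennreal (exp (K\<^sup>2 * m) / D) * ennreal (exp (K * \<mu>))) * (?G * ?H * ?L))\<^sup>2"
    by (simp only: power_mult_distrib mult_ac)
  also have "ennreal (exp (K\<^sup>2 * m) / D) * ennreal (exp (K * \<mu>)) = ennreal (exp (K\<^sup>2 * m + K * \<mu>) / D)"
    using D by (simp add: exp_add flip: ennreal_mult)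
  finally show "(ennreal (exp (K * m * \<omega> (norm v)) * norm (Wig \<tau> g v)))\<^sup>2
    \<le> (ennreal (exp (K\<^sup>2 * m + K * \<mu>) / ((2 * pi) powr (?N / 2) * (\<tau> - \<tau>\<^sup>2) powr (?N / 2))) * (?G * ?H * ?L))\<^sup>2"
    unfolding D_def .
qed

section \<open>Expansion of the Wigner transform through STFT inversion\<close>

text \<open>The constant of the inversion formula, a power of 2 pi times the squared L2 norm of the
  window.\<close>

definition STFT_const :: "(real ^ 'n \<Rightarrow> complex) \<Rightarrow> real" where
  "STFT_const g = (2 * pi) ^ CARD('n) * weighted_L2 0 g"

text \<open>Integrating over \<xi> first leaves f(y) |g(y - x)|^2 by
  \<open>integral_STFT_exp\<close>; integrating over x then gives the squared norm of g. The
  identity holds at every y.\<close>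

lemma STFT_inversion:
  fixes f g :: "real ^ 'n \<Rightarrow> complex"
  assumes f: "f \<in> S_space \<omega>" and g: "g \<in> S_space \<omega>"
  shows "(\<integral>z. STFT g f z * tf_shift z g y \<partial>lborel) = of_real (STFT_const g) * f y"
proof -
  note [measurable] = borel_measurable_S_space[OF f] borel_measurable_S_space[OF g]
  obtain Cg where Cg: "\<And>x. norm (g x) \<le> Cg"
    using decays_bounded[OF S_spaceD(3)[OF g]] by metis
  have "integrable lborel (\<lambda>z. STFT g f z * tf_shift z g y)"
    by (rule integrable_bounded_mult[where C=Cg])
       (auto intro!: decays_integrable decays_STFT f g simp: norm_tf_shift Cg)
  then have int: "integrable (lborel \<Otimes>\<^sub>M lborel) (\<lambda>(x, \<xi>). STFT g f (x, \<xi>) * tf_shift (x, \<xi>) g y)"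
    by (simp add: lborel_prod case_prod_beta')
  have "(\<integral>z. STFT g f z * tf_shift z g y \<partial>lborel) = (\<integral>x. (\<integral>\<xi>. STFT g f (x, \<xi>) * tf_shift (x, \<xi>) g y \<partial>lborel) \<partial>lborel)"
    using lborel_pair.integral_fst[OF int] by (simp add: lborel_prod case_prod_beta')
  also have "\<dots> = (\<integral>x. of_real ((2 * pi) ^ CARD('n)) * f y * of_real ((norm (g (y + (-1) *\<^sub>R x)))\<^sup>2) \<partial>lborel)"
  proof (rule Bochner_Integration.integral_cong[OF refl])
    fix x
    have "(\<integral>\<xi>. STFT g f (x, \<xi>) * tf_shift (x, \<xi>) g y \<partial>lborel) = (\<integral>\<xi>. g (y - x) * (exp (\<i> * of_real (y \<bullet> \<xi>)) * STFT g f (x, \<xi>)) \<partial>lborel)"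
      by (simp add: tf_shift_def mult_ac)
    also have "\<dots> = g (y - x) * (of_real ((2 * pi) ^ CARD('n)) * (f y * cnj (g (y - x))))"
      by (simp only: integral_mult_right_zero integral_STFT_exp[OF f g])
    also have "\<dots> = of_real ((2 * pi) ^ CARD('n)) * f y * (g (y - x) * cnj (g (y - x)))"
      by (simp only: mult_ac)
    finally show "(\<integral>\<xi>. STFT g f (x, \<xi>) * tf_shift (x, \<xi>) g y \<partial>lborel) = of_real ((2 * pi) ^ CARD('n)) * f y * of_real ((norm (g (y + (-1) *\<^sub>R x)))\<^sup>2)"
      unfolding complex_norm_square by simp
  qed
  also have "\<dots> = of_real ((2 * pi) ^ CARD('n)) * f y * of_real (\<integral>x. (norm (g (y + (-1) *\<^sub>R x)))\<^sup>2 \<partial>lborel)"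
    by (simp only: integral_mult_right_zero integral_complex_of_real)
  also have "(\<integral>x. (norm (g (y + (-1) *\<^sub>R x)))\<^sup>2 \<partial>lborel) = weighted_L2 0 g"
    unfolding weighted_L2_def by (subst integral_lborel_affine) auto
  finally show ?thesis
    by (simp add: STFT_const_def)
qed

text \<open>Expands the first slot and exchanges the integrals over t and z. Joint integrability
  comes from the decay of the STFT, the boundedness of g and the integrability of \<open>k\<close>
  along the line in t, for which 1 - \<tau> must not vanish.\<close>

lemma cross_Wig_le_STFT:
  fixes f g k :: "real ^ 'n \<Rightarrow> complex"
  assumes f: "f \<in> S_space \<omega>" and g: "g \<in> S_space \<omega>" and k: "integrable lborel k" and "\<tau> \<noteq> 1"
  shows "ennreal (STFT_const g) * ennreal (norm (cross_Wig \<tau> f k u))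
    \<le> (\<integral>\<^sup>+z. ennreal (norm (STFT g f z)) * ennreal (norm (cross_Wig \<tau> (tf_shift z g) k u)) \<partial>lborel)"
proof (cases u)
  case (Pair x \<xi>)
  note [measurable] = borel_measurable_S_space[OF f] borel_measurable_S_space[OF g]
  have [measurable]: "k \<in> borel_measurable borel"
    using k by (auto dest: borel_measurable_integrable)
  obtain Cg where Cg: "\<And>x. norm (g x) \<le> Cg"
    using decays_bounded[OF S_spaceD(3)[OF g]] by metis
  let ?V = "STFT g f"
  let ?F = "\<lambda>t z. exp (- (\<i> * of_real (t \<bullet> \<xi>))) * ((?V z * tf_shift z g (x + \<tau> *\<^sub>R t)) * cnj (k (x - (1 - \<tau>) *\<^sub>R t)))"
  have V: "integrable lborel ?V"
    by (intro decays_integrable decays_STFT f g) measurable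
  have ik: "integrable lborel (\<lambda>t. of_real Cg * k (x + (- (1 - \<tau>)) *\<^sub>R t))"
    using \<open>\<tau> \<noteq> 1\<close> by (intro integrable_mult_right integrable_lborel_affine k) auto
  have "0 \<le> Cg"
    using order_trans[OF norm_ge_zero Cg] .
  have "integrable (lborel \<Otimes>\<^sub>M lborel) (\<lambda>(t, z). of_real Cg * k (x + (- (1 - \<tau>)) *\<^sub>R t) * ?V z)"
    by (rule integrable_pair_mult[OF ik V])
  then have int: "integrable (lborel \<Otimes>\<^sub>M lborel) (\<lambda>(t, z). ?F t z)"
  proof (rule Bochner_Integration.integrable_bound)
    show "(\<lambda>(t, z). ?F t z) \<in> borel_measurable (lborel \<Otimes>\<^sub>M lborel)"
      by measurable
    have "norm (?F t z) \<le> norm (of_real Cg * k (x + (- (1 - \<tau>)) *\<^sub>R t) * ?V z)" for t z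
    proof -
      have arg: "x + (- (1 - \<tau>)) *\<^sub>R t = x - (1 - \<tau>) *\<^sub>R t" by (simp add: algebra_simps)
      have "norm (?F t z) = norm (?V z) * norm (g (x + \<tau> *\<^sub>R t - fst z)) * norm (k (x - (1 - \<tau>) *\<^sub>R t))"
        by (simp add: norm_mult norm_tf_shift)
      also have "\<dots> \<le> norm (?V z) * Cg * norm (k (x - (1 - \<tau>) *\<^sub>R t))"
        by (intro mult_right_mono mult_left_mono Cg) auto
      also have "\<dots> = norm (of_real Cg * k (x + (- (1 - \<tau>)) *\<^sub>R t) * ?V z)"
        unfolding arg using \<open>0 \<le> Cg\<close> by (simp add: norm_mult mult_ac)
      finally show ?thesis .
    qed
    then show "AE p in lborel \<Otimes>\<^sub>M lborel. norm (case p of (t, z) \<Rightarrow> ?F t z) \<le> norm (case p of (t, z) \<Rightarrow> of_real Cg * k (x + (- (1 - \<tau>)) *\<^sub>R t) * ?V z)"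
      by (intro AE_I2) (simp add: case_prod_beta)
  qed
  have "of_real (STFT_const g) * cross_Wig \<tau> f k u = (\<integral>t. exp (- (\<i> * of_real (t \<bullet> \<xi>))) * ((of_real (STFT_const g) * f (x + \<tau> *\<^sub>R t)) * cnj (k (x - (1 - \<tau>) *\<^sub>R t))) \<partial>lborel)"
    unfolding Pair cross_Wig_def prod.case
    by (subst integral_mult_right_zero[symmetric]) (simp only: mult_ac)
  also have "\<dots> = (\<integral>t. (\<integral>z. ?F t z \<partial>lborel) \<partial>lborel)"
    unfolding STFT_inversion[OF f g, symmetric] by (simp only: integral_mult_right_zero integral_mult_left_zero)
  also have "\<dots> = (\<integral>z. (\<integral>t. ?F t z \<partial>lborel) \<partial>lborel)"
    by (rule lborel_pair.Fubini_integral[OF int, symmetric])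
  also have "\<dots> = (\<integral>z. ?V z * cross_Wig \<tau> (tf_shift z g) k u \<partial>lborel)"
  proof (rule Bochner_Integration.integral_cong[OF refl])
    fix z
    show "(\<integral>t. ?F t z \<partial>lborel) = ?V z * cross_Wig \<tau> (tf_shift z g) k u"
      unfolding Pair cross_Wig_def prod.case
      by (subst integral_mult_right_zero[symmetric]) (simp only: mult_ac)
  qed
  finally have eq: "of_real (STFT_const g) * cross_Wig \<tau> f k u = (\<integral>z. ?V z * cross_Wig \<tau> (tf_shift z g) k u \<partial>lborel)" .
  have "0 \<le> STFT_const g"
    by (simp add: STFT_const_def weighted_L2_nonneg)
  then have "ennreal (STFT_const g) * ennreal (norm (cross_Wig \<tau> f k u)) = ennreal (norm (of_real (STFT_const g) * cross_Wig \<tau> f k u))"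
    by (simp add: norm_mult ennreal_mult)
  also have "\<dots> \<le> (\<integral>\<^sup>+z. ennreal (norm (?V z * cross_Wig \<tau> (tf_shift z g) k u)) \<partial>lborel)"
    unfolding eq by (rule ennreal_norm_integral_le)
  finally show ?thesis
    by (simp add: norm_mult ennreal_mult)
qed

text \<open>The expansion is used first with \<open>k\<close> = f and then, after exchanging the
  slots, with \<tau> replaced by 1 - \<tau> and the shifted window as \<open>k\<close>. A second
  exchange brings back \<tau>, and the doubly shifted transform becomes a translate of that of
  g.\<close>

lemma Wig_le_STFT:
  fixes f g :: "real ^ 'n \<Rightarrow> complex"
  assumes f: "f \<in> S_space \<omega>" and g: "g \<in> S_space \<omega>" and \<tau>: "0 < \<tau>" "\<tau> < 1"
  shows "(ennreal (STFT_const g))\<^sup>2 * ennreal (norm (Wig \<tau> f u))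
    \<le> (\<integral>\<^sup>+z. (\<integral>\<^sup>+w. ennreal (norm (STFT g f z)) * (ennreal (norm (STFT g f w)) * ennreal (norm (Wig \<tau> g (u - Wig_center \<tau> z w)))) \<partial>lborel) \<partial>lborel)"
proof -
  note [measurable] = borel_measurable_S_space[OF f] borel_measurable_S_space[OF g]
  let ?V = "STFT g f" and ?c = "ennreal (STFT_const g)"
  have m [measurable]: "tf_shift z g \<in> borel_measurable borel" for z
    by (rule borel_measurable_tf_shift[where Y="\<lambda>y. y"]) auto
  have ish: "integrable lborel (tf_shift z g)" for z
  proof (rule Bochner_Integration.integrable_bound)
    show "integrable lborel (\<lambda>y. g (- fst z + 1 *\<^sub>R y))"
      by (intro integrable_lborel_affine integrable_S_space g) auto
  qed (auto simp: norm_tf_shift)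
  have "?c * ennreal (norm (Wig \<tau> f u)) \<le> (\<integral>\<^sup>+z. ennreal (norm (?V z)) * ennreal (norm (cross_Wig \<tau> (tf_shift z g) f u)) \<partial>lborel)"
    using cross_Wig_le_STFT[OF f g integrable_S_space[OF f], of \<tau> u] \<tau> by (simp add: Wig_eq_cross_Wig)
  then have "?c * (?c * ennreal (norm (Wig \<tau> f u))) \<le> ?c * (\<integral>\<^sup>+z. ennreal (norm (?V z)) * ennreal (norm (cross_Wig \<tau> (tf_shift z g) f u)) \<partial>lborel)"
    by (rule mult_left_mono) simp
  also have "\<dots> = (\<integral>\<^sup>+z. ?c * (ennreal (norm (?V z)) * ennreal (norm (cross_Wig \<tau> (tf_shift z g) f u))) \<partial>lborel)"
  proof (rule nn_integral_cmult[symmetric])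
    have "(\<lambda>z. cross_Wig \<tau> (tf_shift z g) f u) \<in> borel_measurable borel"
      unfolding cross_Wig_def case_prod_beta by measurable
    then show "(\<lambda>z. ennreal (norm (?V z)) * ennreal (norm (cross_Wig \<tau> (tf_shift z g) f u))) \<in> borel_measurable lborel"
      by measurable
  qed
  also have "\<dots> \<le> (\<integral>\<^sup>+z. (\<integral>\<^sup>+w. ennreal (norm (?V z)) * (ennreal (norm (?V w)) * ennreal (norm (Wig \<tau> g (u - Wig_center \<tau> z w)))) \<partial>lborel) \<partial>lborel)"
  proof (rule nn_integral_mono)
    fix z
    have W: "norm (cross_Wig (1 - \<tau>) (tf_shift w g) (tf_shift z g) u) = norm (Wig \<tau> g (u - Wig_center \<tau> z w))" for w
      using norm_cross_Wig_tf_shift[of g \<tau> z w u] norm_cross_Wig_commute[of "tf_shift z g" "tf_shift w g" \<tau> u]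
      by (simp add: Wig_eq_cross_Wig)
    have "?c * ennreal (norm (cross_Wig \<tau> (tf_shift z g) f u)) = ?c * ennreal (norm (cross_Wig (1 - \<tau>) f (tf_shift z g) u))"
      using norm_cross_Wig_commute[of "tf_shift z g" f \<tau> u] by simp
    also have "\<dots> \<le> (\<integral>\<^sup>+w. ennreal (norm (?V w)) * ennreal (norm (Wig \<tau> g (u - Wig_center \<tau> z w))) \<partial>lborel)"
      using cross_Wig_le_STFT[OF f g ish[of z], of "1 - \<tau>" u] \<tau> unfolding W by simp
    finally have "ennreal (norm (?V z)) * (?c * ennreal (norm (cross_Wig \<tau> (tf_shift z g) f u)))
       \<le> ennreal (norm (?V z)) * (\<integral>\<^sup>+w. ennreal (norm (?V w)) * ennreal (norm (Wig \<tau> g (u - Wig_center \<tau> z w))) \<partial>lborel)"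
      by (rule mult_left_mono) simp
    also have "\<dots> = (\<integral>\<^sup>+w. ennreal (norm (?V z)) * (ennreal (norm (?V w)) * ennreal (norm (Wig \<tau> g (u - Wig_center \<tau> z w)))) \<partial>lborel)"
    proof (rule nn_integral_cmult[symmetric])
      have "(\<lambda>w. Wig_center \<tau> z w) \<in> borel_measurable borel"
        unfolding Wig_center_def by measurable
      then show "(\<lambda>w. ennreal (norm (?V w)) * ennreal (norm (Wig \<tau> g (u - Wig_center \<tau> z w)))) \<in> borel_measurable lborel"
        by measurable
    qed
    finally show "?c * (ennreal (norm (?V z)) * ennreal (norm (cross_Wig \<tau> (tf_shift z g) f u)))
      \<le> (\<integral>\<^sup>+w. ennreal (norm (?V z)) * (ennreal (norm (?V w)) * ennreal (norm (Wig \<tau> g (u - Wig_center \<tau> z w)))) \<partial>lborel)"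
      by (simp only: mult_ac)
  qed
  finally show ?thesis
    by (simp only: power2_eq_square mult.assoc)
qed

text \<open>The weight at u is distributed in two rounds: u is v plus the centre, costing K, and the
  centre is controlled by z and w, costing K again. Once the window's transform is replaced by its
  uniform bound \<open>B\<close>, the variables z and w decouple and the double integral is a
  square.\<close>

lemma weighted_Wig_le_STFT:
  fixes f g :: "real ^ 'n \<Rightarrow> complex"
  assumes f: "f \<in> S_space \<omega>" and g: "g \<in> S_space \<omega>" and \<tau>: "0 < \<tau>" "\<tau> < 1" and "0 \<le> m" "K\<^sup>2 * m \<le> s"
    and B: "\<And>v. ennreal (exp (K * m * \<omega> (norm v)) * norm (Wig \<tau> g v)) \<le> B"
  shows "(ennreal (STFT_const g))\<^sup>2 * ennreal (exp (m * \<omega> (norm u)) * norm (Wig \<tau> f u))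
    \<le> ennreal (exp (K * m + K\<^sup>2 * m)) * B * (\<integral>\<^sup>+z. ennreal (exp (s * \<omega> (norm z)) * norm (STFT g f z)) \<partial>lborel)\<^sup>2"
proof -
  note [measurable] = borel_measurable_S_space[OF f] borel_measurable_S_space[OF g]
  let ?V = "STFT g f" and ?c = "ennreal (STFT_const g)"
  let ?X = "\<lambda>z. ennreal (exp (s * \<omega> (norm z)) * norm (?V z))"
  have [measurable]: "(\<lambda>w. Wig_center \<tau> z (w :: (real^'n) \<times> (real^'n))) \<in> borel_measurable borel" for z
    unfolding Wig_center_def by measurable
  have pw: "ennreal (exp (m * \<omega> (norm u))) * (ennreal (norm (?V z)) * (ennreal (norm (?V w)) * ennreal (norm (Wig \<tau> g (u - Wig_center \<tau> z w)))))
     \<le> ennreal (exp (K * m + K\<^sup>2 * m)) * B * ?X z * ?X w" for z w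
  proof -
    let ?v = "u - Wig_center \<tau> z w"
    have "\<omega> (norm u) \<le> K * (1 + \<omega> (norm ?v) + \<omega> (norm (Wig_center \<tau> z w)))"
      using w_norm_add[of ?v "Wig_center \<tau> z w"] by simp
    also have "\<dots> \<le> K * (1 + \<omega> (norm ?v) + K * (1 + \<omega> (norm z) + \<omega> (norm w)))"
      using K_ge_1 by (intro mult_left_mono add_left_mono w_double norm_Wig_center_le \<tau>) auto
    finally have "m * \<omega> (norm u) \<le> m * (K * (1 + \<omega> (norm ?v) + K * (1 + \<omega> (norm z) + \<omega> (norm w))))"
      using \<open>0 \<le> m\<close> by (rule mult_left_mono)
    also have "\<dots> = K * m + K\<^sup>2 * m + (K * m * \<omega> (norm ?v) + (K\<^sup>2 * m * \<omega> (norm z) + K\<^sup>2 * m * \<omega> (norm w)))"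
      by (simp add: algebra_simps power2_eq_square)
    also have "\<dots> \<le> K * m + K\<^sup>2 * m + (K * m * \<omega> (norm ?v) + (s * \<omega> (norm z) + s * \<omega> (norm w)))"
      using \<open>K\<^sup>2 * m \<le> s\<close> by (intro add_left_mono add_mono mult_right_mono) auto
    finally have "exp (m * \<omega> (norm u)) \<le> exp (K * m + K\<^sup>2 * m) * (exp (K * m * \<omega> (norm ?v)) * (exp (s * \<omega> (norm z)) * exp (s * \<omega> (norm w))))"
      by (simp only: exp_add[symmetric] exp_le_cancel_iff)
    then have "exp (m * \<omega> (norm u)) * (norm (?V z) * (norm (?V w) * norm (Wig \<tau> g ?v)))
      \<le> (exp (K * m + K\<^sup>2 * m) * (exp (K * m * \<omega> (norm ?v)) * (exp (s * \<omega> (norm z)) * exp (s * \<omega> (norm w))))) * (norm (?V z) * (norm (?V w) * norm (Wig \<tau> g ?v)))"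
      by (rule mult_right_mono) simp
    also have "\<dots> = exp (K * m + K\<^sup>2 * m) * (exp (K * m * \<omega> (norm ?v)) * norm (Wig \<tau> g ?v)) * (exp (s * \<omega> (norm z)) * norm (?V z)) * (exp (s * \<omega> (norm w)) * norm (?V w))"
      by (simp only: mult_ac)
    finally have "ennreal (exp (m * \<omega> (norm u)) * (norm (?V z) * (norm (?V w) * norm (Wig \<tau> g ?v))))
      \<le> ennreal (exp (K * m + K\<^sup>2 * m) * (exp (K * m * \<omega> (norm ?v)) * norm (Wig \<tau> g ?v)) * (exp (s * \<omega> (norm z)) * norm (?V z)) * (exp (s * \<omega> (norm w)) * norm (?V w)))"
      by (rule ennreal_leI)
    then have "ennreal (exp (m * \<omega> (norm u))) * (ennreal (norm (?V z)) * (ennreal (norm (?V w)) * ennreal (norm (Wig \<tau> g ?v))))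
      \<le> ennreal (exp (K * m + K\<^sup>2 * m)) * ennreal (exp (K * m * \<omega> (norm ?v)) * norm (Wig \<tau> g ?v)) * ?X z * ?X w"
      by (simp only: ennreal_mult exp_ge_zero norm_ge_zero mult_nonneg_nonneg)
    also have "\<dots> \<le> ennreal (exp (K * m + K\<^sup>2 * m)) * B * ?X z * ?X w"
      by (intro mult_right_mono mult_left_mono B) auto
    finally show ?thesis .
  qed
  have mm [measurable]: "(\<lambda>z. \<integral>\<^sup>+w. ennreal (norm (?V z)) * (ennreal (norm (?V w)) * ennreal (norm (Wig \<tau> g (u - Wig_center \<tau> z w)))) \<partial>lborel) \<in> borel_measurable borel"
    unfolding Wig_center_def by measurable
  have "?c\<^sup>2 * ennreal (exp (m * \<omega> (norm u)) * norm (Wig \<tau> f u)) = ennreal (exp (m * \<omega> (norm u))) * (?c\<^sup>2 * ennreal (norm (Wig \<tau> f u)))"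
    by (simp add: ennreal_mult mult_ac)
  also have "\<dots> \<le> ennreal (exp (m * \<omega> (norm u))) * (\<integral>\<^sup>+z. (\<integral>\<^sup>+w. ennreal (norm (?V z)) * (ennreal (norm (?V w)) * ennreal (norm (Wig \<tau> g (u - Wig_center \<tau> z w)))) \<partial>lborel) \<partial>lborel)"
    by (intro mult_left_mono Wig_le_STFT f g \<tau>) simp
  also have "\<dots> = (\<integral>\<^sup>+z. ennreal (exp (m * \<omega> (norm u))) * (\<integral>\<^sup>+w. ennreal (norm (?V z)) * (ennreal (norm (?V w)) * ennreal (norm (Wig \<tau> g (u - Wig_center \<tau> z w)))) \<partial>lborel) \<partial>lborel)"
    by (rule nn_integral_cmult[symmetric]) (use mm in simp)
  also have "\<dots> = (\<integral>\<^sup>+z. (\<integral>\<^sup>+w. ennreal (exp (m * \<omega> (norm u))) * (ennreal (norm (?V z)) * (ennreal (norm (?V w)) * ennreal (norm (Wig \<tau> g (u - Wig_center \<tau> z w))))) \<partial>lborel) \<partial>lborel)"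
    by (rule nn_integral_cong, rule nn_integral_cmult[symmetric]) measurable
  also have "\<dots> \<le> (\<integral>\<^sup>+z. (\<integral>\<^sup>+w. ennreal (exp (K * m + K\<^sup>2 * m)) * B * ?X z * ?X w \<partial>lborel) \<partial>lborel)"
    by (intro nn_integral_mono pw)
  also have "\<dots> = ennreal (exp (K * m + K\<^sup>2 * m)) * B * (\<integral>\<^sup>+z. ?X z \<partial>lborel)\<^sup>2"
    by (simp add: nn_integral_cmult nn_integral_multc power2_eq_square mult.assoc)
  finally show ?thesis .
qed

text \<open>Hoelder with exponents 2p and (2p)', after writing s as (s + \<mu>) - \<mu>. Squaring
  turns the L^(2p) norm into an L^p norm of the spectrogram and doubles the exponent of the
  weight.\<close>

lemma STFT_weighted_L1_le:
  fixes f g :: "real ^ 'n \<Rightarrow> complex"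
  assumes f: "f \<in> S_space \<omega>" and g: "g \<in> S_space \<omega>" and "1 \<le> p"
  shows "(\<integral>\<^sup>+z. ennreal (exp (s * \<omega> (norm z)) * norm (STFT g f z)) \<partial>lborel)\<^sup>2
    \<le> Lp_norm p (weighted \<omega> (2 * (s + \<mu>)) (spectrogram g f)) * (Lp_norm (conj_exponent (2 * p)) (\<lambda>z :: (real ^ 'n) \<times> (real ^ 'n). exp (- \<mu> * \<omega> (norm z))))\<^sup>2"
proof -
  note [measurable] = borel_measurable_S_space[OF f] borel_measurable_S_space[OF g]
  let ?U = "weighted \<omega> (s + \<mu>) (STFT g f)" and ?e = "\<lambda>z :: (real ^ 'n) \<times> (real ^ 'n). exp (- \<mu> * \<omega> (norm z))"
  have [measurable]: "?U \<in> borel_measurable borel" by measurable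
  have p2: "1 \<le> 2 * p"
    using mult_mono[of 1 2 1 p] \<open>1 \<le> p\<close> by simp
  have "ennreal (exp (s * \<omega> (norm z)) * norm (STFT g f z)) = ennreal (norm (?U z)) * ennreal (norm (?e z))" for z
  proof -
    have "exp (s * \<omega> (norm z)) * norm (STFT g f z) = norm (?U z) * norm (?e z)"
      by (simp add: norm_weighted distrib_right exp_add exp_minus)
    then show ?thesis by (simp add: ennreal_mult)
  qed
  then have "(\<integral>\<^sup>+z. ennreal (exp (s * \<omega> (norm z)) * norm (STFT g f z)) \<partial>lborel) \<le> Lp_norm (2 * p) ?U * Lp_norm (conj_exponent (2 * p)) ?e"
    using Lp_norm_Holder[of ?U ?e "2 * p"] p2 by simp
  then have "(\<integral>\<^sup>+z. ennreal (exp (s * \<omega> (norm z)) * norm (STFT g f z)) \<partial>lborel)\<^sup>2 \<le> (Lp_norm (2 * p) ?U)\<^sup>2 * (Lp_norm (conj_exponent (2 * p)) ?e)\<^sup>2"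
    unfolding power_mult_distrib[symmetric] by (rule power_mono) simp
  also have "\<dots> \<le> Lp_norm p (\<lambda>z. (norm (?U z))\<^sup>2) * (Lp_norm (conj_exponent (2 * p)) ?e)\<^sup>2"
    by (intro mult_right_mono Lp_norm_double_square_le \<open>1 \<le> p\<close>) auto
  also have "(\<lambda>z. (norm (?U z))\<^sup>2) = weighted \<omega> (2 * (s + \<mu>)) (spectrogram g f)"
  proof
    fix z
    have "(norm (?U z))\<^sup>2 = exp (2 * (s + \<mu>) * \<omega> (norm z)) * (norm (STFT g f z))\<^sup>2"
      unfolding norm_weighted by (simp only: power_mult_distrib mult.assoc exp_double)
    then show "(norm (?U z))\<^sup>2 = weighted \<omega> (2 * (s + \<mu>)) (spectrogram g f) z"
      unfolding weighted_def[of \<omega> _ "spectrogram g f"] by (simp only: spectrogram_def real_scaleR_def)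
  qed
  finally show ?thesis .
qed

end

section \<open>Concentration\<close>

text \<open>Cancelling \<open>R\<close> itself would require it to be finite and nonzero. The
  supremum of X has both properties through \<open>C\<close> and \<open>z\<^sub>0\<close>,
  independently of \<open>R\<close>.\<close>

lemma emeasure_ge_of_concentration:
  fixes X :: "'a::euclidean_space \<Rightarrow> ennreal"
  assumes E: "E \<in> sets lebesgue" and R: "\<And>z. X z \<le> R" and nz: "X z\<^sub>0 \<noteq> 0" and bdd: "\<And>z. X z \<le> ennreal C"
    and conc: "e * R \<le> (\<integral>\<^sup>+z\<in>E. X z \<partial>lebesgue)"
  shows "e \<le> emeasure lebesgue E"
proof -
  define \<sigma> where "\<sigma> = (SUP z. X z)"
  have le: "X z \<le> \<sigma>" for z
    unfolding \<sigma>_def by (rule SUP_upper) simp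
  have "\<sigma> \<le> ennreal C"
    unfolding \<sigma>_def by (rule SUP_least) (rule bdd)
  then have "\<sigma> \<noteq> top"
    by (auto simp: top_unique)
  moreover have "\<sigma> \<noteq> 0"
    using le[of z\<^sub>0] nz by auto
  moreover have "\<sigma> * e \<le> \<sigma> * emeasure lebesgue E"
  proof -
    have "\<sigma> \<le> R"
      unfolding \<sigma>_def by (rule SUP_least) (rule R)
    then have "\<sigma> * e \<le> e * R"
      by (simp add: mult.commute[of e] mult_right_mono)
    also note conc
    also have "(\<integral>\<^sup>+z\<in>E. X z \<partial>lebesgue) \<le> (\<integral>\<^sup>+z. \<sigma> * indicator E z \<partial>lebesgue)"
      by (intro nn_integral_mono mult_right_mono le) simp
    also have "\<dots> = \<sigma> * emeasure lebesgue E"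
      using E by (rule nn_integral_cmult_indicator)
    finally show ?thesis .
  qed
  ultimately show ?thesis
    by (simp add: ennreal_mult_le_mult_iff)
qed

text \<open>Here c = top must be excluded because an infimum can be 0 although no \<open>T i\<close>
  is, and c = 0 because an empty infimum is top. In the remaining range division by c is
  legitimate.\<close>

lemma le_times_INF_ennreal:
  fixes c x :: ennreal
  assumes "c \<noteq> 0" "c \<noteq> top" and le: "\<And>i. i \<in> I \<Longrightarrow> x \<le> c * T i"
  shows "x \<le> c * (INF i\<in>I. T i)"
proof -
  have "x / c \<le> (INF i\<in>I. T i)"
  proof (rule INF_greatest)
    fix i assume "i \<in> I"
    then have "x / c \<le> c * T i / c"
      by (intro divide_right_mono_ennreal le)
    also have "\<dots> = T i"
      using assms by (simp add: mult.commute[of c] mult_divide_eq_ennreal)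
    finally show "x / c \<le> T i" .
  qed
  then have "c * (x / c) \<le> c * (INF i\<in>I. T i)"
    by (rule mult_left_mono) simp
  also have "c * (x / c) = x"
    using assms by (simp add: ennreal_times_divide mult.commute[of c] mult_divide_eq_ennreal)
  finally show ?thesis .
qed

context weight
begin

lemma decays_weighted:
  assumes "decays F"
  shows "decays (weighted \<omega> m F)"
  unfolding decays_def
proof
  fix m'
  obtain C where "\<And>x. exp ((m' + m) * \<omega> (norm x)) * norm (F x) \<le> C"
    using decaysE[OF assms] by metis
  then show "\<exists>C. \<forall>x. exp (m' * \<omega> (norm x)) * norm (weighted \<omega> m F x) \<le> C"
    by (auto simp: weighted_def distrib_right exp_add mult.assoc)
qed

lemma decays_spectrogram:
  assumes "f \<in> S_space \<omega>" "g \<in> S_space \<omega>"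
  shows "decays (spectrogram g f)"
  unfolding decays_def
proof
  fix m :: real
  obtain C where C: "0 \<le> C" "\<And>z. exp ((m / 2) * \<omega> (norm z)) * norm (STFT g f z) \<le> C"
    using decaysE[OF decays_STFT[OF assms]] by metis
  have "exp (m * \<omega> (norm z)) * norm (spectrogram g f z) \<le> C\<^sup>2" for z
  proof -
    have "exp (m * \<omega> (norm z)) = (exp ((m / 2) * \<omega> (norm z)))\<^sup>2"
      by (simp flip: exp_double)
    then have "exp (m * \<omega> (norm z)) * norm (spectrogram g f z) = (exp ((m / 2) * \<omega> (norm z)) * norm (STFT g f z))\<^sup>2"
      by (simp add: spectrogram_def power_mult_distrib)
    also have "\<dots> \<le> C\<^sup>2"
      by (intro power_mono C) simp
    finally show ?thesis .
  qed
  then show "\<exists>C. \<forall>z. exp (m * \<omega> (norm z)) * norm (spectrogram g f z) \<le> C" by blast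
qed

text \<open>With C a bound for F, the r-th power of |F| is at most C^(r - 1) |F|, so every finite
  exponent reduces to integrability.\<close>

lemma decays_Lp_norm_finite:
  fixes F :: "'a::euclidean_space \<Rightarrow> 'b::{banach, second_countable_topology}"
  assumes [measurable]: "F \<in> borel_measurable borel" and F: "decays F" and "1 \<le> p"
  shows "Lp_norm p F < \<infinity>"
proof -
  obtain C where C: "\<And>x. norm (F x) \<le> C"
    using decays_bounded[OF F] by metis
  show ?thesis
  proof (cases p)
    case top
    have "esssup lebesgue (\<lambda>z. ennreal (norm (F z))) \<le> ennreal C"
      by (intro esssup_I) (auto intro!: measurable_completion ennreal_leI C)
    then show ?thesis
      using top by (auto simp: Lp_norm_def intro: order.strict_trans1)
  next
    case (real r)
    then have "1 \<le> r" using \<open>1 \<le> p\<close> by (simp flip: ennreal_1)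
    have "(\<integral>\<^sup>+z. ennreal (norm (F z) powr r) \<partial>lborel) \<le> (\<integral>\<^sup>+z. ennreal (C powr (r - 1)) * ennreal (norm (F z)) \<partial>lborel)"
    proof (rule nn_integral_mono)
      fix z
      have "norm (F z) powr r = norm (F z) powr (r - 1) * norm (F z)"
        using powr_add[of "norm (F z)" "r - 1" 1] by simp
      also have "\<dots> \<le> C powr (r - 1) * norm (F z)"
        using \<open>1 \<le> r\<close> by (intro mult_right_mono powr_mono2 C) auto
      finally show "ennreal (norm (F z) powr r) \<le> ennreal (C powr (r - 1)) * ennreal (norm (F z))"
        by (simp add: ennreal_leI flip: ennreal_mult)
    qed
    also have "\<dots> = ennreal (C powr (r - 1)) * (\<integral>\<^sup>+z. ennreal (norm (F z)) \<partial>lborel)"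
      by (rule nn_integral_cmult) measurable
    also have "\<dots> < \<infinity>"
      using decays_integrable[OF assms(1) F] by (simp add: ennreal_mult_less_top integrable_iff_bounded)
    finally show ?thesis
      unfolding real(2) using \<open>1 \<le> r\<close> by (simp add: Lp_norm_finite_exponent)
  qed
qed

lemma Lp_norm_two_weighted_L2:
  assumes "g \<in> S_space \<omega>"
  shows "(Lp_norm 2 g)\<^sup>2 = ennreal (weighted_L2 0 g)"
  using nn_integral_weighted_L2[OF borel_measurable_S_space[OF assms] S_spaceD(3)[OF assms], of 0]
  by (simp add: Lp_norm_two_square)

text \<open>If the L2 norm vanished, g would be zero almost everywhere and, being continuous,
  everywhere.\<close>

lemma weighted_L2_pos:
  assumes g: "g \<in> S_space \<omega>" and "g \<noteq> (\<lambda>_. 0)"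
  shows "0 < weighted_L2 0 g"
proof -
  note [measurable] = borel_measurable_S_space[OF g]
  have "weighted_L2 0 g \<noteq> 0"
  proof
    assume "weighted_L2 0 g = 0"
    then have "(\<integral>\<^sup>+y. (ennreal (norm (g y)))\<^sup>2 \<partial>lborel) = 0"
      using Lp_norm_two_weighted_L2[OF g] by (simp add: Lp_norm_two_square)
    then have "AE y in lborel. ennreal (norm (g y)) \<le> 0"
      by (simp add: nn_integral_0_iff_AE)
    then have "esssup lebesgue (\<lambda>y. ennreal (norm (g y))) \<le> 0"
      by (intro esssup_I AE_completion measurable_completion) measurable
    then have "Lp_norm \<infinity> g \<le> 0"
      by (simp add: Lp_norm_def)
    then have "norm (g x) = 0" for x
      using continuous_le_Lp_norm_infinity[OF S_spaceD(1)[OF g], of x] by simp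
    with \<open>g \<noteq> (\<lambda>_. 0)\<close> show False by auto
  qed
  then show ?thesis
    using weighted_L2_nonneg[of 0 g] by simp
qed

text \<open>If the Wigner transform of f vanished identically, the convolution bound with window f
  would force the spectrogram to vanish, contrary to \<open>STFT_nonzero\<close>.\<close>

lemma Wig_nonzero:
  assumes f: "f \<in> S_space \<omega>" and nz: "f \<noteq> (\<lambda>_. 0)" and \<tau>: "0 < \<tau>" "\<tau> < 1"
  obtains z where "Wig \<tau> f z \<noteq> 0"
proof (rule ccontr)
  assume "\<not> thesis"
  then have W: "Wig \<tau> f z = 0" for z using that by blast
  obtain z where "STFT f f z \<noteq> 0"
    using STFT_nonzero[OF f f nz nz] .
  then show False
    using spectrogram_le_convolution[OF f f \<tau>, of z] by (simp add: W spectrogram_def)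
qed

text \<open>One admissible pair of parameters at a time, before the infimum is taken. The second
  conclusion says that the denominator of \<open>D6\<close> is a positive finite number, so the
  division there is a genuine one.\<close>

lemma Wig_bound_D6_summand:
  fixes f g :: "real ^ 'n \<Rightarrow> complex"
  assumes f: "f \<in> S_space \<omega>" and g: "g \<in> S_space \<omega>" and nz: "g \<noteq> (\<lambda>_. 0)" and \<tau>: "0 < \<tau>" "\<tau> < 1"
    and "0 \<le> m" "0 \<le> \<mu>'" "1 \<le> p" and \<mu>: "2 * (K\<^sup>2 * \<mu>' + \<mu>'') = \<mu>"
  defines "d \<equiv> ennreal ((2 * pi) powr (5 / 2 * real CARD('n)) * (\<tau> - \<tau>\<^sup>2) powr (real CARD('n) / 2)) * Lp_norm 2 g ^ 4"
  shows "ennreal (exp (m * \<omega> (norm u)) * norm (Wig \<tau> f u))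
    \<le> ennreal (exp (K / 2 * (1 + 2 * K) * m)) / d * Lp_norm p (weighted \<omega> (8 * K ^ 4 * m + \<mu>) (spectrogram g f)) *
      (ennreal (exp (K * (1 + 2 * K) * (4 * K\<^sup>2 * m + \<mu>'))) *
         Lp_norm \<infinity> (weighted \<omega> (K\<^sup>2 * (4 * K\<^sup>2 * m + \<mu>')) g) *
         Lp_norm \<infinity> (weighted \<omega> (K\<^sup>2 * (4 * K\<^sup>2 * m + \<mu>')) (fourier g)) *
         Lp_norm 2 (\<lambda>z :: (real ^ 'n) \<times> (real ^ 'n). exp (- \<mu>' * \<omega> (norm z))) *
         (Lp_norm (conj_exponent (2 * p)) (\<lambda>z :: (real ^ 'n) \<times> (real ^ 'n). exp (- \<mu>'' * \<omega> (norm z))))\<^sup>2)"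
    and "\<exists>d'>0. d = ennreal d'"
proof -
  let ?N = "real CARD('n)"
  define s where "s = K\<^sup>2 * (4 * K\<^sup>2 * m + \<mu>')"
  define D where "D = (2 * pi) powr (?N / 2) * (\<tau> - \<tau>\<^sup>2) powr (?N / 2)"
  define GHL where "GHL = Lp_norm \<infinity> (weighted \<omega> s g) * Lp_norm \<infinity> (weighted \<omega> s (fourier g)) * Lp_norm 2 (\<lambda>z :: (real ^ 'n) \<times> (real ^ 'n). exp (- \<mu>' * \<omega> (norm z)))"
  define L where "L = (Lp_norm (conj_exponent (2 * p)) (\<lambda>z :: (real ^ 'n) \<times> (real ^ 'n). exp (- \<mu>'' * \<omega> (norm z))))\<^sup>2"
  define S where "S = Lp_norm p (weighted \<omega> (8 * K ^ 4 * m + \<mu>) (spectrogram g f))"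
  define x where "x = ennreal (exp (m * \<omega> (norm u)) * norm (Wig \<tau> f u))"
  define c where "c = STFT_const g"
  define e1 e2 where "e1 = exp (K / 2 * (1 + 2 * K) * m)" and "e2 = exp (K * (1 + 2 * K) * (4 * K\<^sup>2 * m + \<mu>'))"
  have pos: "0 < \<tau> - \<tau>\<^sup>2"
    using \<tau> by (simp add: power2_eq_square)
  have "0 < D"
    using pos by (simp add: D_def)
  have "0 < c"
    using weighted_L2_pos[OF g nz] by (simp add: c_def STFT_const_def)
  \<comment> \<open>D is the denominator from the bound on the window's Wigner transform, and each
    of the two inversions contributes one c; the powers of 2 pi add up as N/2 + N + N.\<close>
  have d: "d = ennreal (D * c\<^sup>2)"
  proof -
    have "Lp_norm 2 g ^ 4 = ((Lp_norm 2 g)\<^sup>2)\<^sup>2"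
      by (simp flip: power_mult)
    also have "\<dots> = ennreal ((weighted_L2 0 g)\<^sup>2)"
      unfolding Lp_norm_two_weighted_L2[OF g] by (simp add: ennreal_power weighted_L2_nonneg)
    finally have "d = ennreal ((2 * pi) powr (5 / 2 * ?N) * (\<tau> - \<tau>\<^sup>2) powr (?N / 2) * (weighted_L2 0 g)\<^sup>2)"
      unfolding d_def by (simp add: ennreal_mult)
    also have "(2 * pi) powr (5 / 2 * ?N) = (2 * pi) powr (?N / 2) * ((2 * pi) ^ CARD('n))\<^sup>2"
    proof -
      have "(2 * pi) powr (5 / 2 * ?N) = (2 * pi) powr (?N / 2 + (?N + ?N))"
        by (rule arg_cong) (simp add: field_simps)
      also have "\<dots> = (2 * pi) powr (?N / 2) * ((2 * pi) powr ?N * (2 * pi) powr ?N)"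
        by (simp only: powr_add)
      also have "(2 * pi) powr ?N = (2 * pi) ^ CARD('n)"
        by (rule powr_realpow) simp
      finally show ?thesis
        by (simp only: power2_eq_square)
    qed
    finally show ?thesis
      by (simp add: D_def c_def STFT_const_def power_mult_distrib mult_ac)
  qed
  then show "\<exists>d'>0. d = ennreal d'"
    using \<open>0 < D\<close> \<open>0 < c\<close> by (intro exI[of _ "D * c\<^sup>2"]) simp
  have K: "1 \<le> K" by (rule K_ge_1)
  have KK: "1 \<le> K\<^sup>2" "K \<le> K\<^sup>2"
    using K by (auto simp: power2_eq_square intro: mult_mono[of 1 K 1 K, simplified])
  have Kms: "K\<^sup>2 * m \<le> s"
    unfolding s_def using \<open>0 \<le> m\<close> \<open>0 \<le> \<mu>'\<close> KK mult_right_mono[of 1 "4 * K\<^sup>2" m] by (intro mult_left_mono) auto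
  \<comment> \<open>The left side is what the estimates produce, the right side what
    \<open>D6\<close> provides. Comparing the coefficients of m and of \<mu>' separately, K \<ge> 1
    suffices.\<close>
  have exps: "exp (K * m + K\<^sup>2 * m) * exp (K\<^sup>2 * m + K * \<mu>') \<le> e1 * e2"
  proof -
    have "K / 2 \<le> 4 * K\<^sup>2 * K" "K\<^sup>2 \<le> 4 * K\<^sup>2 * (2 * K\<^sup>2)"
      using K KK mult_right_mono[of 1 "4 * K\<^sup>2 * 2" K] mult_right_mono[of 1 "4 * K\<^sup>2 * 2" "K\<^sup>2"] by (auto simp: mult_ac)
    then have "K + 2 * K\<^sup>2 \<le> K / 2 * (1 + 2 * K) + K * (1 + 2 * K) * (4 * K\<^sup>2)"
      by (simp add: algebra_simps power2_eq_square)
    then have "(K + 2 * K\<^sup>2) * m \<le> (K / 2 * (1 + 2 * K) + K * (1 + 2 * K) * (4 * K\<^sup>2)) * m"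
      using \<open>0 \<le> m\<close> by (rule mult_right_mono)
    moreover have "K * \<mu>' \<le> K * (1 + 2 * K) * \<mu>'"
      using K \<open>0 \<le> \<mu>'\<close> by (intro mult_right_mono) auto
    ultimately have "(K * m + K\<^sup>2 * m) + (K\<^sup>2 * m + K * \<mu>') \<le> K / 2 * (1 + 2 * K) * m + K * (1 + 2 * K) * (4 * K\<^sup>2 * m + \<mu>')"
      by (simp add: algebra_simps)
    then show ?thesis
      by (simp only: e1_def e2_def exp_add[symmetric] exp_le_cancel_iff)
  qed
  \<comment> \<open>This is where the constraint linking \<mu>', \<mu>'' and \<mu> is used: it gives
    the spectrogram the same weight for every admissible pair.\<close>
  have s: "2 * (s + \<mu>'') = 8 * K ^ 4 * m + \<mu>"
    unfolding s_def \<mu>[symmetric] by (simp add: algebra_simps power2_eq_square power4_eq_xxxx)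
  have B: "ennreal (exp (K * m * \<omega> (norm v)) * norm (Wig \<tau> g v)) \<le> ennreal (exp (K\<^sup>2 * m + K * \<mu>') / D) * GHL" for v
    unfolding D_def GHL_def by (rule weighted_Wig_bound) (use assms s_def in auto)
  have "(ennreal c)\<^sup>2 * x \<le> ennreal (exp (K * m + K\<^sup>2 * m)) * (ennreal (exp (K\<^sup>2 * m + K * \<mu>') / D) * GHL)
      * (\<integral>\<^sup>+z. ennreal (exp (s * \<omega> (norm z)) * norm (STFT g f z)) \<partial>lborel)\<^sup>2"
    unfolding c_def x_def by (rule weighted_Wig_le_STFT[OF f g \<tau> \<open>0 \<le> m\<close> Kms B])
  also have "\<dots> \<le> ennreal (exp (K * m + K\<^sup>2 * m)) * (ennreal (exp (K\<^sup>2 * m + K * \<mu>') / D) * GHL) * (S * L)"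
    unfolding S_def L_def s[symmetric] by (intro mult_left_mono STFT_weighted_L1_le f g \<open>1 \<le> p\<close>) simp
  finally have "ennreal D * ((ennreal c)\<^sup>2 * x) \<le> ennreal D * (ennreal (exp (K * m + K\<^sup>2 * m)) * (ennreal (exp (K\<^sup>2 * m + K * \<mu>') / D) * GHL) * (S * L))"
    by (rule mult_left_mono) simp
  also have "\<dots> = (ennreal D * ennreal (exp (K * m + K\<^sup>2 * m)) * ennreal (exp (K\<^sup>2 * m + K * \<mu>') / D)) * (GHL * (S * L))"
    by (simp only: mult_ac)
  also have "ennreal D * ennreal (exp (K * m + K\<^sup>2 * m)) * ennreal (exp (K\<^sup>2 * m + K * \<mu>') / D) = ennreal (exp (K * m + K\<^sup>2 * m) * exp (K\<^sup>2 * m + K * \<mu>'))"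
    using \<open>0 < D\<close> by (simp flip: ennreal_mult)
  also have "ennreal (exp (K * m + K\<^sup>2 * m) * exp (K\<^sup>2 * m + K * \<mu>')) * (GHL * (S * L)) \<le> ennreal (e1 * e2) * (GHL * (S * L))"
    by (intro mult_right_mono ennreal_leI exps) simp
  also have "ennreal D * ((ennreal c)\<^sup>2 * x) = x * d"
    using \<open>0 < D\<close> \<open>0 < c\<close> unfolding d by (simp add: ennreal_mult ennreal_power mult_ac)
  also have "ennreal (e1 * e2) * (GHL * (S * L)) = ennreal e1 * (S * (ennreal e2 * GHL * L))"
    by (simp add: e1_def e2_def ennreal_mult mult_ac)
  finally have "x * d / d \<le> ennreal e1 * (S * (ennreal e2 * GHL * L)) / d"
    by (rule divide_right_mono_ennreal)
  moreover have "d \<noteq> 0" "d \<noteq> top"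
    using \<open>0 < D\<close> \<open>0 < c\<close> unfolding d by auto
  ultimately have "x \<le> ennreal e1 * (S * (ennreal e2 * GHL * L)) / d"
    by (simp add: mult_divide_eq_ennreal)
  also have "\<dots> = ennreal e1 / d * S * (ennreal e2 * GHL * L)"
    by (simp add: divide_ennreal_def mult_ac)
  finally show "ennreal (exp (m * \<omega> (norm u)) * norm (Wig \<tau> f u))
    \<le> ennreal (exp (K / 2 * (1 + 2 * K) * m)) / d * Lp_norm p (weighted \<omega> (8 * K ^ 4 * m + \<mu>) (spectrogram g f)) *
      (ennreal (exp (K * (1 + 2 * K) * (4 * K\<^sup>2 * m + \<mu>'))) *
         Lp_norm \<infinity> (weighted \<omega> (K\<^sup>2 * (4 * K\<^sup>2 * m + \<mu>')) g) *
         Lp_norm \<infinity> (weighted \<omega> (K\<^sup>2 * (4 * K\<^sup>2 * m + \<mu>')) (fourier g)) *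
         Lp_norm 2 (\<lambda>z :: (real ^ 'n) \<times> (real ^ 'n). exp (- \<mu>' * \<omega> (norm z))) *
         (Lp_norm (conj_exponent (2 * p)) (\<lambda>z :: (real ^ 'n) \<times> (real ^ 'n). exp (- \<mu>'' * \<omega> (norm z))))\<^sup>2)"
    unfolding x_def e1_def e2_def GHL_def S_def L_def s_def by (simp only: mult.assoc)
qed

theorem Wig_bound_D6:
  fixes f g :: "real ^ 'n \<Rightarrow> complex"
  assumes f: "f \<in> S_space \<omega>" and g: "g \<in> S_space \<omega>" and nz: "g \<noteq> (\<lambda>_. 0)" and \<tau>: "0 < \<tau>" "\<tau> < 1"
    and "0 \<le> m" "1 \<le> p" and \<mu>: "\<mu> > 2 * real CARD('n) / b * (K\<^sup>2 + 2 / enn2real (conj_exponent (2 * p)))"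
  shows "ennreal (exp (m * \<omega> (norm u)) * norm (Wig \<tau> f u))
    \<le> D6 \<omega> K b \<tau> p m \<mu> g * Lp_norm p (weighted \<omega> (8 * K ^ 4 * m + \<mu>) (spectrogram g f))"
proof -
  note [measurable] = borel_measurable_S_space[OF f] borel_measurable_S_space[OF g]
  let ?N = "real CARD('n)" and ?r = "conj_exponent (2 * p)"
  let ?x = "ennreal (exp (m * \<omega> (norm u)) * norm (Wig \<tau> f u))"
  let ?S = "Lp_norm p (weighted \<omega> (8 * K ^ 4 * m + \<mu>) (spectrogram g f))"
  let ?d = "ennreal ((2 * pi) powr (5 / 2 * ?N) * (\<tau> - \<tau>\<^sup>2) powr (?N / 2)) * Lp_norm 2 g ^ 4"
  let ?A = "ennreal (exp (K / 2 * (1 + 2 * K) * m)) / ?d"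
  let ?T = "\<lambda>\<mu>' \<mu>''. ennreal (exp (K * (1 + 2 * K) * (4 * K\<^sup>2 * m + \<mu>'))) *
         Lp_norm \<infinity> (weighted \<omega> (K\<^sup>2 * (4 * K\<^sup>2 * m + \<mu>')) g) *
         Lp_norm \<infinity> (weighted \<omega> (K\<^sup>2 * (4 * K\<^sup>2 * m + \<mu>')) (fourier g)) *
         Lp_norm 2 (\<lambda>z :: (real ^ 'n) \<times> (real ^ 'n). exp (- \<mu>' * \<omega> (norm z))) *
         (Lp_norm ?r (\<lambda>z :: (real ^ 'n) \<times> (real ^ 'n). exp (- \<mu>'' * \<omega> (norm z))))\<^sup>2"
  let ?I = "{(\<mu>', \<mu>''). 2 * (K\<^sup>2 * \<mu>' + \<mu>'') = \<mu> \<and> \<mu>' > ?N / b \<and> \<mu>'' > 2 * ?N / (b * enn2real ?r)}"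
  have summand: "?x \<le> ?A * ?S * (case i of (\<mu>', \<mu>'') \<Rightarrow> ?T \<mu>' \<mu>'')" if i: "i \<in> ?I" for i
  proof (cases i)
    case (Pair \<mu>' \<mu>'')
    have "0 \<le> ?N / b" using b_pos by simp
    then show ?thesis
      using i Wig_bound_D6_summand(1)[OF f g nz \<tau> \<open>0 \<le> m\<close> _ \<open>1 \<le> p\<close>, of \<mu>' \<mu>'' \<mu> u] unfolding Pair by simp
  qed
  have "?I \<noteq> {}"
  proof -
    \<comment> \<open>The lower bound on \<mu> is the value of 2 (K^2 \<mu>' + \<mu>'') at the two
      excluded endpoints. The excess \<delta> is divided so that each parameter accounts for half of
      it.\<close>
    define \<delta> where "\<delta> = \<mu> - 2 * ?N / b * (K\<^sup>2 + 2 / enn2real ?r)"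
    have "0 < \<delta>" using \<mu> by (simp add: \<delta>_def)
    have "0 < K" using K_ge_1 by simp
    have "2 * (K\<^sup>2 * (?N / b + \<delta> / (4 * K\<^sup>2)) + (2 * ?N / (b * enn2real ?r) + \<delta> / 4)) = 2 * ?N / b * (K\<^sup>2 + 2 / enn2real ?r) + \<delta>"
      using \<open>0 < K\<close> by (simp add: algebra_simps)
    also have "\<dots> = \<mu>" by (simp add: \<delta>_def)
    finally have "(?N / b + \<delta> / (4 * K\<^sup>2), 2 * ?N / (b * enn2real ?r) + \<delta> / 4) \<in> ?I"
      using \<open>0 < \<delta>\<close> \<open>0 < K\<close> by simp
    then show ?thesis by blast
  qed
  then obtain i where i: "i \<in> ?I" by blast
  \<comment> \<open>The factor must be nonzero to be moved across the infimum. If it vanishes, a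
    single summand already forces the left side to be 0, which is why the index set had to be
    nonempty.\<close>
  have x: "?x \<le> (?A * ?S) * (INF i\<in>?I. case i of (\<mu>', \<mu>'') \<Rightarrow> ?T \<mu>' \<mu>'')"
  proof (cases "?S = 0")
    case True
    then show ?thesis using summand[OF i] by simp
  next
    case False
    obtain d' where d': "0 < d'" "?d = ennreal d'"
      using i Wig_bound_D6_summand(2)[OF f g nz \<tau> \<open>0 \<le> m\<close> order_refl \<open>1 \<le> p\<close> refl] by blast
    then have A: "?A = ennreal (exp (K / 2 * (1 + 2 * K) * m) / d')"
      by (simp add: divide_ennreal)
    have "spectrogram g f \<in> borel_measurable borel"
      unfolding spectrogram_def[abs_def] by measurable
    then have "?S < \<infinity>"
      by (intro decays_Lp_norm_finite decays_weighted decays_spectrogram f g \<open>1 \<le> p\<close>) measurable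
    then have "?A * ?S \<noteq> top" "?A * ?S \<noteq> 0"
      using False d' unfolding A by (auto simp: ennreal_mult_eq_top_iff)
    then show ?thesis
      by (intro le_times_INF_ennreal summand)
  qed
  show ?thesis
    using x unfolding D6_def Let_def by (simp only: mult_ac)
qed

end

theorem corollary3p8:
  fixes \<omega> :: "real \<Rightarrow> real" and K b \<tau> \<epsilon> :: real and p :: ennreal
    and E :: "((real ^ 'n) \<times> (real ^ 'n)) set"
  assumes "weight_function \<omega> K b"
    and "0 < \<tau>" "\<tau> < 1"
    and "E \<in> sets lebesgue"
    and "0 < \<epsilon>" "\<epsilon> < 1"
    and "1 \<le> p"
    and "(\<exists>(f :: real ^ 'n \<Rightarrow> complex) g lam.
            f \<in> S_space \<omega> \<and> g \<in> S_space \<omega> \<and> f \<noteq> (\<lambda>_. 0) \<and> g \<noteq> (\<lambda>_. 0) \<and> lam \<ge> 0 \<and>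
            (\<integral>\<^sup>+z\<in>E. ennreal (exp (lam * \<omega> (norm z)) * \<bar>spectrogram g f z\<bar>) \<partial>lebesgue)
              \<ge> ennreal (1 - \<epsilon>) * D5 \<omega> K \<tau> p lam g * Lp_norm p (weighted \<omega> (K * lam) (Wig \<tau> f)))
       \<or> (\<exists>(f :: real ^ 'n \<Rightarrow> complex) g lam \<mu>.
            f \<in> S_space \<omega> \<and> g \<in> S_space \<omega> \<and> f \<noteq> (\<lambda>_. 0) \<and> g \<noteq> (\<lambda>_. 0) \<and> lam \<ge> 0 \<and>
            \<mu> > 2 * real CARD('n) / b * (K\<^sup>2 + 2 / enn2real (conj_exponent (2 * p))) \<and>
            (\<integral>\<^sup>+z\<in>E. ennreal (exp (lam * \<omega> (norm z)) * cmod (Wig \<tau> f z)) \<partial>lebesgue)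
              \<ge> ennreal (1 - \<epsilon>) * D6 \<omega> K b \<tau> p lam \<mu> g *
                 Lp_norm p (weighted \<omega> (8 * K ^ 4 * lam + \<mu>) (spectrogram g f)))"
  shows "emeasure lebesgue E \<ge> ennreal (1 - \<epsilon>)"
  using assms(8)
proof (elim disjE exE conjE)
  interpret weight \<omega> K b
    by unfold_locales (rule assms(1))
  fix f g :: "real ^ 'n \<Rightarrow> complex" and lam
  assume f: "f \<in> S_space \<omega>" and g: "g \<in> S_space \<omega>" and nz: "f \<noteq> (\<lambda>_. 0)" "g \<noteq> (\<lambda>_. 0)" and "0 \<le> lam"
    and conc: "ennreal (1 - \<epsilon>) * D5 \<omega> K \<tau> p lam g * Lp_norm p (weighted \<omega> (K * lam) (Wig \<tau> f))
      \<le> (\<integral>\<^sup>+z\<in>E. ennreal (exp (lam * \<omega> (norm z)) * \<bar>spectrogram g f z\<bar>) \<partial>lebesgue)"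
  obtain C where C: "\<And>z. exp (lam * \<omega> (norm z)) * norm (spectrogram g f z) \<le> C"
    using decaysE[OF decays_spectrogram[OF f g]] by metis
  obtain z\<^sub>0 where "STFT g f z\<^sub>0 \<noteq> 0"
    using STFT_nonzero[OF f g nz] .
  show ?thesis
  proof (rule emeasure_ge_of_concentration[OF assms(4)])
    show "ennreal (exp (lam * \<omega> (norm z)) * \<bar>spectrogram g f z\<bar>) \<le> D5 \<omega> K \<tau> p lam g * Lp_norm p (weighted \<omega> (K * lam) (Wig \<tau> f))" for z
      by (rule spectrogram_bound[OF f g assms(2,3) \<open>0 \<le> lam\<close> assms(7)])
    show "ennreal (exp (lam * \<omega> (norm z\<^sub>0)) * \<bar>spectrogram g f z\<^sub>0\<bar>) \<noteq> 0"
      using \<open>STFT g f z\<^sub>0 \<noteq> 0\<close> by (simp add: spectrogram_def)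
    show "ennreal (exp (lam * \<omega> (norm z)) * \<bar>spectrogram g f z\<bar>) \<le> ennreal C" for z
      using C[of z] by (simp add: ennreal_leI)
  qed (use conc in \<open>simp add: mult.assoc\<close>)
next
  interpret weight \<omega> K b
    by unfold_locales (rule assms(1))
  fix f g :: "real ^ 'n \<Rightarrow> complex" and lam \<mu>
  assume f: "f \<in> S_space \<omega>" and g: "g \<in> S_space \<omega>" and nz: "f \<noteq> (\<lambda>_. 0)" "g \<noteq> (\<lambda>_. 0)" and "0 \<le> lam"
    and \<mu>: "\<mu> > 2 * real CARD('n) / b * (K\<^sup>2 + 2 / enn2real (conj_exponent (2 * p)))"
    and conc: "ennreal (1 - \<epsilon>) * D6 \<omega> K b \<tau> p lam \<mu> g * Lp_norm p (weighted \<omega> (8 * K ^ 4 * lam + \<mu>) (spectrogram g f))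
      \<le> (\<integral>\<^sup>+z\<in>E. ennreal (exp (lam * \<omega> (norm z)) * cmod (Wig \<tau> f z)) \<partial>lebesgue)"
  obtain C where C: "\<And>z. exp (lam * \<omega> (norm z)) * norm (Wig \<tau> f z) \<le> C"
    using decaysE[OF decays_Wig[OF f assms(2,3)]] by metis
  obtain z\<^sub>0 where "Wig \<tau> f z\<^sub>0 \<noteq> 0"
    using Wig_nonzero[OF f nz(1) assms(2,3)] .
  show ?thesis
  proof (rule emeasure_ge_of_concentration[OF assms(4)])
    show "ennreal (exp (lam * \<omega> (norm z)) * cmod (Wig \<tau> f z))
      \<le> D6 \<omega> K b \<tau> p lam \<mu> g * Lp_norm p (weighted \<omega> (8 * K ^ 4 * lam + \<mu>) (spectrogram g f))" for z
      by (rule Wig_bound_D6[OF f g nz(2) assms(2,3) \<open>0 \<le> lam\<close> assms(7) \<mu>])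
    show "ennreal (exp (lam * \<omega> (norm z\<^sub>0)) * cmod (Wig \<tau> f z\<^sub>0)) \<noteq> 0"
      using \<open>Wig \<tau> f z\<^sub>0 \<noteq> 0\<close> by simp
    show "ennreal (exp (lam * \<omega> (norm z)) * cmod (Wig \<tau> f z)) \<le> ennreal C" for z
      using C[of z] by (simp add: ennreal_leI)
  qed (use conc in \<open>simp add: mult.assoc\<close>)
qed

end
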